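(* Let $p$ be a prime and let $G=C_{p^{i_1}}\times\cdots\times C_{p^{i_n}}$ with $i_1,\dots,i_n\ge1$, where $C_{p^{i_k}}$ is cyclic of order $p^{i_k}$ with generator $g_k$. Let $\rho_k$ be the generating character of $R_{\mathbb C}(C_{p^{i_k}})$ sending $g_k$ to $e^{2\pi i/p^{i_k}}$ (with $i=\sqrt{-1}$ in the numerator), regarded as a character of $G$ via the projection $G\to C_{p^{i_k}}$. Then there is a well-defined ring homomorphism $$R^*_{\mathbb C}(G)\otimes_{\mathbb Z}\mathbb F_p\longrightarrow\frac{\mathbb F_p[u_1,\dots,u_n]}{(u_1^{p^{i_1}},\dots,u_n^{p^{i_n}})}$$ sending $c_1(\rho_k)$ to $u_k$ for each $k$.
   Context: Let $G$ be a finite group. $R_{\mathbb C}(G)$ is the ring of virtual complex characters of $G$ (the free abelian group on the irreducible complex characters, with product induced by tensor product), with augmentation $\epsilon:R_{\mathbb C}(G)\to\mathbb Z$ the degree map and $I=\ker\epsilon$. Exterior powers of representations give maps $\lambda^n$ on characters, extended to $R_{\mathbb C}(G)$ by requiring $\lambda^0=1$ and $\lambda^n(x+y)=\sum_{i+j=n}\lambda^i(x)\lambda^j(y)$. Put $\gamma^n(x)=\lambda^n(x+n-1)$. Let $\Gamma^n\subseteq R_{\mathbb C}(G)$ be the additive subgroup generated by all products $\gamma^{i_1}(x_1)\cdots\gamma^{i_r}(x_r)$ with $x_j\in I$ and $\sum_j i_j\ge n$; then $\Gamma^0=R_{\mathbb C}(G)$, $\Gamma^1=I$, $\Gamma^m\Gamma^n\subseteq\Gamma^{m+n}$.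 The graded character ring is $R^*_{\mathbb C}(G)=\bigoplus_{n\ge0}\Gamma^n/\Gamma^{n+1}$. The $n$-th Chern class of $\rho\in R_{\mathbb C}(G)$ is the class $c_n(\rho)\in\Gamma^n/\Gamma^{n+1}$ of $\gamma^n(\rho-\epsilon(\rho))$; for a one-dimensional character $\rho$, $c_1(\rho)$ is the class of $\rho-1$. *)

theory Defs
  imports
    Complex_Main
    "HOL-Algebra.Product_Groups"
    "HOL-Algebra.Free_Abelian_Groups"
    "HOL-Algebra.QuotRing"
    "HOL-Algebra.Indexed_Polynomials"
    "HOL-Number_Theory.Residues"
    "Jordan_Normal_Form.VS_Connect"
begin

text \<open>Representations are in matrix form: homomorphisms into the general linear group
  of degree \<open>d\<close>, with \<open>d = 0\<close> allowed.\<close>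

definition matrix_rep :: "('g, 'b) monoid_scheme \<Rightarrow> nat \<Rightarrow> ('g \<Rightarrow> complex mat) \<Rightarrow> bool" where
  "matrix_rep G d r \<longleftrightarrow> r \<in> hom G (units_of (ring_mat TYPE(complex) d ()))"

definition irreducible_rep :: "('g, 'b) monoid_scheme \<Rightarrow> nat \<Rightarrow> ('g \<Rightarrow> complex mat) \<Rightarrow> bool" where
  "irreducible_rep G d r \<longleftrightarrow> matrix_rep G d r \<and> d > 0 \<and>
     (\<forall>W. VectorSpace.subspace class_ring W (module_vec TYPE(complex) d) \<and>
          (\<forall>g\<in>carrier G. \<forall>w\<in>W. r g *\<^sub>v w \<in> W)
        \<longrightarrow> W = {0\<^sub>v d} \<or> W = carrier_vec d)"

definition mat_trace :: "complex mat \<Rightarrow> complex" where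
  "mat_trace A = (\<Sum>i<dim_row A. A $$ (i, i))"

definition character :: "('g, 'b) monoid_scheme \<Rightarrow> ('g \<Rightarrow> complex mat) \<Rightarrow> 'g \<Rightarrow> complex" where
  "character G r = (\<lambda>g\<in>carrier G. mat_trace (r g))"

definition irreducible_characters :: "('g, 'b) monoid_scheme \<Rightarrow> ('g \<Rightarrow> complex) set" where
  "irreducible_characters G = {character G r |d r. irreducible_rep G d r}"

definition linear_characters :: "('g, 'b) monoid_scheme \<Rightarrow> ('g \<Rightarrow> complex) set" where
  "linear_characters G = {character G r |r. matrix_rep G 1 r}"

definition function_ring :: "('g, 'b) monoid_scheme \<Rightarrow> ('g \<Rightarrow> complex) ring" where
  "function_ring G =
    \<lparr>carrier = carrier G \<rightarrow>\<^sub>E UNIV,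
     monoid.mult = (\<lambda>x y. \<lambda>g\<in>carrier G. x g * y g),
     one = (\<lambda>g\<in>carrier G. 1),
     zero = (\<lambda>g\<in>carrier G. 0),
     add = (\<lambda>x y. \<lambda>g\<in>carrier G. x g + y g)\<rparr>"

text \<open>The free abelian group on the irreducible characters is realised as the additive group they
  generate inside the functions on \<open>G\<close> (they are linearly independent); the product
  induced by the tensor product is then the pointwise one.\<close>

definition character_ring :: "('g, 'b) monoid_scheme \<Rightarrow> ('g \<Rightarrow> complex) ring" where
  "character_ring G =
    (function_ring G)\<lparr>carrier := generate (add_monoid (function_ring G)) (irreducible_characters G)\<rparr>"

text \<open>The degree of a character is its value at the identity.\<close>

definition augmentation :: "('g, 'b) monoid_scheme \<Rightarrow> ('g \<Rightarrow> complex) \<Rightarrow> int" where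
  "augmentation G x = (THE d. x \<one>\<^bsub>G\<^esub> = of_int d)"

definition augmentation_ideal :: "('g, 'b) monoid_scheme \<Rightarrow> ('g \<Rightarrow> complex) set" where
  "augmentation_ideal G = {x \<in> carrier (character_ring G). augmentation G x = 0}"

text \<open>The matrix of the \<open>k\<close>-th exterior power of \<open>A\<close> in the basis of the
  \<open>e\<^bsub>s 0\<^esub> \<and> \<dots> \<and> e\<^bsub>s (k - 1)\<^esub>\<close>, where \<open>s\<close> runs through the
  increasing lists of length \<open>k\<close> in \<open>{..<d}\<close>: its entries are the minors of size \<open>k\<close>.\<close>

definition increasing_lists :: "nat \<Rightarrow> nat \<Rightarrow> nat list list" where
  "increasing_lists d k = filter (\<lambda>s. length s = k) (subseqs [0..<d])"

definition exterior_power_mat :: "nat \<Rightarrow> complex mat \<Rightarrow> complex mat" where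
  "exterior_power_mat k A =
    (let S = increasing_lists (dim_row A) k in
     mat (length S) (length S) (\<lambda>(i, j). det (mat k k (\<lambda>(a, b). A $$ (S ! i ! a, S ! j ! b)))))"

text \<open>The extension of the exterior powers to virtual characters is determined uniquely by these
  conditions because every virtual character is a difference of characters.\<close>

definition lambda_op :: "('g, 'b) monoid_scheme \<Rightarrow> nat \<Rightarrow> ('g \<Rightarrow> complex) \<Rightarrow> 'g \<Rightarrow> complex" where
  "lambda_op G = (THE L.
     (\<forall>n. L n \<in> carrier (character_ring G) \<rightarrow>\<^sub>E carrier (character_ring G)) \<and>
     (\<forall>n d r. matrix_rep G d r \<longrightarrow>
        L n (character G r) = character G (\<lambda>g. exterior_power_mat n (r g))) \<and>
     (\<forall>x\<in>carrier (character_ring G). L 0 x = \<one>\<^bsub>character_ring G\<^esub>) \<and>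
     (\<forall>n. \<forall>x\<in>carrier (character_ring G). \<forall>y\<in>carrier (character_ring G).
        L n (x \<oplus>\<^bsub>character_ring G\<^esub> y) =
          (\<Oplus>\<^bsub>character_ring G\<^esub>i\<in>{..n}. L i x \<otimes>\<^bsub>character_ring G\<^esub> L (n - i) y)))"

definition gamma_op :: "('g, 'b) monoid_scheme \<Rightarrow> nat \<Rightarrow> ('g \<Rightarrow> complex) \<Rightarrow> 'g \<Rightarrow> complex" where
  "gamma_op G n x =
    lambda_op G n (x \<oplus>\<^bsub>character_ring G\<^esub>
      add_pow (character_ring G) (int n - 1) \<one>\<^bsub>character_ring G\<^esub>)"

definition gamma_product :: "('g, 'b) monoid_scheme \<Rightarrow> (nat \<times> ('g \<Rightarrow> complex)) list \<Rightarrow> 'g \<Rightarrow> complex"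
  where "gamma_product G ps =
    foldr (\<lambda>(i, x) y. gamma_op G i x \<otimes>\<^bsub>character_ring G\<^esub> y) ps \<one>\<^bsub>character_ring G\<^esub>"

definition gamma_filtration :: "('g, 'b) monoid_scheme \<Rightarrow> nat \<Rightarrow> ('g \<Rightarrow> complex) set" where
  "gamma_filtration G n = generate (add_monoid (character_ring G))
     {gamma_product G ps |ps. snd ` set ps \<subseteq> augmentation_ideal G \<and> n \<le> sum_list (map fst ps)}"

text \<open>For a decreasing filtration \<open>F\<close> of the ring \<open>R\<close> by additive subgroups
  with \<open>F m F n \<subseteq> F (m + n)\<close> and \<open>F 0 = R\<close>.\<close>

definition graded_piece :: "('a, 'c) ring_scheme \<Rightarrow> (nat \<Rightarrow> 'a set) \<Rightarrow> nat \<Rightarrow> 'a set monoid" where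
  "graded_piece R F n = (add_monoid R)\<lparr>carrier := F n\<rparr> Mod F (Suc n)"

text \<open>The element of degree \<open>n\<close> given by the class of \<open>a \<in> F n\<close>; the zero of the
  piece of degree \<open>m\<close> is the coset \<open>F (Suc m)\<close>.\<close>

definition homogeneous :: "('a, 'c) ring_scheme \<Rightarrow> (nat \<Rightarrow> 'a set) \<Rightarrow> nat \<Rightarrow> 'a \<Rightarrow> nat \<Rightarrow> 'a set"
  where "homogeneous R F n a = (\<lambda>m. if m = n then F (Suc n) +>\<^bsub>R\<^esub> a else F (Suc m))"

definition graded_ring :: "('a, 'c) ring_scheme \<Rightarrow> (nat \<Rightarrow> 'a set) \<Rightarrow> (nat \<Rightarrow> 'a set) ring" where
  "graded_ring R F =
    \<lparr>carrier = carrier (sum_group UNIV (graded_piece R F)),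
     monoid.mult = (\<lambda>x y n. finprod (graded_piece R F n)
        (\<lambda>i. rcoset_mult R (F (Suc n)) (x i) (y (n - i))) {..n}),
     one = homogeneous R F 0 \<one>\<^bsub>R\<^esub>,
     zero = \<one>\<^bsub>sum_group UNIV (graded_piece R F)\<^esub>,
     add = monoid.mult (sum_group UNIV (graded_piece R F))\<rparr>"

definition graded_character_ring :: "('g, 'b) monoid_scheme \<Rightarrow> (nat \<Rightarrow> ('g \<Rightarrow> complex) set) ring" where
  "graded_character_ring G = graded_ring (character_ring G) (gamma_filtration G)"

definition chern_class ::
  "('g, 'b) monoid_scheme \<Rightarrow> nat \<Rightarrow> ('g \<Rightarrow> complex) \<Rightarrow> nat \<Rightarrow> ('g \<Rightarrow> complex) set" where
  "chern_class G n x = homogeneous (character_ring G) (gamma_filtration G) n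
     (gamma_op G n (x \<ominus>\<^bsub>character_ring G\<^esub>
        add_pow (character_ring G) (augmentation G x) \<one>\<^bsub>character_ring G\<^esub>))"

text \<open>The tensor product is the free abelian group on \<open>A \<times> B\<close> modulo the subgroup
  generated by the biadditivity relations, with
  \<open>(a \<otimes> b) (a' \<otimes> b') = a a' \<otimes> b b'\<close>. The ring \<open>pair_ring\<close> carries the biadditive
  extension of this product to the free abelian group.\<close>

definition pair_ring ::
  "('a, 'c) ring_scheme \<Rightarrow> ('b, 'd) ring_scheme \<Rightarrow> ('a \<times> 'b \<Rightarrow>\<^sub>0 int) ring" where
  "pair_ring A B =
    \<lparr>carrier = carrier (free_Abelian_group (carrier A \<times> carrier B)),
     monoid.mult = (\<lambda>x y. frag_extend (\<lambda>(a, b). frag_extend (\<lambda>(a', b').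
        frag_of (a \<otimes>\<^bsub>A\<^esub> a', b \<otimes>\<^bsub>B\<^esub> b')) y) x),
     one = frag_of (\<one>\<^bsub>A\<^esub>, \<one>\<^bsub>B\<^esub>),
     zero = 0,
     add = (+)\<rparr>"

definition tensor_relations ::
  "('a, 'c) ring_scheme \<Rightarrow> ('b, 'd) ring_scheme \<Rightarrow> ('a \<times> 'b \<Rightarrow>\<^sub>0 int) set" where
  "tensor_relations A B = generate (free_Abelian_group (carrier A \<times> carrier B))
    ({frag_of (a \<oplus>\<^bsub>A\<^esub> a', b) - frag_of (a, b) - frag_of (a', b) |a a' b.
        a \<in> carrier A \<and> a' \<in> carrier A \<and> b \<in> carrier B} \<union>
     {frag_of (a, b \<oplus>\<^bsub>B\<^esub> b') - frag_of (a, b) - frag_of (a, b') |a b b'.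
        a \<in> carrier A \<and> b \<in> carrier B \<and> b' \<in> carrier B})"

definition tensor_ring ::
  "('a, 'c) ring_scheme \<Rightarrow> ('b, 'd) ring_scheme \<Rightarrow> ('a \<times> 'b \<Rightarrow>\<^sub>0 int) set ring" where
  "tensor_ring A B = pair_ring A B Quot tensor_relations A B"

definition pure_tensor ::
  "('a, 'c) ring_scheme \<Rightarrow> ('b, 'd) ring_scheme \<Rightarrow> 'a \<Rightarrow> 'b \<Rightarrow> ('a \<times> 'b \<Rightarrow>\<^sub>0 int) set" where
  "pure_tensor A B a b = tensor_relations A B +>\<^bsub>pair_ring A B\<^esub> frag_of (a, b)"

text \<open>Polynomials over \<open>R\<close> in variables indexed by \<open>V\<close> in the library's
  representation by coefficient functions on multisets of variables; the library provides the
  carrier, the constants, the variables and the sum, but not the product of two polynomials.\<close>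

definition indexed_poly_ring :: "('a, 'c) ring_scheme \<Rightarrow> 'v set \<Rightarrow> ('v multiset \<Rightarrow> 'a) ring" where
  "indexed_poly_ring R V =
    \<lparr>carrier = ring.indexed_pset R V (carrier R),
     monoid.mult = (\<lambda>P Q m. \<Oplus>\<^bsub>R\<^esub>a\<in>{a. a \<subseteq># m}. P a \<otimes>\<^bsub>R\<^esub> Q (m - a)),
     one = ring.indexed_const R \<one>\<^bsub>R\<^esub>,
     zero = ring.indexed_const R \<zero>\<^bsub>R\<^esub>,
     add = ring.indexed_padd R\<rparr>"

definition truncation_ideal ::
  "('a, 'c) ring_scheme \<Rightarrow> 'v set \<Rightarrow> ('v \<Rightarrow> nat) \<Rightarrow> ('v multiset \<Rightarrow> 'a) set" where
  "truncation_ideal R V q = genideal (indexed_poly_ring R V)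
     ((\<lambda>k. ring.indexed_var R k [^]\<^bsub>indexed_poly_ring R V\<^esub> q k) ` V)"

definition truncated_poly_ring ::
  "('a, 'c) ring_scheme \<Rightarrow> 'v set \<Rightarrow> ('v \<Rightarrow> nat) \<Rightarrow> ('v multiset \<Rightarrow> 'a) set ring" where
  "truncated_poly_ring R V q = indexed_poly_ring R V Quot truncation_ideal R V q"

definition truncated_var ::
  "('a, 'c) ring_scheme \<Rightarrow> 'v set \<Rightarrow> ('v \<Rightarrow> nat) \<Rightarrow> 'v \<Rightarrow> ('v multiset \<Rightarrow> 'a) set" where
  "truncated_var R V q k =
     truncation_ideal R V q +>\<^bsub>indexed_poly_ring R V\<^esub> ring.indexed_var R k"

end

theory Submission
  imports Defs "Jordan_Normal_Form.Schur_Decomposition" "HOL-Computational_Algebra.Polynomial_FPS"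
begin

text \<open>
  Write \<open>q\<^sub>k = p\<^sup>e\<^sup>k\<close>. Every virtual character of \<open>G\<close> is an integer combination of the linear
  characters \<open>\<sigma> a = \<Prod> \<rho>\<^sub>k\<^sup>a\<^sup>k\<close>, and sending \<open>\<rho>\<^sub>k\<close> to \<open>1 + u\<^sub>k\<close> is compatible with the relations
  \<open>\<rho>\<^sub>k\<^sup>q\<^sup>k = 1\<close> because \<open>(1 + u\<^sub>k)\<^sup>q\<^sup>k = 1 + u\<^sub>k\<^sup>q\<^sup>k = 1\<close> in the truncated polynomial ring over \<open>F\<^sub>p\<close>.
  For \<open>x = \<Sum> N\<^sub>a (\<sigma> a - 1)\<close> in the augmentation ideal, \<open>\<gamma>\<^sup>i(x)\<close> is the coefficient of \<open>t\<^sup>i\<close> in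
  \<open>\<Prod> (1 + (\<sigma> a - 1) t)\<^sup>N\<^sup>a\<close>; as \<open>\<sigma> a - 1\<close> has no constant term in the \<open>u\<^sub>k\<close>, its image has only
  terms of degree at least \<open>i\<close>. So the \<open>\<gamma>\<close>-filtration maps into the filtration by degree, and the
  homomorphism is obtained by passing to the associated graded rings.
\<close>

section \<open>Tensor products of rings\<close>

text \<open>The graded character ring comes without generators and relations, so a homomorphism
  cannot simply be prescribed on Chern classes: it is built on the filtered character ring and made
  graded afterwards. The relations \<rho>^q = 1 survive the substitution only modulo p and the
  truncation, so there is no map from virtual characters to integral polynomials. A relation between
  the two is used instead; its ambiguity is an ideal that dies in the target, and orthogonality of
  the linear characters is what bounds the ambiguity. The other obstacle is that the
  \<lambda>-operations are given by a definite description, which yields nothing before existence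
  and uniqueness are known. Existence on virtual characters comes from the values x(g^(k+1)): they
  are additive in x, and exponentiating them gives a multiplicative series, which agrees with the
  exterior powers by a comparison of eigenvalues. Negative multiplicities then mean division by
  power series with constant term 1.\<close>

abbreviation keys :: "('v \<Rightarrow>\<^sub>0 int) \<Rightarrow> 'v set" where
  "keys \<equiv> Poly_Mapping.keys"

text \<open>The universal property of the tensor product, by extending the biadditive map (a, b) to
  f(a) k(b) over the free abelian group and checking that it kills the relations. The first factor
  enters through closure conditions alone, because the graded ring to which this is applied is never
  shown to satisfy the ring axioms.\<close>

lemma tensor_ring_hom:
  fixes A :: "('a, 'c) ring_scheme" and B :: "('b, 'd) ring_scheme"
    and T :: "('t, 'e) ring_scheme" (structure)
  assumes T: "cring T"
    and A: "\<one>\<^bsub>A\<^esub> \<in> carrier A"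
      "\<And>x y. x \<in> carrier A \<Longrightarrow> y \<in> carrier A \<Longrightarrow> x \<otimes>\<^bsub>A\<^esub> y \<in> carrier A"
      "\<And>x y. x \<in> carrier A \<Longrightarrow> y \<in> carrier A \<Longrightarrow> x \<oplus>\<^bsub>A\<^esub> y \<in> carrier A"
    and B: "ring B"
    and f: "f \<in> Ring.ring_hom A T" and k: "k \<in> Ring.ring_hom B T"
  shows "\<exists>h \<in> Ring.ring_hom (tensor_ring A B) T.
    \<forall>a\<in>carrier A. \<forall>b\<in>carrier B. h (pure_tensor A B a b) = f a \<otimes> k b"
proof -
  interpret T: cring T by (rule T)
  interpret B: ring B by (rule B)
  define S where "S = carrier A \<times> carrier B"
  define I where "I = tensor_relations A B"
  define P where "P = pair_ring A B"
  note f_simps = ring_hom_closed[OF f] ring_hom_mult[OF f] ring_hom_add[OF f] ring_hom_one[OF f]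
  note k_simps = ring_hom_closed[OF k] ring_hom_mult[OF k] ring_hom_add[OF k] ring_hom_one[OF k]
  have "(\<lambda>(a, b). f a \<otimes> k b) ` S \<subseteq> carrier (add_monoid T)"
    using f_simps k_simps by (auto simp: S_def)
  then obtain h0 where h0: "h0 \<in> hom (free_Abelian_group S) (add_monoid T)"
      and h0_frag: "\<And>x. x \<in> S \<Longrightarrow> h0 (frag_of x) = (\<lambda>(a, b). f a \<otimes> k b) x"
    using comm_group.free_Abelian_group_universal[OF T.a_comm_group] by metis
  interpret h0: group_hom "free_Abelian_group S" "add_monoid T" h0
    using h0 T.add.is_group by (simp add: group_hom_def group_hom_axioms_def)
  have h0_closed: "h0 x \<in> carrier T" if "keys x \<subseteq> S" for x
    using h0.hom_closed[of x] that by simp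
  have h0_add: "h0 (x + y) = h0 x \<oplus> h0 y"
    if "keys x \<subseteq> S" "keys y \<subseteq> S" for x y
    using h0.hom_mult[of x y] that by simp
  have h0_zero: "h0 0 = \<zero>" using h0.hom_one by simp
  have h0_minus: "h0 (- x) = \<ominus> h0 x" if "keys x \<subseteq> S" for x
    using h0.hom_inv[of x] that by (simp add: a_inv_def)
  have h0_diff: "h0 (x - y) = h0 x \<ominus> h0 y"
    if "keys x \<subseteq> S" "keys y \<subseteq> S" for x y
    using h0_add[of x "- y"] h0_minus[of y] that by (simp add: a_minus_def)
  have keys_diff': "keys (x - y) \<subseteq> S"
    if "keys x \<subseteq> S" "keys y \<subseteq> S" for x y :: "'a \<times> 'b \<Rightarrow>\<^sub>0 int"
    using that keys_diff[of x y] by blast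
  have keys_add': "keys (x + y) \<subseteq> S"
    if "keys x \<subseteq> S" "keys y \<subseteq> S" for x y :: "'a \<times> 'b \<Rightarrow>\<^sub>0 int"
    using that keys_add[of x y] by blast
  define gens where "gens =
    {frag_of (a \<oplus>\<^bsub>A\<^esub> a', b) - frag_of (a, b) - frag_of (a', b) |a a' b.
        a \<in> carrier A \<and> a' \<in> carrier A \<and> b \<in> carrier B} \<union>
     {frag_of (a, b \<oplus>\<^bsub>B\<^esub> b') - frag_of (a, b) - frag_of (a, b') |a b b'.
        a \<in> carrier A \<and> b \<in> carrier B \<and> b' \<in> carrier B}"
  have gens: "keys x \<subseteq> S \<and> h0 x = \<zero>" if "x \<in> gens" for x
  proof -
    \<comment> \<open>Both families of relations have the shape u - v - w, and distributivity in T
      gives the required value of \<open>h0\<close> at u in either case.\<close>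
    have collapse: "keys (frag_of u - frag_of v - frag_of w) \<subseteq> S \<and>
        h0 (frag_of u - frag_of v - frag_of w) = \<zero>"
      if "u \<in> S" "v \<in> S" "w \<in> S" "h0 (frag_of u) = h0 (frag_of v) \<oplus> h0 (frag_of w)" for u v w
    proof -
      have ks: "keys (frag_of u) \<subseteq> S" "keys (frag_of v) \<subseteq> S"
        "keys (frag_of w) \<subseteq> S" using that by auto
      have "h0 (frag_of u - frag_of v - frag_of w) =
          (h0 (frag_of v) \<oplus> h0 (frag_of w)) \<ominus> h0 (frag_of v) \<ominus> h0 (frag_of w)"
        using ks keys_diff' by (simp add: h0_diff that(4))
      also have "\<dots> = \<zero>"
        using h0_closed[OF ks(2)] h0_closed[OF ks(3)] by algebra
      finally show ?thesis using ks keys_diff' by auto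
    qed
    from that show ?thesis
      unfolding gens_def
    proof (elim UnE CollectE exE conjE)
      fix a a' b assume x: "x = frag_of (a \<oplus>\<^bsub>A\<^esub> a', b) - frag_of (a, b) - frag_of (a', b)"
        and ab: "a \<in> carrier A" "a' \<in> carrier A" "b \<in> carrier B"
      show ?thesis unfolding x
        by (rule collapse) (use ab A in \<open>auto simp: S_def h0_frag f_simps k_simps T.l_distr\<close>)
    next
      fix a b b' assume x: "x = frag_of (a, b \<oplus>\<^bsub>B\<^esub> b') - frag_of (a, b) - frag_of (a, b')"
        and ab: "a \<in> carrier A" "b \<in> carrier B" "b' \<in> carrier B"
      show ?thesis unfolding x
        by (rule collapse) (use ab A in \<open>auto simp: S_def h0_frag f_simps k_simps T.r_distr\<close>)
    qed
  qed
  have I: "keys x \<subseteq> S \<and> h0 x = \<zero>" if "x \<in> I" for x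
  proof -
    have "x \<in> generate (free_Abelian_group S) gens"
      using that by (simp add: I_def tensor_relations_def gens_def S_def)
    then show ?thesis
    proof (induction rule: generate.induct)
      case one then show ?case by (simp add: h0_zero)
    next
      case (incl h) then show ?case by (rule gens)
    next
      case (inv h) then show ?case using gens[OF inv] by (simp add: h0_minus)
    next
      case (eng a b) then show ?case using keys_add' by (simp add: h0_add)
    qed
  qed
  have I0: "0 \<in> I"
    using generate.one[of "free_Abelian_group S" gens]
    by (simp add: I_def tensor_relations_def gens_def S_def)
  have coset: "I +>\<^bsub>P\<^esub> x = {i + x |i. i \<in> I}" for x
    by (auto simp: P_def pair_ring_def a_r_coset_def r_coset_def)
  have h0_coset: "keys y \<subseteq> S \<and> h0 y = h0 x"
    if "y \<in> I +>\<^bsub>P\<^esub> x" "keys x \<subseteq> S" for x y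
  proof -
    have "y \<in> {i + x |i. i \<in> I}" using that(1) by (simp add: coset)
    then obtain i where i: "i \<in> I" "y = i + x" by blast
    show ?thesis using I[OF i(1)] that(2) keys_add'[of i x] h0_closed[of x] by (simp add: i h0_add)
  qed
  have self: "x \<in> I +>\<^bsub>P\<^esub> x" for x using I0 by (force simp: coset)
  have carrP: "carrier P = {x. keys x \<subseteq> S}"
    by (auto simp: P_def pair_ring_def S_def)
  have mult1: "frag_of (a, b) \<otimes>\<^bsub>P\<^esub> y =
      frag_extend (\<lambda>(a', b'). frag_of (a \<otimes>\<^bsub>A\<^esub> a', b \<otimes>\<^bsub>B\<^esub> b')) y" for a b y
    by (simp add: P_def pair_ring_def)
  have mult_diff: "(x - y) \<otimes>\<^bsub>P\<^esub> z = (x \<otimes>\<^bsub>P\<^esub> z) - (y \<otimes>\<^bsub>P\<^esub> z)" for x y z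
    by (simp add: P_def pair_ring_def frag_extend_diff)
  \<comment> \<open>Both sides are biadditive, so an induction in each argument reduces the claim to
    two generators. There commutativity of T exchanges the two middle factors.\<close>
  have mult: "keys (x \<otimes>\<^bsub>P\<^esub> y) \<subseteq> S \<and> h0 (x \<otimes>\<^bsub>P\<^esub> y) = h0 x \<otimes> h0 y"
    if x: "keys x \<subseteq> S" and y: "keys y \<subseteq> S" for x y
    using x
  proof (induction x rule: free_Abelian_group_induct[consumes 1, case_names zero diff one])
    case zero
    then show ?case using h0_closed[OF y] by (simp add: P_def pair_ring_def h0_zero)
  next
    case (diff x x')
    then show ?case using h0_closed keys_diff' y
      by (simp add: mult_diff h0_diff) (simp add: a_minus_def T.l_distr T.l_minus)
  next
    case (one u)
    obtain a b where u: "u = (a, b)" "a \<in> carrier A" "b \<in> carrier B"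
      using one by (auto simp: S_def)
    have uc: "h0 (frag_of u) \<in> carrier T" using h0_closed one by simp
    show ?case using y
    proof (induction y rule: free_Abelian_group_induct[consumes 1, case_names zero diff one])
      case zero
      then show ?case using uc by (simp add: u mult1 h0_zero)
    next
      case (diff y y')
      then show ?case using h0_closed keys_diff' uc
        by (simp add: u mult1 frag_extend_diff h0_diff) (simp add: a_minus_def T.r_distr T.r_minus)
    next
      case (one v)
      then show ?case using u A
        by (auto simp: mult1 S_def h0_frag f_simps k_simps T.m_ac)
    qed
  qed
  \<comment> \<open>Well defined on cosets because \<open>h0\<close> is constant on each of
    them.\<close>
  define h where "h = (\<lambda>Z. the_elem (h0 ` Z))"
  have h_eq: "h Z = c" if "z \<in> Z" "\<And>z. z \<in> Z \<Longrightarrow> h0 z = c" for Z c z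
  proof -
    have "h0 ` Z = {c}" using that by blast
    then show ?thesis by (simp add: h_def)
  qed
  have h_coset: "h (I +>\<^bsub>P\<^esub> x) = h0 x" if "keys x \<subseteq> S" for x
    by (rule h_eq[OF self]) (use h0_coset that in blast)
  have Tens: "tensor_ring A B = P Quot I" by (simp add: tensor_ring_def P_def I_def)
  have carr: "carrier (P Quot I) = {I +>\<^bsub>P\<^esub> x |x. keys x \<subseteq> S}"
    by (auto simp: FactRing_def A_RCOSETS_def RCOSETS_def a_r_coset_def carrP)
  have "h \<in> Ring.ring_hom (P Quot I) T"
  proof (rule ring_hom_memI)
    fix Z1 assume "Z1 \<in> carrier (P Quot I)"
    then show "h Z1 \<in> carrier T" using h_coset h0_closed by (auto simp: carr)
  next
    fix Z1 Z2 assume "Z1 \<in> carrier (P Quot I)" "Z2 \<in> carrier (P Quot I)"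
    then obtain x y where Z1: "Z1 = I +>\<^bsub>P\<^esub> x" and Z2: "Z2 = I +>\<^bsub>P\<^esub> y"
      and x: "keys x \<subseteq> S" and y: "keys y \<subseteq> S"
      by (auto simp: carr)
    \<comment> \<open>The product of two cosets is by definition a union of cosets. That I is an
      ideal has not been established, so this union is not known to be a single coset; constancy of
      \<open>h0\<close> on it is enough.\<close>
    have prod: "Z1 \<otimes>\<^bsub>P Quot I\<^esub> Z2 = (\<Union>a\<in>Z1. \<Union>b\<in>Z2. I +>\<^bsub>P\<^esub> (a \<otimes>\<^bsub>P\<^esub> b))"
      by (simp add: FactRing_def rcoset_mult_def)
    have "h (Z1 \<otimes>\<^bsub>P Quot I\<^esub> Z2) = h0 x \<otimes> h0 y"
    proof (rule h_eq)
      show "x \<otimes>\<^bsub>P\<^esub> y \<in> Z1 \<otimes>\<^bsub>P Quot I\<^esub> Z2"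
        unfolding prod unfolding Z1 Z2 using self by blast
    next
      fix z assume "z \<in> Z1 \<otimes>\<^bsub>P Quot I\<^esub> Z2"
      then obtain a b where ab: "a \<in> Z1" "b \<in> Z2" "z \<in> I +>\<^bsub>P\<^esub> (a \<otimes>\<^bsub>P\<^esub> b)"
        unfolding prod by blast
      then show "h0 z = h0 x \<otimes> h0 y"
        using h0_coset[OF ab(3)] mult[of a b] h0_coset[OF ab(1)[unfolded Z1] x]
          h0_coset[OF ab(2)[unfolded Z2] y] by simp
    qed
    then show "h (Z1 \<otimes>\<^bsub>P Quot I\<^esub> Z2) = h Z1 \<otimes> h Z2"
      by (simp add: Z1 Z2 h_coset x y)
    have sum: "Z1 \<oplus>\<^bsub>P Quot I\<^esub> Z2 = {a + b |a b. a \<in> Z1 \<and> b \<in> Z2}"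
      by (auto simp: FactRing_def set_add_def set_mult_def P_def pair_ring_def)
    have "h (Z1 \<oplus>\<^bsub>P Quot I\<^esub> Z2) = h0 x \<oplus> h0 y"
    proof (rule h_eq)
      show "x + y \<in> Z1 \<oplus>\<^bsub>P Quot I\<^esub> Z2"
        unfolding sum unfolding Z1 Z2 using self by blast
    next
      fix z assume "z \<in> Z1 \<oplus>\<^bsub>P Quot I\<^esub> Z2"
      then obtain a b where ab: "a \<in> Z1" "b \<in> Z2" "z = a + b"
        unfolding sum by blast
      then show "h0 z = h0 x \<oplus> h0 y"
        using h0_coset[OF ab(1)[unfolded Z1] x]
          h0_coset[OF ab(2)[unfolded Z2] y] by (simp add: h0_add)
    qed
    then show "h (Z1 \<oplus>\<^bsub>P Quot I\<^esub> Z2) = h Z1 \<oplus> h Z2"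
      by (simp add: Z1 Z2 h_coset x y)
  next
    have "\<one>\<^bsub>P Quot I\<^esub> = I +>\<^bsub>P\<^esub> frag_of (\<one>\<^bsub>A\<^esub>, \<one>\<^bsub>B\<^esub>)"
      by (simp add: FactRing_def P_def pair_ring_def)
    then show "h \<one>\<^bsub>P Quot I\<^esub> = \<one>"
      using A(1) by (simp add: h_coset S_def h0_frag f_simps k_simps)
  qed
  moreover have "h (pure_tensor A B a b) = f a \<otimes> k b" if "a \<in> carrier A" "b \<in> carrier B" for a b
    using that by (simp add: pure_tensor_def flip: P_def I_def, subst h_coset)
      (auto simp: S_def h0_frag)
  ultimately show ?thesis unfolding Tens by blast
qed

section \<open>Graded rings of filtrations\<close>

locale ring_filtration = ring R for R (structure) +
  fixes F :: "nat \<Rightarrow> 'a set"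
  assumes filtration_subgroup: "subgroup (F n) (add_monoid R)"
    and filtration_Suc: "F (Suc n) \<subseteq> F n"
    and filtration_mult: "a \<in> F m \<Longrightarrow> b \<in> F n \<Longrightarrow> a \<otimes> b \<in> F (m + n)"
    and filtration_one: "\<one> \<in> F 0"
begin

abbreviation "GR \<equiv> graded_ring R F"
abbreviation "GP \<equiv> graded_piece R F"

abbreviation cls :: "nat \<Rightarrow> 'a \<Rightarrow> 'a set" where
  "cls n a \<equiv> F (Suc n) +> a"

lemma filtration_closed: "a \<in> F n \<Longrightarrow> a \<in> carrier R"
  using subgroup.subset[OF filtration_subgroup] by auto

lemma filtration_add: "a \<in> F n \<Longrightarrow> b \<in> F n \<Longrightarrow> a \<oplus> b \<in> F n"
  using subgroup.m_closed[OF filtration_subgroup] by simp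

lemma filtration_zero: "\<zero> \<in> F n"
  using subgroup.one_closed[OF filtration_subgroup] by simp

lemma cls_mem: "b \<in> cls n a \<longleftrightarrow> (\<exists>c\<in>F (Suc n). b = c \<oplus> a)"
  by (auto simp: a_r_coset_def r_coset_def)

lemma cls_self: "a \<in> carrier R \<Longrightarrow> a \<in> cls n a"
  using filtration_zero[of "Suc n"] by (force simp: cls_mem)

lemma cls_eqI: "b \<in> cls n a \<Longrightarrow> a \<in> carrier R \<Longrightarrow> cls n b = cls n a"
  using add.repr_independence[OF _ _ filtration_subgroup[of "Suc n"], of b a]
  by (simp add: a_r_coset_def)

lemma cls_zero: "a \<in> F (Suc n) \<Longrightarrow> cls n a = F (Suc n)"
  using add.coset_join2[OF filtration_closed filtration_subgroup] by (auto simp: a_r_coset_def)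

lemma comm_group_filtration: "comm_group ((add_monoid R)\<lparr>carrier := F n\<rparr>)"
  by (rule group.group_comm_groupI[OF add.subgroup_imp_group[OF filtration_subgroup]])
    (simp add: a_comm filtration_closed)

lemma comm_group_graded_piece: "comm_group (GP n)"
  and graded_piece_subgroup: "subgroup (F (Suc n)) ((add_monoid R)\<lparr>carrier := F n\<rparr>)"
proof -
  interpret H: comm_group "(add_monoid R)\<lparr>carrier := F n\<rparr>"
    by (rule comm_group_filtration)
  show *: "subgroup (F (Suc n)) ((add_monoid R)\<lparr>carrier := F n\<rparr>)"
    using add.subgroup_incl[OF filtration_subgroup filtration_subgroup filtration_Suc] by simp
  show "comm_group (GP n)"
    unfolding graded_piece_def by (rule H.abelian_FactGroup[OF *])
qed

lemma carrier_graded_piece: "carrier (GP n) = cls n ` F n"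
  by (auto simp: graded_piece_def FactGroup_def RCOSETS_def a_r_coset_def r_coset_def)

lemma one_graded_piece: "\<one>\<^bsub>GP n\<^esub> = F (Suc n)"
  by (simp add: graded_piece_def FactGroup_def)

lemma mult_graded_piece:
  assumes "a \<in> F n" "b \<in> F n"
  shows "cls n a \<otimes>\<^bsub>GP n\<^esub> cls n b = cls n (a \<oplus> b)"
proof -
  interpret H: comm_group "(add_monoid R)\<lparr>carrier := F n\<rparr>"
    by (rule comm_group_filtration)
  have N: "F (Suc n) \<lhd> (add_monoid R)\<lparr>carrier := F n\<rparr>"
    using H.normal_iff_subgroup graded_piece_subgroup by blast
  show ?thesis
    using normal.rcos_sum[OF N, of a b] assms
    by (simp add: graded_piece_def FactGroup_def a_r_coset_def r_coset_def set_mult_def)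
qed

text \<open>In the product of c + a and d + b the three terms other than ab lie in the filtration
  step i + j + 1. Hence all cosets in the union that defines \<open>rcoset_mult\<close>
  coincide.\<close>

lemma rcoset_mult_cls:
  assumes a: "a \<in> F i" and b: "b \<in> F j"
  shows "rcoset_mult R (F (Suc (i + j))) (cls i a) (cls j b) = cls (i + j) (a \<otimes> b)"
proof -
  note ac = filtration_closed[OF a] and bc = filtration_closed[OF b]
  have "cls (i + j) (a' \<otimes> b') = cls (i + j) (a \<otimes> b)" if "a' \<in> cls i a" "b' \<in> cls j b" for a' b'
  proof (rule cls_eqI)
    obtain c d where c: "c \<in> F (Suc i)" "a' = c \<oplus> a" and d: "d \<in> F (Suc j)" "b' = d \<oplus> b"
      using \<open>a' \<in> cls i a\<close> \<open>b' \<in> cls j b\<close> by (auto simp: cls_mem)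
    note cc = filtration_closed[OF c(1)] and dc = filtration_closed[OF d(1)]
    have "c \<otimes> d \<in> F (Suc (i + j))"
      using filtration_mult[OF c(1) d(1)] filtration_Suc by auto
    moreover have "c \<otimes> b \<in> F (Suc (i + j))" "a \<otimes> d \<in> F (Suc (i + j))"
      using filtration_mult[OF c(1) b] filtration_mult[OF a d(1)] by auto
    ultimately have "c \<otimes> d \<oplus> c \<otimes> b \<oplus> a \<otimes> d \<in> F (Suc (i + j))"
      by (intro filtration_add)
    moreover have "a' \<otimes> b' = c \<otimes> d \<oplus> c \<otimes> b \<oplus> a \<otimes> d \<oplus> a \<otimes> b"
      using ac bc cc dc by (simp add: c d l_distr r_distr a_ac)
    ultimately show "a' \<otimes> b' \<in> cls (i + j) (a \<otimes> b)" unfolding cls_mem by blast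
  qed (use ac bc in simp)
  then show ?thesis
    unfolding rcoset_mult_def using cls_self[OF ac, of i] cls_self[OF bc, of j] by blast
qed

lemma group_graded_piece: "group (GP n)"
  using comm_group_graded_piece comm_group_def by blast

lemma carrier_graded_ring:
  "x \<in> carrier (GR) \<longleftrightarrow>
     (\<forall>n. x n \<in> cls n ` F n) \<and> finite {n. x n \<noteq> F (Suc n)}"
  by (auto simp: graded_ring_def carrier_sum_group group_graded_piece carrier_graded_piece
      one_graded_piece)

lemma mult_graded_ring: "(x \<otimes>\<^bsub>GR\<^esub> y) n = 
   finprod (GP n) (\<lambda>i. rcoset_mult R (F (Suc n)) (x i) (y (n - i))) {..n}"
  by (simp add: graded_ring_def)

lemma add_graded_ring: "(x \<oplus>\<^bsub>GR\<^esub> y) n = x n \<otimes>\<^bsub>GP n\<^esub> y n"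
  by (simp add: graded_ring_def)

lemma one_graded_ring: "\<one>\<^bsub>GR\<^esub> = homogeneous R F 0 \<one>"
  by (simp add: graded_ring_def)

lemma homogeneous_closed: "a \<in> F n \<Longrightarrow> homogeneous R F n a \<in> carrier (GR)"
  unfolding carrier_graded_ring
proof (intro conjI allI)
  fix m assume "a \<in> F n"
  then show "homogeneous R F n a m \<in> cls m ` F m"
    using cls_zero[OF filtration_zero, of m] filtration_zero[of m] by (force simp: homogeneous_def)
  show "finite {m. homogeneous R F n a m \<noteq> F (Suc m)}"
    by (rule finite_subset[of _ "{n}"]) (auto simp: homogeneous_def)
qed

lemma support_bound:
  assumes "x \<in> carrier (GR)"
  obtains N where "\<And>n. N < n \<Longrightarrow> x n = F (Suc n)"
proof -
  have "finite {n. x n \<noteq> F (Suc n)}" using assms by (simp add: carrier_graded_ring)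
  then obtain N where "\<forall>n\<in>{n. x n \<noteq> F (Suc n)}. n \<le> N"
    using finite_nat_set_iff_bounded_le by meson
  then show ?thesis using that[of N] by force
qed

lemma rcoset_mult_closed:
  assumes "x \<in> carrier (GR)" "y \<in> carrier (GR)" "i \<le> n"
  shows "rcoset_mult R (F (Suc n)) (x i) (y (n - i)) \<in> carrier (GP n)"
proof -
  obtain a b where "a \<in> F i" "x i = cls i a" "b \<in> F (n - i)" "y (n - i) = cls (n - i) b"
    using assms unfolding carrier_graded_ring by blast
  then show ?thesis
    using rcoset_mult_cls[of a i b "n - i"] filtration_mult[of a i b "n - i"] assms(3)
    by (simp add: carrier_graded_piece)
qed

lemma rcoset_mult_zero:
  assumes "x \<in> carrier (GR)" "y \<in> carrier (GR)" "i \<le> n"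
    and "x i = F (Suc i) \<or> y (n - i) = F (Suc (n - i))"
  shows "rcoset_mult R (F (Suc n)) (x i) (y (n - i)) = \<one>\<^bsub>GP n\<^esub>"
proof -
  \<comment> \<open>The representative of a zero coset is chosen to be zero itself, so that one of
    the factors below vanishes outright.\<close>
  have "\<exists>c\<in>F m. z m = cls m c \<and> (z m = F (Suc m) \<longrightarrow> c = \<zero>)" if "z \<in> carrier (GR)" for z m
  proof (cases "z m = F (Suc m)")
    case True
    then show ?thesis using cls_zero[OF filtration_zero, of m] filtration_zero by auto
  next
    case False
    then show ?thesis using that by (auto simp: carrier_graded_ring)
  qed
  from this[OF assms(1), of i] this[OF assms(2), of "n - i"] assms(4)
  obtain a b where ab: "a \<in> F i" "x i = cls i a" "b \<in> F (n - i)" "y (n - i) = cls (n - i) b"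
      and z: "a = \<zero> \<or> b = \<zero>"
    by blast
  have "a \<otimes> b = \<zero>" using z ab filtration_closed by auto
  then show ?thesis
    using rcoset_mult_cls[of a i b "n - i"] ab assms(3) cls_zero[OF filtration_zero]
    by (simp add: one_graded_piece)
qed

lemma graded_ring_mult_support:
  assumes x: "x \<in> carrier (GR)" and y: "y \<in> carrier (GR)"
    and N: "\<And>n. N < n \<Longrightarrow> x n = F (Suc n)" and M: "\<And>n. M < n \<Longrightarrow> y n = F (Suc n)"
    and n: "N + M < n"
  shows "(x \<otimes>\<^bsub>GR\<^esub> y) n = F (Suc n)"
proof -
  interpret P: comm_group "GP n" by (rule comm_group_graded_piece)
  have "rcoset_mult R (F (Suc n)) (x i) (y (n - i)) = \<one>\<^bsub>GP n\<^esub>" if i: "i \<in> {..n}" for i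
  proof -
    have "N < i \<or> M < n - i" using n i by auto
    then have "x i = F (Suc i) \<or> y (n - i) = F (Suc (n - i))" using N M by blast
    then show ?thesis using i by (intro rcoset_mult_zero x y) auto
  qed
  then show ?thesis
    unfolding mult_graded_ring by (subst P.finprod_one_eqI) (simp_all add: one_graded_piece)
qed

lemma graded_ring_mult_closed:
  assumes x: "x \<in> carrier (GR)" and y: "y \<in> carrier (GR)"
  shows "x \<otimes>\<^bsub>GR\<^esub> y \<in> carrier (GR)"
  unfolding carrier_graded_ring
proof (intro conjI allI)
  fix n
  interpret P: comm_group "GP n" by (rule comm_group_graded_piece)
  show "(x \<otimes>\<^bsub>GR\<^esub> y) n \<in> cls n ` F n"
    unfolding mult_graded_ring carrier_graded_piece[symmetric]
    by (rule P.finprod_closed) (use rcoset_mult_closed[OF x y] in auto)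
next
  obtain N M where N: "\<And>n. N < n \<Longrightarrow> x n = F (Suc n)" and M: "\<And>n. M < n \<Longrightarrow> y n = F (Suc n)"
    using support_bound[OF x] support_bound[OF y] by metis
  have "(x \<otimes>\<^bsub>GR\<^esub> y) n = F (Suc n)" if "N + M < n" for n
    by (rule graded_ring_mult_support[OF x y N M that])
  then have "{n. (x \<otimes>\<^bsub>GR\<^esub> y) n \<noteq> F (Suc n)} \<subseteq> {..N + M}"
    using leI by auto
  then show "finite {n. (x \<otimes>\<^bsub>GR\<^esub> y) n \<noteq> F (Suc n)}"
    using finite_subset by blast
qed

lemma graded_ring_add_closed:
  assumes x: "x \<in> carrier (GR)" and y: "y \<in> carrier (GR)"
  shows "x \<oplus>\<^bsub>GR\<^esub> y \<in> carrier (GR)"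
  using group.subgroup_self[OF sum_group[OF group_graded_piece], THEN subgroup.m_closed] x y
  by (simp add: graded_ring_def)

text \<open>A map out of the graded ring is the same as compatible maps on the filtration steps:
  \<open>\<phi> n\<close> kills the next step, hence descends to the n-th piece, and the values on
  the components are added up in T. Multiplicativity is then the Cauchy product formula in
  T.\<close>

lemma graded_ring_hom:
  fixes T :: "('t, 'e) ring_scheme" and \<phi> :: "nat \<Rightarrow> 'a \<Rightarrow> 't"
  assumes "cring T"
    and closed: "\<And>n a. a \<in> F n \<Longrightarrow> \<phi> n a \<in> carrier T"
    and add: "\<And>n a b. a \<in> F n \<Longrightarrow> b \<in> F n \<Longrightarrow> \<phi> n (a \<oplus> b) = \<phi> n a \<oplus>\<^bsub>T\<^esub> \<phi> n b"
    and mult: "\<And>m n a b. a \<in> F m \<Longrightarrow> b \<in> F n \<Longrightarrow> \<phi> (m + n) (a \<otimes> b) = \<phi> m a \<otimes>\<^bsub>T\<^esub> \<phi> n b"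
    and one: "\<phi> 0 \<one> = \<one>\<^bsub>T\<^esub>"
    and zero: "\<And>n a. a \<in> F (Suc n) \<Longrightarrow> \<phi> n a = \<zero>\<^bsub>T\<^esub>"
  shows "\<exists>f \<in> Ring.ring_hom (GR) T. \<forall>n. \<forall>a\<in>F n. f (homogeneous R F n a) = \<phi> n a"
proof -
  interpret T: cring T by fact
  define \<psi> where "\<psi> n Z = the_elem (\<phi> n ` Z)" for n Z
  have \<psi>: "\<psi> n (cls n a) = \<phi> n a" if a: "a \<in> F n" for n a
  proof -
    have "\<phi> n b = \<phi> n a" if "b \<in> cls n a" for b
    proof -
      obtain c where c: "c \<in> F (Suc n)" "b = c \<oplus> a" using \<open>b \<in> cls n a\<close> by (auto simp: cls_mem)
      have "c \<in> F n" using c filtration_Suc by blast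
      then show ?thesis using a c zero[of c n] add[of c n a] closed[OF a] by simp
    qed
    then have "\<phi> n ` cls n a = {\<phi> n a}" using cls_self[OF filtration_closed[OF a], of n] by blast
    then show ?thesis by (simp add: \<psi>_def)
  qed
  have \<psi>_closed: "\<psi> n z \<in> carrier T" if "z \<in> cls n ` F n" for n z
    using that \<psi> closed by auto
  have \<psi>_zero: "\<psi> n (F (Suc n)) = \<zero>\<^bsub>T\<^esub>" for n
    using \<psi>[OF filtration_zero, of n] zero[OF filtration_zero, of n] cls_zero[OF filtration_zero, of
        n]
    by simp
  have \<psi>_add: "\<psi> n (z \<otimes>\<^bsub>GP n\<^esub> w) = \<psi> n z \<oplus>\<^bsub>T\<^esub> \<psi> n w"
    if "z \<in> cls n ` F n" "w \<in> cls n ` F n" for n z w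
    using that by (auto simp: mult_graded_piece \<psi> filtration_add add)
  have \<psi>_hom: "group_hom (GP n) (add_monoid T) (\<psi> n)" for n
    using \<psi>_add \<psi>_closed by (auto simp: group_hom_def group_hom_axioms_def group_graded_piece
        T.add.is_group hom_def carrier_graded_piece)
  have \<psi>_mult: "\<psi> n (rcoset_mult R (F (Suc n)) (x i) (y (n - i))) =
      \<psi> i (x i) \<otimes>\<^bsub>T\<^esub> \<psi> (n - i) (y (n - i))"
    if "x \<in> carrier (GR)" "y \<in> carrier (GR)" "i \<le> n" for x y i n
  proof -
    have "x i \<in> cls i ` F i" "y (n - i) \<in> cls (n - i) ` F (n - i)"
      using that by (simp_all add: carrier_graded_ring)
    then obtain a b where "a \<in> F i" "x i = cls i a" "b \<in> F (n - i)" "y (n - i) = cls (n - i) b"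
      by blast
    then show ?thesis
      using rcoset_mult_cls[of a i b "n - i"] filtration_mult[of a i b "n - i"] that(3)
        mult[of a i b "n - i"]
      by (simp add: \<psi>)
  qed
  have \<psi>_finprod: "\<psi> n (finprod (GP n) z A) = finsum T (\<lambda>i. \<psi> n (z i)) A"
    if "finite A" "\<And>i. i \<in> A \<Longrightarrow> z i \<in> carrier (GP n)" for n z and A :: "nat set"
    using that
  proof (induction A)
    case empty
    interpret P: comm_group "GP n" by (rule comm_group_graded_piece)
    show ?case by (simp add: one_graded_piece \<psi>_zero)
  next
    case (insert i A)
    interpret P: comm_group "GP n" by (rule comm_group_graded_piece)
    have "finprod (GP n) z A \<in> carrier (GP n)"
      by (rule P.finprod_closed) (use insert in auto)
    then show ?case
      using insert \<psi>_add \<psi>_closed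
      by (subst P.finprod_insert) (auto simp: carrier_graded_piece Pi_def)
  qed
  define f where "f x = finsum T (\<lambda>n. \<psi> n (x n)) {n. x n \<noteq> F (Suc n)}" for x
  have comp: "\<psi> n (x n) \<in> carrier T" if "x \<in> carrier (GR)" for x n
    using that \<psi>_closed by (simp add: carrier_graded_ring)
  \<comment> \<open>The support depends on the element, so sums and products are compared over a
    common initial segment of degrees.\<close>
  have f_eq: "f x = finsum T (\<lambda>n. \<psi> n (x n)) {..N}"
    if "x \<in> carrier (GR)" "\<And>n. N < n \<Longrightarrow> x n = F (Suc n)" for x N
    unfolding f_def
  proof (rule T.add.finprod_mono_neutral_cong_left)
    show "{n. x n \<noteq> F (Suc n)} \<subseteq> {..N}" using that(2) leI by auto
    show "\<psi> i (x i) = \<zero>\<^bsub>T\<^esub>" if i: "i \<in> {..N} - {n. x n \<noteq> F (Suc n)}" for i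
    proof -
      have "x i = F (Suc i)" using i by simp
      then show ?thesis by (simp add: \<psi>_zero)
    qed
    show "(\<lambda>n. \<psi> n (x n)) \<in> {..N} \<rightarrow> carrier T" using comp[OF that(1)] by simp
  qed simp_all
  have "f \<in> Ring.ring_hom (GR) T"
  proof (rule ring_hom_memI)
    fix x assume x: "x \<in> carrier (GR)"
    show "f x \<in> carrier T" unfolding f_def by (rule T.finsum_closed) (use comp[OF x] in auto)
    fix y assume y: "y \<in> carrier (GR)"
    obtain N M where N: "\<And>n. N < n \<Longrightarrow> x n = F (Suc n)" and M: "\<And>n. M < n \<Longrightarrow> y n = F (Suc n)"
      using support_bound[OF x] support_bound[OF y] by metis
    let ?xy = "x \<otimes>\<^bsub>GR\<^esub> y"
    have xy: "?xy \<in> carrier (GR)" by (rule graded_ring_mult_closed[OF x y])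
    have \<psi>_xy: "\<psi> n (?xy n) = (\<Oplus>\<^bsub>T\<^esub>i\<in>{..n}. \<psi> i (x i) \<otimes>\<^bsub>T\<^esub> \<psi> (n - i) (y (n - i)))" for n
      unfolding mult_graded_ring
      by (subst \<psi>_finprod)
        (auto simp: rcoset_mult_closed[OF x y] \<psi>_mult[OF x y] comp[OF x] comp[OF y] intro!:
            T.finsum_cong')
    have "?xy n = F (Suc n)" if "N + M < n" for n
      by (rule graded_ring_mult_support[OF x y N M that])
    then have "f ?xy = (\<Oplus>\<^bsub>T\<^esub>n\<in>{..N + M}. \<Oplus>\<^bsub>T\<^esub>i\<in>{..n}. \<psi> i (x i) \<otimes>\<^bsub>T\<^esub> \<psi> (n - i) (y (n - i)))"
      using f_eq[OF xy] by (simp add: \<psi>_xy)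
    also have "\<dots> = (\<Oplus>\<^bsub>T\<^esub>i\<in>{..N}. \<psi> i (x i)) \<otimes>\<^bsub>T\<^esub> (\<Oplus>\<^bsub>T\<^esub>i\<in>{..M}. \<psi> i (y i))"
      by (rule T.cauchy_product) (auto intro!: bound.intro simp: N M \<psi>_zero comp[OF x] comp[OF y])
    also have "\<dots> = f x \<otimes>\<^bsub>T\<^esub> f y" using f_eq[OF x N] f_eq[OF y M] by simp
    finally show "f ?xy = f x \<otimes>\<^bsub>T\<^esub> f y" .
    let ?s = "x \<oplus>\<^bsub>GR\<^esub> y"
    have s: "?s \<in> carrier (GR)" by (rule graded_ring_add_closed[OF x y])
    have \<psi>_s: "\<psi> n (?s n) = \<psi> n (x n) \<oplus>\<^bsub>T\<^esub> \<psi> n (y n)" for n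
      using x y by (simp add: add_graded_ring \<psi>_add carrier_graded_ring)
    have "?s n = F (Suc n)" if "N + M < n" for n
      using N[of n] M[of n] that mult_graded_piece[OF filtration_zero filtration_zero, of n]
        cls_zero[OF filtration_zero, of n] by (simp add: add_graded_ring)
    then have "f ?s = (\<Oplus>\<^bsub>T\<^esub>n\<in>{..N + M}. \<psi> n (x n) \<oplus>\<^bsub>T\<^esub> \<psi> n (y n))"
      using f_eq[OF s] by (simp add: \<psi>_s)
    also have "\<dots> = f x \<oplus>\<^bsub>T\<^esub> f y"
      using f_eq[OF x, of "N + M"] f_eq[OF y, of "N + M"] N M comp[OF x] comp[OF y]
      by (simp add: T.finsum_addf)
    finally show "f ?s = f x \<oplus>\<^bsub>T\<^esub> f y" .
  next
    have "f (homogeneous R F 0 \<one>) = (\<Oplus>\<^bsub>T\<^esub>n\<in>{..0}. \<psi> n (homogeneous R F 0 \<one> n))"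
      by (rule f_eq) (simp add: homogeneous_closed filtration_one, simp add: homogeneous_def)
    then show "f \<one>\<^bsub>GR\<^esub> = \<one>\<^bsub>T\<^esub>"
      by (simp add: one_graded_ring homogeneous_def \<psi> filtration_one one)
  qed
  moreover have "f (homogeneous R F n a) = \<phi> n a" if "a \<in> F n" for n a
  proof -
    \<comment> \<open>If the class of a is the zero coset, then n is outside the support and f adds
      up nothing; the claim still holds because \<open>\<phi> n a\<close> is zero as well.\<close>
    have "\<phi> n a = \<zero>\<^bsub>T\<^esub>" if "cls n a = F (Suc n)"
      using \<psi>[OF \<open>a \<in> F n\<close>] \<psi>_zero[of n] that by simp
    note z = this
    have "f (homogeneous R F n a) = finsum T (\<lambda>m. \<psi> m (homogeneous R F n a m)) {n}"
      unfolding f_def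
      by (rule T.add.finprod_mono_neutral_cong_left)
        (use that in \<open>auto simp: homogeneous_def \<psi>_zero \<psi> closed z\<close>)
    then show ?thesis using that by (simp add: homogeneous_def \<psi> closed)
  qed
  ultimately show ?thesis by blast
qed

end

section \<open>Truncated polynomial rings\<close>

abbreviation coef :: "('v multiset \<Rightarrow>\<^sub>0 int) \<Rightarrow> 'v multiset \<Rightarrow> int" where
  "coef \<equiv> Poly_Mapping.lookup"

lemma finite_submultisets: "finite {a. a \<subseteq># m}"
proof (rule finite_subset)
  show "{a. a \<subseteq># m} \<subseteq> mset ` {xs. set xs \<subseteq> set_mset m \<and> length xs \<le> size m}"
  proof
    fix a assume "a \<in> {a. a \<subseteq># m}"
    moreover obtain xs where "mset xs = a" using ex_mset by blast
    ultimately have "set xs \<subseteq> set_mset m" "length xs \<le> size m"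
      using set_mset_mono[of a m] size_mset_mono[of a m] by force+
    then show "a \<in> mset ` {xs. set xs \<subseteq> set_mset m \<and> length xs \<le> size m}"
      using \<open>mset xs = a\<close> by blast
  qed
  show "finite (mset ` {xs. set xs \<subseteq> set_mset m \<and> length xs \<le> size m})"
    by (rule finite_imageI[OF finite_lists_length_le[OF finite_set_mset]])
qed

text \<open>Brings the convolution of poly mappings into the form of the product in
  \<open>indexed_poly_ring\<close>, a sum over the divisors of a monomial.\<close>

lemma lookup_mult_multiset:
  fixes f g :: "'v multiset \<Rightarrow>\<^sub>0 int"
  shows "coef (f * g) m =
    (\<Sum>a | a \<subseteq># m. coef f a * coef g (m - a))"
proof -
  have inner: "(Sum_any (\<lambda>b. coef g b when m = a + b)) =
      (if a \<subseteq># m then coef g (m - a) else 0)" for a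
  proof (cases "a \<subseteq># m")
    case True
    then have "(coef g b when m = a + b) = (coef g b when b = m - a)" for b
      by (auto simp: when_def)
    then show ?thesis using True by simp
  next
    case False
    then have "m \<noteq> a + b" for b by (metis mset_subset_eq_add_left)
    then show ?thesis using False by simp
  qed
  show ?thesis
    unfolding lookup_mult inner
    by (subst Sum_any.expand_superset[of "{a. a \<subseteq># m}"])
      (auto simp: finite_submultisets intro!: sum.cong split: if_splits)
qed

lemma lookup_mult_var:
  fixes f :: "'v multiset \<Rightarrow>\<^sub>0 int"
  shows "coef (f * Poly_Mapping.single {#k#} 1) m =
    (if k \<in># m then coef f (m - {#k#}) else 0)"
proof -
  have "coef (f * Poly_Mapping.single {#k#} 1) m =
      (\<Sum>a | a \<subseteq># m. if m - a = {#k#} then coef f a else 0)"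
    unfolding lookup_mult_multiset by (rule sum.cong) (auto simp: lookup_single when_def)
  also have "\<dots> = (\<Sum>a \<in> {a. a \<subseteq># m \<and> m - a = {#k#}}. coef f a)"
    by (subst sum.inter_filter[symmetric]) (auto simp: finite_submultisets)
  also have "{a. a \<subseteq># m \<and> m - a = {#k#}} = (if k \<in># m then {m - {#k#}} else {})"
  proof -
    have "a \<subseteq># m \<and> m - a = {#k#} \<longleftrightarrow> m = add_mset k a" for a
      by (auto simp: mset_subset_eq_exists_conv)
    moreover have "m = add_mset k a \<longleftrightarrow> k \<in># m \<and> a = m - {#k#}" for a by auto
    ultimately show ?thesis by auto
  qed
  finally show ?thesis by auto
qed

lemma single_power:
  "Poly_Mapping.single m (1::int) ^ k = Poly_Mapping.single (repeat_mset k m) 1"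
  by (induction k) (auto simp: mult_single)

locale truncated_polynomials =
  fixes p :: int and V :: "'v set" and q :: "'v \<Rightarrow> nat"
  assumes p_gt_1: "1 < p"
begin

abbreviation "Fp \<equiv> residue_ring p"
abbreviation "PR \<equiv> indexed_poly_ring Fp V"
abbreviation "TI \<equiv> truncation_ideal Fp V q"
abbreviation "TR \<equiv> truncated_poly_ring Fp V q"

text \<open>The integral polynomials are poly mappings, a commutative ring in the type class sense;
  the ring axioms for \<^term>\<open>PR\<close> are transported from there along this surjection, which sends the
  variables outside \<^term>\<open>V\<close> to zero.\<close>

definition reduce :: "('v multiset \<Rightarrow>\<^sub>0 int) \<Rightarrow> 'v multiset \<Rightarrow> int" where
  "reduce f = (\<lambda>m. if set_mset m \<subseteq> V then coef f m mod p else 0)"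

sublocale res: residues p Fp by unfold_locales (rule p_gt_1, simp)

lemma Fp_simps: "carrier Fp = {0..p - 1}" "x \<oplus>\<^bsub>Fp\<^esub> y = (x + y) mod p"
  "x \<otimes>\<^bsub>Fp\<^esub> y = (x * y) mod p" "\<zero>\<^bsub>Fp\<^esub> = 0" "\<one>\<^bsub>Fp\<^esub> = 1"
  by (simp_all add: residue_ring_def)

lemma finsum_Fp: "finite A \<Longrightarrow> (\<And>a. a \<in> A \<Longrightarrow> h a \<in> carrier Fp) \<Longrightarrow>
    (\<Oplus>\<^bsub>Fp\<^esub>a\<in>A. h a) = (\<Sum>a\<in>A. h a) mod p"
  by (induction A rule: finite_induct) (auto simp: Fp_simps Pi_def mod_add_right_eq
      res.finsum_insert)

lemma reduce_add: "reduce (f + g) = reduce f \<oplus>\<^bsub>PR\<^esub> reduce g"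
  by (auto simp: indexed_poly_ring_def res.indexed_padd_def reduce_def Fp_simps lookup_add
      mod_add_eq)

lemma reduce_mult: "reduce (f * g) = reduce f \<otimes>\<^bsub>PR\<^esub> reduce g"
proof
  fix m
  have "(reduce f \<otimes>\<^bsub>PR\<^esub> reduce g) m = (\<Oplus>\<^bsub>Fp\<^esub>a\<in>{a. a \<subseteq># m}. (reduce f a * reduce g (m - a)) mod p)"
    by (simp add: indexed_poly_ring_def Fp_simps)
  also have "\<dots> = (\<Sum>a | a \<subseteq># m. (reduce f a * reduce g (m - a)) mod p) mod p"
    by (rule finsum_Fp) (use p_gt_1 in \<open>auto simp: finite_submultisets Fp_simps\<close>)
  also have "\<dots> = (\<Sum>a | a \<subseteq># m. reduce f a * reduce g (m - a)) mod p"
    by (simp add: mod_sum_eq)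
  also have "\<dots> = reduce (f * g) m"
  proof (cases "set_mset m \<subseteq> V")
    case True
    then have *: "set_mset a \<subseteq> V" "set_mset (m - a) \<subseteq> V" if "a \<subseteq># m" for a
      using that set_mset_mono[of a m] by (auto dest: in_diffD)
    have "(\<Sum>a | a \<subseteq># m. reduce f a * reduce g (m - a)) mod p =
        (\<Sum>a | a \<subseteq># m. (reduce f a * reduce g (m - a)) mod p) mod p" by (simp add: mod_sum_eq)
    also have "\<dots> = (\<Sum>a | a \<subseteq># m. (coef f a * coef g (m - a)) mod p) mod p"
      by (rule arg_cong[of _ _ "\<lambda>x. x mod p"], rule sum.cong) (auto simp: reduce_def * mod_mult_eq)
    also have "\<dots> = reduce (f * g) m" using True by
        (simp add: mod_sum_eq reduce_def lookup_mult_multiset)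
    finally show ?thesis .
  next
    case False
    have "reduce f a * reduce g (m - a) = 0" if "a \<subseteq># m" for a
    proof -
      have "set_mset m = set_mset a \<union> set_mset (m - a)"
        using that by (metis set_mset_union subset_mset.add_diff_inverse)
      then show ?thesis using False by (auto simp: reduce_def)
    qed
    then have "(\<Sum>a | a \<subseteq># m. reduce f a * reduce g (m - a)) = 0"
      by (intro sum.neutral) simp
    then show ?thesis using False by (simp add: reduce_def)
  qed
  finally show "reduce (f * g) m = (reduce f \<otimes>\<^bsub>PR\<^esub> reduce g) m" by simp
qed

lemma reduce_const: "k \<in> carrier Fp \<Longrightarrow> reduce (Poly_Mapping.single 0 k) = res.indexed_const k"
  by (auto simp: reduce_def res.indexed_const_def lookup_single when_def Fp_simps)

lemma reduce_zero: "reduce 0 = \<zero>\<^bsub>PR\<^esub>"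
  by (auto simp: reduce_def indexed_poly_ring_def res.indexed_const_def Fp_simps)

lemma reduce_one: "reduce 1 = \<one>\<^bsub>PR\<^esub>"
  using reduce_const[of 1] p_gt_1 by (simp add: indexed_poly_ring_def Fp_simps)

lemma reduce_var_mult:
  assumes "i \<in> V"
  shows "res.indexed_pmult (reduce f) i = reduce (f * Poly_Mapping.single {#i#} 1)"
proof
  fix m
  show "res.indexed_pmult (reduce f) i m = reduce (f * Poly_Mapping.single {#i#} 1) m"
  proof (cases "i \<in># m")
    case True
    then obtain m' where "m = add_mset i m'" by (meson multi_member_split)
    then show ?thesis using assms by (simp add: res.indexed_pmult_def reduce_def lookup_mult_var)
  next
    case False
    then show ?thesis by (simp add: res.indexed_pmult_def reduce_def lookup_mult_var Fp_simps)
  qed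
qed

lemma reduce_var: "k \<in> V \<Longrightarrow> reduce (Poly_Mapping.single {#k#} 1) = res.indexed_var k"
  using reduce_var_mult[of k 1] by (simp add: res.indexed_var_def reduce_one indexed_poly_ring_def)

lemma carrier_PR: "carrier PR = range reduce"
proof -
  have "P \<in> range reduce" if "P \<in> res.indexed_pset V (carrier Fp)" for P
    using that
  proof induction
    case (indexed_const k)
    then have "res.indexed_const k = reduce (Poly_Mapping.single 0 k)" by (simp add: reduce_const)
    then show ?case by simp
  next
    case (indexed_padd P Q)
    then obtain f g where "P = reduce f" "Q = reduce g" by blast
    then have "res.indexed_padd P Q = reduce (f + g)" by
        (simp add: reduce_add indexed_poly_ring_def)
    then show ?case by simp
  next
    case (indexed_pmult P i)
    then obtain f where "P = reduce f" by blast
    then show ?case using reduce_var_mult[OF indexed_pmult(2)] by simp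
  qed
  moreover have "reduce f \<in> res.indexed_pset V (carrier Fp)" for f
  proof -
    have single: "reduce (Poly_Mapping.single m c) \<in> res.indexed_pset V (carrier Fp)" for m c
    proof (induction m)
      case empty
      have "reduce (Poly_Mapping.single 0 c) = reduce (Poly_Mapping.single 0 (c mod p))"
        by (auto simp: reduce_def lookup_single when_def)
      also have "\<dots> = res.indexed_const (c mod p)"
        using p_gt_1 by (intro reduce_const) (simp add: Fp_simps)
      finally show ?case
        using p_gt_1 by (auto intro!: res.indexed_pset.indexed_const simp: Fp_simps)
    next
      case (add i m)
      show ?case
      proof (cases "i \<in> V")
        case True
        have "Poly_Mapping.single (add_mset i m) c =
            Poly_Mapping.single m c * Poly_Mapping.single {#i#} 1"
          by (simp add: mult_single)
        then show ?thesis
          using reduce_var_mult[OF True, symmetric] res.indexed_pset.indexed_pmult[OF add True]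
              by simp
      next
        case False
        then have "reduce (Poly_Mapping.single (add_mset i m) c) = res.indexed_const 0"
          by (intro ext) (auto simp: reduce_def res.indexed_const_def lookup_single when_def
              Fp_simps)
        then show ?thesis
          using p_gt_1 by (auto intro!: res.indexed_pset.indexed_const simp: Fp_simps)
      qed
    qed
    \<comment> \<open>The induction has a difference step, whereas \<open>indexed_pset\<close> is
      closed under sums; carrying - f along turns the difference into a sum.\<close>
    have "reduce f \<in> res.indexed_pset V (carrier Fp) \<and>
        reduce (- f) \<in> res.indexed_pset V (carrier Fp)"
      using subset_UNIV
    proof (induction f rule: frag_induction)
      case zero then show ?case using single[of 0 0] by simp
    next
      case (one m)
      then show ?case using single[of m 1] single[of m "- 1"] by (simp add: single_uminus)
    next
      case (diff f g)
      then show ?case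
        using reduce_add[of f "- g"] reduce_add[of "- f" g]
        by (auto intro!: res.indexed_pset.indexed_padd simp: indexed_poly_ring_def)
    qed
    then show ?thesis by simp
  qed
  ultimately show ?thesis by (auto simp: indexed_poly_ring_def)
qed

lemma cring_PR: "cring PR"
proof (intro cringI abelian_groupI comm_monoidI)
  fix x assume "x \<in> carrier PR"
  then obtain f where f: "x = reduce f" by (auto simp: carrier_PR)
  have "reduce (- f) \<oplus>\<^bsub>PR\<^esub> x = \<zero>\<^bsub>PR\<^esub>" by (simp add: f reduce_add[symmetric] reduce_zero)
  then show "\<exists>y\<in>carrier PR. y \<oplus>\<^bsub>PR\<^esub> x = \<zero>\<^bsub>PR\<^esub>" by (auto simp: carrier_PR)
qed (auto simp: carrier_PR reduce_add[symmetric] reduce_mult[symmetric] reduce_zero[symmetric]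
    reduce_one[symmetric] algebra_simps)

sublocale PR: cring PR by (rule cring_PR)

lemma reduce_closed: "reduce f \<in> carrier PR" by (simp add: carrier_PR)

lemma reduce_power: "reduce (f ^ k) = reduce f [^]\<^bsub>PR\<^esub> k"
  by (induction k) (simp_all add: reduce_one reduce_mult power_Suc2 del: power_Suc)

lemma ideal_TI: "ideal TI PR"
  unfolding truncation_ideal_def
  by (rule PR.genideal_ideal) (auto simp: reduce_var[symmetric] reduce_closed)

sublocale TI: ideal TI PR by (rule ideal_TI)

lemma cring_TR: "cring TR"
  unfolding truncated_poly_ring_def by (rule TI.quotient_is_cring[OF cring_PR])

text \<open>A monomial with some exponent at least \<open>q k\<close> is a multiple of a generator
  of the ideal. Every other monomial of f disappears under \<open>reduce\<close>, because p divides
  its coefficient or one of its variables lies outside V.\<close>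

lemma reduce_in_TI:
  assumes "\<And>m. set_mset m \<subseteq> V \<Longrightarrow> \<forall>k\<in>V. count m k < q k \<Longrightarrow> p dvd coef f m"
  shows "reduce f \<in> TI"
proof -
  define B where "B = {m \<in> keys f. set_mset m \<subseteq> V \<and> (\<exists>k\<in>V. q k \<le> count m k)}"
  have finB: "finite B" unfolding B_def by (rule finite_subset[OF _ finite_keys[of f]]) auto
  have sub: "reduce (\<Sum>m\<in>A. Poly_Mapping.single m (coef f m)) \<in> TI"
    if "finite A" "A \<subseteq> B" for A
    using that
  proof (induction A)
    case empty
    then show ?case by (simp add: reduce_zero TI.zero_closed)
  next
    case (insert m A)
    then obtain k where k: "k \<in> V" "q k \<le> count m k" by (auto simp: B_def)
    have "replicate_mset (q k) k \<subseteq># m" using k(2) by (simp add: count_le_replicate_mset_subset_eq)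
    then have m: "m = (m - replicate_mset (q k) k) + repeat_mset (q k) {#k#}" by simp
    have "Poly_Mapping.single m (coef f m) =
        Poly_Mapping.single (m - replicate_mset (q k) k) (coef f m) * Poly_Mapping.single {#k#} 1 ^
            q k"
      by (subst m) (simp add: single_power mult_single)
    then have "reduce (Poly_Mapping.single m (coef f m)) =
        reduce (Poly_Mapping.single (m - replicate_mset (q k) k) (coef f m)) \<otimes>\<^bsub>PR\<^esub> (res.indexed_var k
            [^]\<^bsub>PR\<^esub> q k)"
      by (simp add: reduce_mult reduce_power reduce_var k)
    moreover have "res.indexed_var k [^]\<^bsub>PR\<^esub> q k \<in> TI"
      unfolding truncation_ideal_def using k(1)
      by (intro subsetD[OF PR.genideal_self]) (auto simp: reduce_var[symmetric] reduce_closed)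
    ultimately have "reduce (Poly_Mapping.single m (coef f m)) \<in> TI"
      using TI.I_l_closed reduce_closed by simp
    then show ?case using insert by (simp add: reduce_add TI.a_closed)
  qed
  have "reduce f = reduce (\<Sum>m\<in>B. Poly_Mapping.single m (coef f m))"
  proof
    fix m
    have "coef (\<Sum>m\<in>B. Poly_Mapping.single m (coef f m)) m =
        (if m \<in> B then coef f m else 0)"
      using finB by (simp add: lookup_sum lookup_single when_def)
    moreover have "p dvd coef f m" if "m \<notin> B" "set_mset m \<subseteq> V"
      using that assms[of m] by (cases "m \<in> keys f") (auto simp: B_def in_keys_iff not_le)
    ultimately show "reduce f m = reduce (\<Sum>m\<in>B. Poly_Mapping.single m (coef f m)) m"
      by (auto simp: reduce_def)
  qed
  then show ?thesis using sub[OF finB] by simp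
qed

definition trunc :: "('v multiset \<Rightarrow>\<^sub>0 int) \<Rightarrow> ('v multiset \<Rightarrow> int) set" where
  "trunc f = TI +>\<^bsub>PR\<^esub> reduce f"

lemma trunc_closed: "trunc f \<in> carrier TR"
  and trunc_add: "trunc (f + g) = trunc f \<oplus>\<^bsub>TR\<^esub> trunc g"
  and trunc_mult: "trunc (f * g) = trunc f \<otimes>\<^bsub>TR\<^esub> trunc g"
  and trunc_one: "trunc 1 = \<one>\<^bsub>TR\<^esub>"
  and trunc_zero: "trunc 0 = \<zero>\<^bsub>TR\<^esub>"
  using TI.rcos_ring_hom ring_hom_closed[OF TI.rcos_ring_hom reduce_closed]
    ring_hom_add[OF TI.rcos_ring_hom reduce_closed reduce_closed]
    ring_hom_mult[OF TI.rcos_ring_hom reduce_closed reduce_closed]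
    ring_hom_one[OF TI.rcos_ring_hom] ring_hom_zero[OF TI.rcos_ring_hom PR.ring_axioms
        TI.quotient_is_ring]
  by (simp_all add: trunc_def truncated_poly_ring_def reduce_add reduce_mult reduce_one reduce_zero)

lemma trunc_eq_zero:
  assumes "\<And>m. set_mset m \<subseteq> V \<Longrightarrow> \<forall>k\<in>V. count m k < q k \<Longrightarrow> p dvd coef f m"
  shows "trunc f = \<zero>\<^bsub>TR\<^esub>"
  using PR.add.coset_join2[OF reduce_closed TI.a_subgroup reduce_in_TI[OF assms]]
  by (simp add: trunc_def truncated_poly_ring_def FactRing_def a_r_coset_def)

lemma trunc_cong:
  assumes "\<And>m. set_mset m \<subseteq> V \<Longrightarrow> \<forall>k\<in>V. count m k < q k \<Longrightarrow>
    p dvd coef f m - coef g m"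
  shows "trunc f = trunc g"
proof -
  interpret TR: cring TR by (rule cring_TR)
  have "trunc (f - g) = \<zero>\<^bsub>TR\<^esub>" by (rule trunc_eq_zero) (simp add: lookup_minus assms)
  then show ?thesis using trunc_add[of "f - g" g] trunc_closed[of g] by simp
qed

lemma trunc_var: "k \<in> V \<Longrightarrow> trunc (Poly_Mapping.single {#k#} 1) = truncated_var Fp V q k"
  by (simp add: trunc_def truncated_var_def reduce_var)

text \<open>The structure map of the truncated ring as an algebra over the prime field; it is the
  second homomorphism fed into the universal property of the tensor product.\<close>

lemma trunc_const_hom: "(\<lambda>c. trunc (Poly_Mapping.single 0 c)) \<in> Ring.ring_hom Fp TR"
proof -
  have c: "trunc (Poly_Mapping.single 0 (c mod p)) = trunc (Poly_Mapping.single 0 c)" for c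
    by (rule trunc_cong) (auto simp: lookup_single when_def mod_eq_dvd_iff[symmetric])
  show ?thesis
    by (rule ring_hom_memI)
      (simp_all add: trunc_closed Fp_simps c trunc_mult[symmetric] trunc_add[symmetric] mult_single
        single_add trunc_one[symmetric])
qed

end

section \<open>Traces of exterior powers\<close>

text \<open>Summing over permutations of S itself, instead of indices 0, ..., |S| - 1, makes this
  appear in the expansion of det(1 + tA) without renumbering.\<close>

definition principal_minor :: "complex mat \<Rightarrow> nat set \<Rightarrow> complex" where
  "principal_minor A S = (\<Sum>\<pi> | \<pi> permutes S. of_int (sign \<pi>) * (\<Prod>i\<in>S. A $$ (i, \<pi> i)))"

text \<open>Each product in the Leibniz formula is expanded according to the set S of rows from
  which the factor tA is taken. The remaining rows contribute Kronecker deltas, so only permutations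
  that fix the complement of S survive.\<close>

lemma det_one_plus_smult:
  assumes A: "A \<in> carrier_mat d d"
  shows "det (1\<^sub>m d + t \<cdot>\<^sub>m A) = (\<Sum>S\<in>Pow {0..<d}. t ^ card S * principal_minor A S)"
proof -
  let ?D = "{0..<d}"
  let ?f = "\<lambda>\<pi> S. of_int (sign \<pi>) * ((\<Prod>i\<in>S. t * A $$ (i, \<pi> i)) * (\<Prod>i\<in>?D - S. if i =
      \<pi> i then 1 else 0))"
  have sub: "(\<Sum>\<pi> | \<pi> permutes ?D. ?f \<pi> S) = t ^ card S * principal_minor A S" if S: "S \<subseteq> ?D" for S
  proof -
    have "(\<Sum>\<pi> | \<pi> permutes ?D. ?f \<pi> S) = (\<Sum>\<pi> | \<pi> permutes S. ?f \<pi> S)"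
    proof (rule sum.mono_neutral_right)
      show "finite {\<pi>. \<pi> permutes ?D}" by (simp add: finite_permutations)
      show "{\<pi>. \<pi> permutes S} \<subseteq> {\<pi>. \<pi> permutes ?D}" using permutes_subset S by blast
      show "\<forall>\<pi>\<in>{\<pi>. \<pi> permutes ?D} - {\<pi>. \<pi> permutes S}. ?f \<pi> S = 0"
      proof
        fix \<pi> assume \<pi>: "\<pi> \<in> {\<pi>. \<pi> permutes ?D} - {\<pi>. \<pi> permutes S}"
        then have "\<exists>i\<in>?D - S. i \<noteq> \<pi> i"
          using permutes_superset[of \<pi> ?D S] by force
        then have "(\<Prod>i\<in>?D - S. if i = \<pi> i then 1 else 0) = (0::complex)"
          by (intro prod_zero) auto
        then show "?f \<pi> S = 0" by simp
      qed
    qed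
    also have "\<dots> = (\<Sum>\<pi> | \<pi> permutes S. t ^ card S * (of_int (sign \<pi>) * (\<Prod>i\<in>S. A $$ (i, \<pi> i))))"
    proof (rule sum.cong[OF refl])
      fix \<pi> assume "\<pi> \<in> {\<pi>. \<pi> permutes S}"
      then have "(\<Prod>i\<in>?D - S. if i = \<pi> i then 1 else 0) = (1::complex)"
        by (intro prod.neutral) (auto simp: permutes_not_in)
      then show "?f \<pi> S = t ^ card S * (of_int (sign \<pi>) * (\<Prod>i\<in>S. A $$ (i, \<pi> i)))"
        by (simp add: prod.distrib)
    qed
    finally show ?thesis by (simp add: principal_minor_def sum_distrib_left)
  qed
  have "det (1\<^sub>m d + t \<cdot>\<^sub>m A) =
      (\<Sum>\<pi> | \<pi> permutes ?D. of_int (sign \<pi>) * (\<Prod>i\<in>?D. t * A $$ (i, \<pi> i) + (if i = \<pi> i then 1 else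
          0)))"
    using A by (auto simp: det_def permutes_in_image intro!: sum.cong prod.cong)
  also have "\<dots> = (\<Sum>\<pi> | \<pi> permutes ?D. \<Sum>S\<in>Pow ?D. ?f \<pi> S)"
    by (simp add: prod_add sum_distrib_left)
  also have "\<dots> = (\<Sum>S\<in>Pow ?D. \<Sum>\<pi> | \<pi> permutes ?D. ?f \<pi> S)" by (rule sum.swap)
  also have "\<dots> = (\<Sum>S\<in>Pow ?D. t ^ card S * principal_minor A S)"
  proof (rule sum.cong[OF refl])
    fix S assume "S \<in> Pow ?D"
    then show "(\<Sum>\<pi> | \<pi> permutes ?D. ?f \<pi> S) = t ^ card S * principal_minor A S"
      by (intro sub) simp
  qed
  finally show ?thesis .
qed

text \<open>Transport along the numbering of S by the list s carries the permutations of the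
  positions to those of S and preserves signs.\<close>

lemma det_submatrix_eq_principal_minor:
  assumes "distinct s"
  shows "det (mat (length s) (length s) (\<lambda>(a, b). A $$ (s ! a, s ! b))) = principal_minor A (set s)"
proof -
  let ?K = "{0..<length s}"
  have inj: "inj_on ((!) s) ?K" using assms by (auto simp: inj_on_def nth_eq_iff_index_eq)
  have im: "(!) s ` ?K = set s" by (auto simp: set_conv_nth)
  have bij: "bij_betw (map_permutation ?K ((!) s)) {\<pi>. \<pi> permutes ?K} {\<pi>. \<pi> permutes set s}"
  proof (rule bij_betw_byWitness[where f' = "map_permutation (set s) (inv_into ?K ((!) s))"])
    have b: "bij_betw ((!) s) ?K (set s)" using inj im by (simp add: bij_betw_def)
    have b': "bij_betw (inv_into ?K ((!) s)) (set s) ?K" by (rule bij_betw_inv_into[OF b])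
    show "\<forall>\<pi>\<in>{\<pi>. \<pi> permutes ?K}. map_permutation (set s) (inv_into ?K ((!) s)) (map_permutation ?K
        ((!) s) \<pi>) = \<pi>"
      using map_permutation_compose_inv[OF b] inv_into_f_f[OF inj] by blast
    show "\<forall>\<pi>\<in>{\<pi>. \<pi> permutes set s}. map_permutation ?K ((!) s) (map_permutation (set s) (inv_into ?K
        ((!) s)) \<pi>) = \<pi>"
      using map_permutation_compose_inv[OF b'] f_inv_into_f[of _ "(!) s" ?K] im by blast
    show "map_permutation ?K ((!) s) ` {\<pi>. \<pi> permutes ?K} \<subseteq> {\<pi>. \<pi> permutes set s}"
      using map_permutation_permutes[OF b] by blast
    show "map_permutation (set s) (inv_into ?K ((!) s)) ` {\<pi>. \<pi> permutes set s} \<subseteq> {\<pi>. \<pi> permutes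
        ?K}"
      using map_permutation_permutes[OF b'] by blast
  qed
  have "principal_minor A (set s) = (\<Sum>\<pi> | \<pi> permutes ?K. of_int (sign (map_permutation ?K ((!) s)
      \<pi>)) *
      (\<Prod>i\<in>set s. A $$ (i, map_permutation ?K ((!) s) \<pi> i)))"
    unfolding principal_minor_def by (rule sum.reindex_bij_betw[OF bij, symmetric])
  also have "\<dots> = (\<Sum>\<pi> | \<pi> permutes ?K. of_int (sign \<pi>) * (\<Prod>a\<in>?K. A $$ (s ! a, s ! \<pi> a)))"
  proof (rule sum.cong[OF refl])
    fix \<pi> assume \<pi>: "\<pi> \<in> {\<pi>. \<pi> permutes ?K}"
    have "(\<Prod>i\<in>set s. A $$ (i, map_permutation ?K ((!) s) \<pi> i)) =
        (\<Prod>a\<in>?K. A $$ (s ! a, map_permutation ?K ((!) s) \<pi> (s ! a)))"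
      unfolding im[symmetric] by (simp add: prod.reindex[OF inj])
    also have "\<dots> = (\<Prod>a\<in>?K. A $$ (s ! a, s ! \<pi> a))"
      by (rule prod.cong) (auto simp: map_permutation_apply[OF inj])
    finally show "of_int (sign (map_permutation ?K ((!) s) \<pi>)) *
      (\<Prod>i\<in>set s. A $$ (i, map_permutation ?K ((!) s) \<pi> i)) = of_int (sign \<pi>) * (\<Prod>a\<in>?K. A $$ (s ! a,
          s ! \<pi> a))"
      using \<pi> by (simp add: sign_map_permutation[OF inj])
  qed
  also have "\<dots> = det (mat (length s) (length s) (\<lambda>(a, b). A $$ (s ! a, s ! b)))"
    by (auto simp: det_def permutes_in_image intro!: sum.cong prod.cong)
  finally show ?thesis by simp
qed

text \<open>The increasing lists of length k enumerate each k-element subset once, and the diagonal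
  entry at a list is the principal minor of its set.\<close>

lemma trace_exterior_power:
  assumes A: "A \<in> carrier_mat d d"
  shows "mat_trace (exterior_power_mat k A) = (\<Sum>S | S \<subseteq> {0..<d} \<and> card S = k. principal_minor A S)"
proof -
  define L where "L = increasing_lists d k"
  define h where "h s = det (mat k k (\<lambda>(a, b). A $$ (s ! a, s ! b)))" for s
  have distL: "distinct (map set L)"
    using distinct_set_subseqs[of "[0..<d]"] by
        (simp add: L_def increasing_lists_def distinct_map inj_on_def)
  have L: "distinct s \<and> length s = k \<and> set s \<subseteq> {0..<d}" if "s \<in> set L" for s
    using that subseqs_distinctD[of s "[0..<d]"] subseqs_powset[of "[0..<d]"]
    by (auto simp: L_def increasing_lists_def)
  have setL: "set ` set L = {S. S \<subseteq> {0..<d} \<and> card S = k}"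
  proof (intro equalityI subsetI)
    fix S assume "S \<in> {S. S \<subseteq> {0..<d} \<and> card S = k}"
    moreover from this obtain s where "s \<in> set (subseqs [0..<d])" "S = set s"
      using subset_subseqs[of S "[0..<d]"] by auto
    ultimately show "S \<in> set ` set L"
      using subseqs_distinctD[of s "[0..<d]"] by
          (auto simp: L_def increasing_lists_def distinct_card)
  qed (use L distinct_card in force)
  have "mat_trace (exterior_power_mat k A) = (\<Sum>i<length L. h (L ! i))"
    using A by (simp add: mat_trace_def exterior_power_mat_def Let_def L_def h_def)
  also have "\<dots> = (\<Sum>s\<leftarrow>L. h s)"
    by (simp add: sum_list_sum_nth atLeast0LessThan)
  also have "\<dots> = (\<Sum>s\<in>set L. h s)"
    using distL by (simp add: sum_list_distinct_conv_sum_set distinct_map)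
  also have "\<dots> = (\<Sum>s\<in>set L. principal_minor A (set s))"
    by (rule sum.cong) (use L det_submatrix_eq_principal_minor in \<open>force simp: h_def\<close>)+
  also have "\<dots> = (\<Sum>S\<in>set ` set L. principal_minor A S)"
    using distL by (simp add: sum.reindex distinct_map)
  finally show ?thesis by (simp add: setL)
qed

text \<open>Packs the exterior powers into a function of t that is invariant under conjugation and
  can therefore be evaluated on a triangular form. The second claim covers the exponents beyond the
  degree of this polynomial.\<close>

lemma det_one_plus_smult_exterior:
  assumes A: "A \<in> carrier_mat d d"
  shows "det (1\<^sub>m d + t \<cdot>\<^sub>m A) = (\<Sum>k\<le>d. mat_trace (exterior_power_mat k A) * t ^ k)"
    and "d < k \<Longrightarrow> mat_trace (exterior_power_mat k A) = 0"
proof -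
  have "det (1\<^sub>m d + t \<cdot>\<^sub>m A) = (\<Sum>k\<in>{..d}. \<Sum>S\<in>{S \<in> Pow {0..<d}. card S =
      k}. t ^ card S * principal_minor A S)"
    unfolding det_one_plus_smult[OF A]
  proof (rule sum.group[symmetric])
    show "card ` Pow {0..<d} \<subseteq> {..d}"   proof
      fix k assume "k \<in> card ` Pow {0..<d}"
      then obtain S where "S \<subseteq> {0..<d}" "k = card S" by auto
      then show "k \<in> {..d}" using card_mono[of "{0..<d}" S] by simp
    qed
  qed simp_all
  also have "\<dots> = (\<Sum>k\<le>d. mat_trace (exterior_power_mat k A) * t ^ k)"
  proof (rule sum.cong[OF refl])
    fix k
    have "(\<Sum>S\<in>{S \<in> Pow {0..<d}. card S = k}. t ^ card S * principal_minor A S) =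
        (\<Sum>S | S \<subseteq> {0..<d} \<and> card S = k. principal_minor A S * t ^ k)"
      by (rule sum.cong) auto
    then show "(\<Sum>S\<in>{S \<in> Pow {0..<d}. card S = k}. t ^ card S * principal_minor A S) =
        mat_trace (exterior_power_mat k A) * t ^ k"
      unfolding trace_exterior_power[OF A] by (simp only: sum_distrib_right)
  qed
  finally show "det (1\<^sub>m d + t \<cdot>\<^sub>m A) = (\<Sum>k\<le>d. mat_trace (exterior_power_mat k A) * t ^ k)" .
  show "mat_trace (exterior_power_mat k A) = 0" if "d < k"
  proof -
    have "{S. S \<subseteq> {0..<d} \<and> card S = k} = {}" 
    proof -
      have "card S \<le> d" if "S \<subseteq> {0..<d}" for S using card_mono[of "{0..<d}" S] that by simp
      then show ?thesis using that by (auto simp: not_le[symmetric])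
    qed
    then show ?thesis unfolding trace_exterior_power[OF A] by (simp only: sum.empty)
  qed
qed

section \<open>Traces and eigenvalues through triangular forms\<close>

lemma mat_trace_mult_comm:
  assumes "A \<in> carrier_mat d d" "B \<in> carrier_mat d d"
  shows "mat_trace (A * B) = mat_trace (B * A)"
proof -
  have "mat_trace (A * B) = (\<Sum>i<d. \<Sum>j<d. A $$ (i, j) * B $$ (j, i))"
    using assms by (auto simp: mat_trace_def scalar_prod_def atLeast0LessThan intro!: sum.cong)
  also have "\<dots> = (\<Sum>j<d. \<Sum>i<d. B $$ (j, i) * A $$ (i, j))"
    by (subst sum.swap) (simp add: mult.commute)
  also have "\<dots> = mat_trace (B * A)"
    using assms by (auto simp: mat_trace_def scalar_prod_def atLeast0LessThan intro!: sum.cong)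
  finally show ?thesis .
qed

lemma upper_triangular_mult:
  fixes A B :: "complex mat"
  assumes A: "A \<in> carrier_mat d d" "upper_triangular A"
      and B: "B \<in> carrier_mat d d" "upper_triangular B"
  shows "upper_triangular (A * B)" and "i < d \<Longrightarrow> (A * B) $$ (i, i) = A $$ (i, i) * B $$ (i, i)"
proof -
  \<comment> \<open>Either k < i, and the entry of A is below the diagonal, or j < k, and that of B
    is. Only k = i = j escapes.\<close>
  have zero: "A $$ (i, k) * B $$ (k, j) = 0" if "i < d" "j \<le> i" "k < d" "k \<noteq> i \<or> j < i" for i j k
  proof (cases "k < i")
    case True
    then show ?thesis using upper_triangularD[OF A(2), of k i] A that by simp
  next
    case False
    then have "j < k" using that by auto
    then show ?thesis using upper_triangularD[OF B(2), of j k] B that by simp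
  qed
  have entry: "(A * B) $$ (i, j) = (\<Sum>k<d. A $$ (i, k) * B $$ (k, j))" if "i < d" "j < d" for i j
    using A B that by (simp add: scalar_prod_def atLeast0LessThan)
  show "upper_triangular (A * B)"
  proof (rule upper_triangularI)
    fix i j assume ij: "j < i" "i < dim_row (A * B)"
    then have "(A * B) $$ (i, j) = (\<Sum>k<d. A $$ (i, k) * B $$ (k, j))" using A by (intro entry) auto
    also have "\<dots> = 0" using ij zero[of i j] A by (intro sum.neutral) auto
    finally show "(A * B) $$ (i, j) = 0" .
  qed
  show "(A * B) $$ (i, i) = A $$ (i, i) * B $$ (i, i)" if i: "i < d"
  proof -
    have "(\<Sum>k<d. A $$ (i, k) * B $$ (k, i)) = (\<Sum>k\<in>{i}. A $$ (i, k) * B $$ (k, i))"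
      by (rule sum.mono_neutral_right) (use i zero in auto)
    then show ?thesis using entry[OF i i] by simp
  qed
qed

lemma upper_triangular_pow:
  fixes A :: "complex mat"
  assumes A: "A \<in> carrier_mat d d" "upper_triangular A"
  shows "upper_triangular (A ^\<^sub>m k) \<and> (\<forall>i<d. (A ^\<^sub>m k) $$ (i, i) = (A $$ (i, i)) ^ k)"
proof (induction k)
  case 0
  then show ?case using A by auto
next
  case (Suc k)
  then show ?case
    using upper_triangular_mult[of "A ^\<^sub>m k" d A] A by (simp add: pow_carrier_mat mult.commute)
qed

text \<open>Over the complex numbers every characteristic polynomial splits, so a triangular form
  exists without further assumptions on the matrix.\<close>

lemma complex_schur:
  assumes A: "A \<in> carrier_mat d d"
  obtains B P Q :: "complex mat" where "similar_mat_wit A B P Q" "upper_triangular B"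
    "B \<in> carrier_mat d d" "P \<in> carrier_mat d d" "Q \<in> carrier_mat d d" "P * Q = 1\<^sub>m d" "Q * P = 1\<^sub>m d"
    "A = P * B * Q"
proof -
  obtain as where "char_poly A = (\<Prod>a\<leftarrow>as. [:- a, 1:])"
    using char_poly_factorized[OF A] by blast
  then obtain B where B: "upper_triangular B" "similar_mat A B"
    using schur_decomposition_exists[OF A] by blast
  then obtain P Q where w: "similar_mat_wit A B P Q" unfolding similar_mat_def by blast
  show ?thesis by (rule that[OF w B(1)]) (use similar_mat_witD2[OF A w] in auto)
qed

lemma mat_trace_conjugate:
  assumes "B \<in> carrier_mat d d" "P \<in> carrier_mat d d" "Q \<in> carrier_mat d d" "Q * P = 1\<^sub>m d"
  shows "mat_trace (P * B * Q) = mat_trace B"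
proof -
  have "mat_trace (P * B * Q) = mat_trace (Q * (P * B))"
    using assms by (intro mat_trace_mult_comm) auto
  also have "Q * (P * B) = B" using assms by (simp flip: assoc_mult_mat)
  finally show ?thesis .
qed

text \<open>The a i are the eigenvalues with multiplicity, read off the diagonal of a triangular
  form. One family has to serve both identities: the first carries the exterior powers, the second
  the power sums from which \<open>lambda_series\<close> is made.\<close>

lemma eigenvalue_sums:
  assumes A: "A \<in> carrier_mat d d"
  obtains a :: "nat \<Rightarrow> complex" where
    "\<And>t. (\<Prod>i<d. 1 + t * a i) = (\<Sum>k\<le>d. mat_trace (exterior_power_mat k A) * t ^ k)"
    "\<And>k. mat_trace (A ^\<^sub>m k) = (\<Sum>i<d. a i ^ k)"
proof -
  obtain B P Q where w: "similar_mat_wit A B P Q" "upper_triangular B"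
    "B \<in> carrier_mat d d" "P \<in> carrier_mat d d" "Q \<in> carrier_mat d d" "P * Q = 1\<^sub>m d" "Q * P = 1\<^sub>m d"
    "A = P * B * Q" using complex_schur[OF A] by blast
  show ?thesis
  proof (rule that[of "\<lambda>i. B $$ (i, i)"])
    fix t :: complex
    have "1\<^sub>m d + t \<cdot>\<^sub>m A = P * (1\<^sub>m d + t \<cdot>\<^sub>m B) * Q"
    proof -
      have "P * (1\<^sub>m d + t \<cdot>\<^sub>m B) * Q = (P * 1\<^sub>m d + P * (t \<cdot>\<^sub>m B)) * Q"
        using w by (subst mult_add_distrib_mat) auto
      also have "\<dots> = P * 1\<^sub>m d * Q + P * (t \<cdot>\<^sub>m B) * Q"
        using w by (subst add_mult_distrib_mat) auto
      also have "P * 1\<^sub>m d * Q = 1\<^sub>m d" using w by simp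
      also have "P * (t \<cdot>\<^sub>m B) * Q = t \<cdot>\<^sub>m A"
        using w by (simp add: mult_smult_distrib mult_smult_assoc_mat[of "P * B" d d])
      finally show ?thesis by simp
    qed
    then have "similar_mat (1\<^sub>m d + t \<cdot>\<^sub>m A) (1\<^sub>m d + t \<cdot>\<^sub>m B)"
      using w A by (intro similar_matI[of _ _ P Q d]) auto
    then have "det (1\<^sub>m d + t \<cdot>\<^sub>m A) = det (1\<^sub>m d + t \<cdot>\<^sub>m B)" by (rule det_similar)
    also have "\<dots> = prod_list (diag_mat (1\<^sub>m d + t \<cdot>\<^sub>m B))"
      using w upper_triangularD[OF w(2)] by (intro det_upper_triangular)
          (auto intro!: upper_triangularI)
    also have "\<dots> = (\<Prod>i<d. 1 + t * B $$ (i, i))"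
      using w by (simp add: diag_mat_def prod.distinct_set_conv_list[symmetric] atLeast0LessThan)
    finally show "(\<Prod>i<d. 1 + t * B $$ (i, i)) = (\<Sum>k\<le>d. mat_trace (exterior_power_mat k A) * t ^ k)"
      by (simp add: det_one_plus_smult_exterior[OF A])
    fix k
    have "A ^\<^sub>m k = P * B ^\<^sub>m k * Q" by (rule similar_mat_wit_pow_id[OF w(1)])
    then have "mat_trace (A ^\<^sub>m k) = mat_trace (B ^\<^sub>m k)"
      using mat_trace_conjugate[OF pow_carrier_mat[OF w(3)] w(4,5,7)] by simp
    then show "mat_trace (A ^\<^sub>m k) = (\<Sum>i<d. B $$ (i, i) ^ k)"
      using upper_triangular_pow[OF w(3,2), of k] w(3) by (simp add: mat_trace_def)
  qed
qed

text \<open>The diagonal entries of a triangular form are idempotent complex numbers, hence 0 or 1,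
  and the trace counts the ones.\<close>

lemma mat_trace_idempotent:
  assumes A: "A \<in> carrier_mat d d" and idem: "A * A = A"
  shows "mat_trace A \<in> \<nat>"
proof -
  obtain B P Q where w: "similar_mat_wit A B P Q" "upper_triangular B"
    "B \<in> carrier_mat d d" "P \<in> carrier_mat d d" "Q \<in> carrier_mat d d" "P * Q = 1\<^sub>m d" "Q * P = 1\<^sub>m d"
    "A = P * B * Q" using complex_schur[OF A] by blast
  have B: "B = Q * A * P"
    using similar_mat_witD2(3)[OF w(3) similar_mat_wit_sym[OF w(1)]] .
  have "B * B = Q * A * (P * Q) * A * P"
    using w(3-5) A by (simp add: B assoc_mult_mat[of _ d d _ d _ d])
  also have "\<dots> = Q * (A * A) * P"
    using w(3-7) A by (simp add: assoc_mult_mat[of _ d d _ d _ d])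
  also have "\<dots> = B" by (simp add: idem B)
  finally have "B * B = B" .
  then have "B $$ (i, i) * B $$ (i, i) = B $$ (i, i)" if "i < d" for i
    using upper_triangular_mult(2)[OF w(3,2) w(3,2) that] by simp
  then have "B $$ (i, i) \<in> \<nat>" if "i < d" for i
    using that by (metis Nats_0 Nats_1 mult_cancel_right2)
  note Nats = this
  have "(\<Sum>i\<in>N. B $$ (i, i)) \<in> \<nat>" if "finite N" "N \<subseteq> {..<d}" for N
    using that by (induction N) (auto simp: Nats)
  from this[of "{..<d}"] have "(\<Sum>i<d. B $$ (i, i)) \<in> \<nat>" by simp
  moreover have "mat_trace A = (\<Sum>i<d. B $$ (i, i))"
    using mat_trace_conjugate[OF w(3-5) w(7)] w(3,8) by (simp add: mat_trace_def)
  ultimately show ?thesis by simp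
qed

section \<open>The Frobenius map modulo a prime\<close>

lemma dvd_power_diff:
  fixes c x y :: "'a :: comm_ring_1"
  assumes "c dvd x - y"
  shows "c dvd x ^ k - y ^ k"
  using assms by (metis dvd_trans power_diff_sumr2 dvd_triv_left)

text \<open>The inner binomial coefficients are multiples of P. The identity is phrased as a
  divisibility because it will be applied to integral polynomials, where P is not zero.\<close>

lemma of_nat_dvd_freshman:
  fixes x y :: "'a :: comm_ring_1"
  assumes P: "prime P"
  shows "of_nat P dvd (x + y) ^ P - (x ^ P + y ^ P)"
proof -
  have P0: "0 < P" using P prime_gt_0_nat by blast
  have "(x + y) ^ P = (\<Sum>k\<le>P. of_nat (P choose k) * x ^ k * y ^ (P - k))" by (rule binomial_ring)
  also have "{..P} = insert 0 (insert P {0<..<P})" by auto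
  also have "(\<Sum>k\<in>\<dots>. of_nat (P choose k) * x ^ k * y ^ (P - k)) =
      x ^ P + y ^ P + (\<Sum>k\<in>{0<..<P}. of_nat (P choose k) * x ^ k * y ^ (P - k))"
    using P0 by (simp add: add_ac)
  finally have "(x + y) ^ P - (x ^ P + y ^ P) =
      (\<Sum>k\<in>{0<..<P}. of_nat (P choose k) * x ^ k * y ^ (P - k))" by simp
  moreover have "of_nat P dvd of_nat (P choose k) * x ^ k * y ^ (P - k)" if "k \<in> {0<..<P}" for k
  proof -
    have "P dvd P choose k" using that P by (intro dvd_choose_prime) auto
    then have "(of_nat P :: 'a) dvd of_nat (P choose k)" by (auto simp: dvd_def)
    then show ?thesis by (intro dvd_mult2)
  qed
  ultimately show ?thesis by (simp only: dvd_sum)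
qed

lemma of_nat_dvd_freshman_power:
  fixes x y :: "'a :: comm_ring_1"
  assumes P: "prime P"
  shows "of_nat P dvd (x + y) ^ (P ^ e) - (x ^ (P ^ e) + y ^ (P ^ e))"
proof (induction e)
  case (Suc e)
  let ?z = "x ^ (P ^ e) + y ^ (P ^ e)"
  have "of_nat P dvd ((x + y) ^ (P ^ e)) ^ P - ?z ^ P"
    by (rule dvd_power_diff[OF Suc])
  moreover have "of_nat P dvd ?z ^ P - ((x ^ (P ^ e)) ^ P + (y ^ (P ^ e)) ^ P)"
    by (rule of_nat_dvd_freshman[OF P])
  ultimately have "of_nat P dvd (((x + y) ^ (P ^ e)) ^ P - ?z ^ P) +
      (?z ^ P - ((x ^ (P ^ e)) ^ P + (y ^ (P ^ e)) ^ P))" by (intro dvd_add) simp_all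
  then have "of_nat P dvd ((x + y) ^ (P ^ e)) ^ P - ((x ^ (P ^ e)) ^ P + (y ^ (P ^ e)) ^ P)"
    by (simp only: diff_add_cancel add_diff_eq)
  then show ?case by (simp only: power_mult[symmetric] power_Suc2)
qed simp

section \<open>Integral polynomials filtered by degree\<close>

lemma lookup_of_nat_mult:
  "coef (of_nat c * f) m = int c * coef f m"
  for f :: "'v multiset \<Rightarrow>\<^sub>0 int"
  by (induction c) (auto simp: lookup_add algebra_simps)

abbreviation uvar :: "'v \<Rightarrow> 'v multiset \<Rightarrow>\<^sub>0 int" where
  "uvar k \<equiv> Poly_Mapping.single {#k#} 1"

context truncated_polynomials
begin

definition reduced :: "'v multiset \<Rightarrow> bool" where
  "reduced m \<longleftrightarrow> set_mset m \<subseteq> V \<and> (\<forall>k\<in>V. count m k < q k)"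

text \<open>The coefficient of a product at a reduced monomial thus involves coefficients at reduced
  monomials only; this is what makes K an ideal and the filtration J multiplicative.\<close>

lemma reduced_mono: "reduced m \<Longrightarrow> a \<subseteq># m \<Longrightarrow> reduced a"
  unfolding reduced_def using set_mset_mono mset_subset_eq_count
      by (metis order.strict_trans1 order_trans)

text \<open>\<open>K\<close> is the ideal generated by \<open>p\<close>, the \<open>u\<^sub>k\<^sup>q\<^sup>k\<close> and the variables outside \<open>V\<close>; \<open>J n\<close> is \<open>K\<close>
  plus the polynomials without terms of degree less than \<open>n\<close>.\<close>

definition K :: "('v multiset \<Rightarrow>\<^sub>0 int) set" where
  "K = {f. \<forall>m. reduced m \<longrightarrow> p dvd coef f m}"

definition J :: "nat \<Rightarrow> ('v multiset \<Rightarrow>\<^sub>0 int) set" where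
  "J n = {f. \<forall>m. reduced m \<longrightarrow> size m < n \<longrightarrow> p dvd coef f m}"

lemma K_zero: "0 \<in> K" and J_zero: "0 \<in> J n" by (simp_all add: K_def J_def)

lemma K_add: "f \<in> K \<Longrightarrow> g \<in> K \<Longrightarrow> f + g \<in> K" and K_diff: "f \<in> K \<Longrightarrow> g \<in> K \<Longrightarrow> f - g \<in> K"
  and J_add: "f \<in> J n \<Longrightarrow> g \<in> J n \<Longrightarrow> f + g \<in> J n" and J_diff: "f \<in> J n \<Longrightarrow> g \<in> J n \<Longrightarrow> f - g \<in> J n"
  by (simp_all add: K_def J_def lookup_add lookup_minus)

lemma J_uminus: "f \<in> J n \<Longrightarrow> - f \<in> J n"
  using J_diff[of 0 n f] J_zero by simp

lemma J_mono: "m \<le> n \<Longrightarrow> J n \<subseteq> J m" by (auto simp: J_def)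

lemma J_0: "f \<in> J 0" by (simp add: J_def)

lemma K_mult: "f \<in> K \<Longrightarrow> f * g \<in> K"
  by (simp add: K_def lookup_mult_multiset) (auto intro!: dvd_sum dvd_mult2 dest: reduced_mono)

text \<open>When a monomial of degree below i + j is split into two factors, one of them has degree
  below i or the other has degree below j.\<close>

lemma J_mult:
  assumes "f \<in> J i" "g \<in> J j"
  shows "f * g \<in> J (i + j)"
  unfolding J_def
proof (intro CollectI allI impI)
  fix m assume m: "reduced m" "size m < i + j"
  show "p dvd coef (f * g) m"
    unfolding lookup_mult_multiset
  proof (rule dvd_sum)
    fix a assume "a \<in> {a. a \<subseteq># m}"
    then have a: "a \<subseteq># m" by simp
    then have "size a + size (m - a) = size m" by (simp add: size_Diff_submset size_mset_mono)
    then have "size a < i \<or> size (m - a) < j" using m by auto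
    then show "p dvd coef f a * coef g (m - a)"
      using assms reduced_mono[OF m(1) a] reduced_mono[OF m(1), of "m - a"]
      by (auto simp: J_def intro: dvd_mult dvd_mult2)
  qed
qed

lemma uvar_J: "uvar k \<in> J 1"
  by (auto simp: J_def lookup_single when_def)

definition proj :: "nat \<Rightarrow> ('v multiset \<Rightarrow>\<^sub>0 int) \<Rightarrow> 'v multiset \<Rightarrow>\<^sub>0 int" where
  "proj n f = Abs_poly_mapping (\<lambda>m. coef f m when size m = n)"

lemma lookup_proj: "coef (proj n f) m = (coef f m when size m = n)"
proof -
  have "finite {m. (coef f m when size m = n) \<noteq> 0}"
    by (rule finite_subset[OF _ finite_keys[of f]]) (auto simp: in_keys_iff)
  then show ?thesis by (simp add: proj_def)
qed

text \<open>For f in \<open>J n\<close> this is the leading form of f in the truncated ring; it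
  depends only on f modulo \<open>J (Suc n)\<close>.\<close>

definition degree_part :: "nat \<Rightarrow> ('v multiset \<Rightarrow>\<^sub>0 int) \<Rightarrow> ('v multiset \<Rightarrow> int) set" where
  "degree_part n f = trunc (proj n f)"

lemma trunc_cong_K: "f - g \<in> K \<Longrightarrow> trunc f = trunc g"
  by (rule trunc_cong) (auto simp: K_def reduced_def lookup_minus)

lemma proj_add: "proj n (f + g) = proj n f + proj n g"
  and proj_diff: "proj n (f - g) = proj n f - proj n g"
  by (rule poly_mapping_eqI, simp add: lookup_proj lookup_add lookup_minus when_def)+

lemma degree_part_cong: "f - g \<in> K \<Longrightarrow> degree_part n f = degree_part n g"
  unfolding degree_part_def
  by (rule trunc_cong_K) (auto simp: proj_diff[symmetric] K_def lookup_proj when_def)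

lemma degree_part_closed: "degree_part n f \<in> carrier TR"
  by (simp add: degree_part_def trunc_closed)

lemma degree_part_add: "degree_part n (f + g) = degree_part n f \<oplus>\<^bsub>TR\<^esub> degree_part n g"
  by (simp add: degree_part_def proj_add trunc_add)

lemma degree_part_zero:
  assumes "f \<in> J (Suc n)"
  shows "degree_part n f = \<zero>\<^bsub>TR\<^esub>"
proof -
  have "proj n f - 0 \<in> K" using assms by (auto simp: K_def J_def lookup_proj when_def)
  then show ?thesis unfolding degree_part_def using trunc_cong_K trunc_zero by metis
qed

text \<open>Leading forms multiply. At a reduced monomial of degree i + j, a splitting with a factor
  of too small degree contributes 0 modulo p, and any other splitting has degrees exactly i and j.
  The membership in J is what disposes of the former.\<close>

lemma degree_part_mult:
  assumes f: "f \<in> J i" and g: "g \<in> J j"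
  shows "degree_part (i + j) (f * g) = degree_part i f \<otimes>\<^bsub>TR\<^esub> degree_part j g"
  unfolding degree_part_def trunc_mult[symmetric]
proof (rule trunc_cong_K)
  have "p dvd coef (proj (i + j) (f * g) - proj i f * proj j g) m" if m: "reduced m" for m
  proof -
    have "coef (proj (i + j) (f * g) - proj i f * proj j g) m =
      (\<Sum>a | a \<subseteq># m. ((coef f a * coef g (m - a)) when size m = i + j) -
        (coef f a when size a = i) * (coef g (m - a) when size (m - a) = j))"
      by (simp add: lookup_minus lookup_proj lookup_mult_multiset sum_subtractf when_def)
    also have "p dvd \<dots>"
    proof (rule dvd_sum)
      fix a assume "a \<in> {a. a \<subseteq># m}"
      then have a: "a \<subseteq># m" by simp
      then have s: "size a + size (m - a) = size m" by (simp add: size_Diff_submset size_mset_mono)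
      consider "size a = i" | "size a < i" | "i < size a" by linarith
      then show "p dvd ((coef f a * coef g (m - a)) when size m = i + j) -
        (coef f a when size a = i) * (coef g (m - a) when size (m - a) = j)"
      proof cases
        case 1
        then have "size m = i + j \<longleftrightarrow> size (m - a) = j" using s by auto
        then show ?thesis using 1 by (simp add: when_def)
      next
        case 2
        then have "p dvd coef f a" using f reduced_mono[OF m a] by (auto simp: J_def)
        then show ?thesis using 2 by (simp add: when_def)
      next
        case 3
        have "p dvd coef g (m - a)" if "size m = i + j"
          using g reduced_mono[OF m, of "m - a"] 3 s that by (auto simp: J_def)
        then show ?thesis using 3 by (simp add: when_def)
      qed
    qed
    finally show ?thesis .
  qed
  then show "proj (i + j) (f * g) - proj i f * proj j g \<in> K" by (simp add: K_def)
qed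

lemma degree_part_one: "degree_part 0 1 = \<one>\<^bsub>TR\<^esub>"
proof -
  have "proj 0 1 = 1"
    by (rule poly_mapping_eqI) (simp add: lookup_proj lookup_one when_def)
  then show ?thesis by (simp add: degree_part_def trunc_one)
qed

lemma degree_part_uvar: "k \<in> V \<Longrightarrow> degree_part 1 (uvar k) = truncated_var Fp V q k"
proof -
  assume "k \<in> V"
  have "proj 1 (uvar k) = uvar k"
    by (rule poly_mapping_eqI) (auto simp add: lookup_proj lookup_single when_def)
  then show ?thesis using \<open>k \<in> V\<close> by (simp add: degree_part_def trunc_var)
qed

definition vmon :: "('v \<Rightarrow> nat) \<Rightarrow> 'v multiset \<Rightarrow>\<^sub>0 int" where
  "vmon a = (\<Prod>k\<in>V. (1 + uvar k) ^ a k)"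

lemma vmon_add: "vmon (\<lambda>k. a k + b k) = vmon a * vmon b"
  by (simp add: vmon_def power_add prod.distrib)

lemma vmon_zero: "vmon (\<lambda>_. 0) = 1"
  by (simp add: vmon_def)

lemma vmon_unit: "finite V \<Longrightarrow> k \<in> V \<Longrightarrow> vmon (\<lambda>l. if l = k then 1 else 0) = 1 + uvar k"
  by (simp add: vmon_def if_distrib[of "\<lambda>i. _ ^ i"] prod.delta cong: if_cong)

lemma one_minus_power_uvar_J: "(1 + uvar k) ^ i - 1 \<in> J 1"
proof (induction i)
  case (Suc i)
  have "(1 + uvar k) ^ Suc i - 1 = ((1 + uvar k) ^ i - 1) + uvar k * (1 + uvar k) ^ i"
    by (simp add: algebra_simps)
  moreover have "uvar k * (1 + uvar k) ^ i \<in> J 1"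
    using J_mult[OF uvar_J J_0, of k "(1 + uvar k) ^ i"] by simp
  ultimately show ?case using J_add[OF Suc] by (simp only:)
qed (simp add: J_zero)

lemma vmon_minus_one_J: "vmon a - 1 \<in> J 1"
proof -
  have "(\<Prod>k\<in>A. (1 + uvar k) ^ a k) - 1 \<in> J 1" for A :: "'v set"
  proof (induction A rule: infinite_finite_induct)
    case (insert k A)
    let ?P = "\<Prod>k\<in>A. (1 + uvar k) ^ a k"
    have "(1 + uvar k) ^ a k * ?P - 1 = ((1 + uvar k) ^ a k - 1) * ?P + (?P - 1)"
      by (simp add: algebra_simps)
    moreover have "((1 + uvar k) ^ a k - 1) * ?P \<in> J 1"
      using J_mult[OF one_minus_power_uvar_J J_0, of k "a k" ?P] by simp
    ultimately show ?case using J_add insert by (simp only: prod.insert simp_thms)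
  qed (auto simp: J_zero)
  then show ?thesis by (simp add: vmon_def)
qed

lemma power_uvar_K:
  assumes P: "prime P" "p = int P" and k: "k \<in> V" "q k = P ^ e"
  shows "(1 + uvar k) ^ q k - 1 \<in> K"
proof -
  obtain h where h: "(1 + uvar k) ^ q k - (1 ^ q k + uvar k ^ q k) = of_nat P * h"
    using of_nat_dvd_freshman_power[OF P(1), of 1 "uvar k" e] k(2) by (auto simp: dvd_def)
  then have "(1 + uvar k) ^ q k - 1 = of_nat P * h + uvar k ^ q k" by (simp add: algebra_simps)
  moreover have "of_nat P * h \<in> K" by (simp add: K_def lookup_of_nat_mult flip: P(2))
  moreover have "uvar k ^ q k \<in> K"
    using k(1) by (auto simp: K_def single_power lookup_single when_def reduced_def)
  ultimately show ?thesis by (simp add: K_add)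
qed

text \<open>The counterpart of \<open>\<sigma>_mod\<close> on the polynomial side: exponents can be
  reduced simultaneously in a character and in the polynomial substituted for it.\<close>

lemma vmon_mod_K:
  assumes "finite V" and P: "prime P" "p = int P" and q: "\<And>k. k \<in> V \<Longrightarrow> q k = P ^ e k"
  shows "vmon a - vmon (\<lambda>k. a k mod q k) \<in> K"
proof -
  have pow: "(1 + uvar k) ^ i - (1 + uvar k) ^ (i mod q k) \<in> K" if k: "k \<in> V" for k i
  proof -
    let ?v = "1 + uvar k"
    have "(?v ^ q k) ^ j - 1 \<in> K" for j
    proof (induction j)
      case (Suc j)
      have "(?v ^ q k) ^ Suc j - 1 = (?v ^ q k - 1) * (?v ^ q k) ^ j + ((?v ^ q k) ^ j - 1)"
        by (simp add: algebra_simps)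
      then show ?case using K_add[OF K_mult[OF power_uvar_K[OF P k q[OF k]]] Suc] by (simp only:)
    qed (simp add: K_zero)
    from K_mult[OF this[of "i div q k"], of "?v ^ (i mod q k)"]
    have "((?v ^ q k) ^ (i div q k) - 1) * ?v ^ (i mod q k) \<in> K" .
    moreover have "(?v ^ q k) ^ (i div q k) * ?v ^ (i mod q k) = ?v ^ i"
      by (simp flip: power_mult power_add)
    ultimately show ?thesis by (simp add: left_diff_distrib)
  qed
  have "(\<Prod>k\<in>A. (1 + uvar k) ^ a k) - (\<Prod>k\<in>A. (1 + uvar k) ^ (a k mod q k)) \<in> K" if "A \<subseteq> V" for A
    using finite_subset[OF that assms(1)] that
  proof (induction A rule: finite_induct)
    case (insert k A)
    let ?P = "\<Prod>k\<in>A. (1 + uvar k) ^ a k" and ?Q = "\<Prod>k\<in>A. (1 + uvar k) ^ (a k mod q k)"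
    have "(1 + uvar k) ^ a k * ?P - (1 + uvar k) ^ (a k mod q k) * ?Q =
        ((1 + uvar k) ^ a k - (1 + uvar k) ^ (a k mod q k)) * ?P + (?P - ?Q) * (1 + uvar k) ^ (a k
            mod q k)"
      by (simp add: algebra_simps)
    then show ?case using insert K_mult[OF pow] K_mult by (simp add: K_add)
  qed (simp add: K_zero)
  from this[of V] show ?thesis by (simp add: vmon_def)
qed

end

section \<open>Linear characters\<close>

lemma cring_function_ring: "cring (function_ring G)"
proof (intro cringI abelian_groupI comm_monoidI)
  fix x assume "x \<in> carrier (function_ring G)"
  then show "\<exists>y\<in>carrier (function_ring G). y \<oplus>\<^bsub>function_ring G\<^esub> x = \<zero>\<^bsub>function_ring G\<^esub>"
    by (intro bexI[of _ "\<lambda>g\<in>carrier G. - x g"]) (auto simp: function_ring_def)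
qed (auto simp: function_ring_def fun_eq_iff PiE_def extensional_def algebra_simps)

lemma minus_function_ring:
  assumes "x \<in> carrier (function_ring G)"
  shows "\<ominus>\<^bsub>function_ring G\<^esub> x = (\<lambda>g\<in>carrier G. - x g)"
proof -
  interpret cring "function_ring G" by (rule cring_function_ring)
  show ?thesis
    by (rule minus_equality) (use assms in \<open>auto simp: function_ring_def fun_eq_iff\<close>)
qed

lemma mat_trace_1: "A \<in> carrier_mat 1 1 \<Longrightarrow> mat_trace A = A $$ (0, 0)"
  by (simp add: mat_trace_def)

lemma matrix_rep_carrier: "matrix_rep G d r \<Longrightarrow> x \<in> carrier G \<Longrightarrow> r x \<in> carrier_mat d d"
  by (auto simp: matrix_rep_def units_of_def Units_def ring_mat_def hom_def Pi_def)

lemma matrix_rep_mult: "matrix_rep G d r \<Longrightarrow> x \<in> carrier G \<Longrightarrow> y \<in> carrier G \<Longrightarrow> r (x \<otimes>\<^bsub>G\<^esub> y) = r x * r y"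
  by (auto simp: matrix_rep_def units_of_def ring_mat_def hom_def)

lemma matrix_rep_one:
  assumes "group G" "matrix_rep G d r"
  shows "r \<one>\<^bsub>G\<^esub> = 1\<^sub>m d"
proof -
  interpret M: ring "ring_mat TYPE(complex) d ()" by (rule ring_mat)
  have "group_hom G (units_of (ring_mat TYPE(complex) d ())) r"
    using assms M.units_group by (simp add: group_hom_def group_hom_axioms_def matrix_rep_def)
  from group_hom.hom_one[OF this] show ?thesis by (simp add: units_of_def ring_mat_def)
qed

lemma matrix_rep_pow:
  assumes G: "group G" "matrix_rep G d r" and x: "x \<in> carrier G"
  shows "r (x [^]\<^bsub>G\<^esub> (k::nat)) = r x ^\<^sub>m k"
proof (induction k)
  case 0
  then show ?case using matrix_rep_one[OF G] matrix_rep_carrier[OF G(2) x] by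
      (simp add: nat_pow_def)
next
  case (Suc k)
  interpret group G by fact
  show ?case using Suc matrix_rep_mult[OF G(2) _ x] x by simp
qed

lemma linear_character_facts:
  assumes G: "group G" and \<chi>: "\<chi> \<in> linear_characters G"
  shows "\<chi> \<in> extensional (carrier G)" and "\<chi> \<one>\<^bsub>G\<^esub> = 1"
    and "\<And>x y. x \<in> carrier G \<Longrightarrow> y \<in> carrier G \<Longrightarrow> \<chi> (x \<otimes>\<^bsub>G\<^esub> y) = \<chi> x * \<chi> y"
proof -
  interpret group G by fact
  obtain r where r: "matrix_rep G 1 r" and \<chi>: "\<chi> = character G r"
    using \<chi> by (auto simp: linear_characters_def)
  have \<chi>_eq: "\<chi> x = r x $$ (0, 0)" if "x \<in> carrier G" for x
    using that matrix_rep_carrier[OF r that] by (simp add: \<chi> character_def mat_trace_1)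
  show "\<chi> \<in> extensional (carrier G)" by (simp add: \<chi> character_def)
  show "\<chi> \<one>\<^bsub>G\<^esub> = 1" by (simp add: \<chi>_eq matrix_rep_one[OF G r])
  fix x y assume xy: "x \<in> carrier G" "y \<in> carrier G"
  then show "\<chi> (x \<otimes>\<^bsub>G\<^esub> y) = \<chi> x * \<chi> y"
    using matrix_rep_carrier[OF r xy(1)] matrix_rep_carrier[OF r xy(2)]
    by (simp add: \<chi>_eq matrix_rep_mult[OF r xy] scalar_prod_def)
qed

definition scalar_mat :: "complex \<Rightarrow> complex mat" where
  "scalar_mat c = mat 1 1 (\<lambda>_. c)"

lemma scalar_mat_rep:
  assumes G: "group G" and one: "\<chi> \<one>\<^bsub>G\<^esub> = 1"
    and mult: "\<And>x y. x \<in> carrier G \<Longrightarrow> y \<in> carrier G \<Longrightarrow> \<chi> (x \<otimes>\<^bsub>G\<^esub> y) = \<chi> x * \<chi> y"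
  shows "matrix_rep G 1 (\<lambda>x. scalar_mat (\<chi> x))"
proof -
  interpret group G by fact
  have mm: "scalar_mat a * scalar_mat b = scalar_mat (a * b)" for a b
    by (rule eq_matI) (auto simp: scalar_mat_def scalar_prod_def)
  have o: "scalar_mat 1 = 1\<^sub>m 1" by (rule eq_matI) (auto simp: scalar_mat_def)
  have c: "scalar_mat a \<in> carrier_mat 1 1" for a by (simp add: scalar_mat_def)
  have "\<exists>B\<in>carrier_mat 1 1. B * scalar_mat (\<chi> x) = 1\<^sub>m 1 \<and> scalar_mat (\<chi> x) * B = 1\<^sub>m 1"
    if x: "x \<in> carrier G" for x
    by (rule bexI[of _ "scalar_mat (\<chi> (inv\<^bsub>G\<^esub> x))"])
      (use x in \<open>simp_all add: mm c o[symmetric] mult[symmetric] one del: One_nat_def\<close>)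
  then show ?thesis
    by (auto simp: matrix_rep_def hom_def units_of_def Units_def ring_mat_def mm mult c simp del:
        One_nat_def)
qed

lemma character_scalar_mat: "\<chi> \<in> extensional (carrier G) \<Longrightarrow> character G (\<lambda>x. scalar_mat (\<chi> x)) = \<chi>"
  by (auto simp: character_def scalar_mat_def mat_trace_def extensional_def)

lemma irreducible_scalar_rep:
  assumes "matrix_rep G 1 r"
  shows "irreducible_rep G 1 r"
  unfolding irreducible_rep_def
proof (intro conjI allI impI)
  fix W assume W: "VectorSpace.subspace class_ring W (module_vec TYPE(complex) 1) \<and>
     (\<forall>g\<in>carrier G. \<forall>w\<in>W. r g *\<^sub>v w \<in> W)"
  then have sub: "submodule class_ring W (module_vec TYPE(complex) 1)"
    using subspace.submod by blast
  have WV: "W \<subseteq> carrier_vec 1" and zero: "0\<^sub>v 1 \<in> W"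
    and smult: "\<And>c w. w \<in> W \<Longrightarrow> c \<cdot>\<^sub>v w \<in> W"
    using submodule.subset[OF sub] submodule.zero_closed[OF sub] submodule.smult_closed[OF sub]
    by (simp_all add: module_vec_simps class_ring_simps)
  show "W = {0\<^sub>v 1} \<or> W = carrier_vec 1"
  proof (cases "W \<subseteq> {0\<^sub>v 1}")
    case True
    then show ?thesis using zero by blast
  next
    case False
    then obtain w where w: "w \<in> W" "w \<noteq> 0\<^sub>v 1" by blast
    then have wc: "w \<in> carrier_vec 1" using WV by blast
    then have w0: "w $ 0 \<noteq> 0" using w(2) by (auto simp: vec_eq_iff)
    have "v \<in> W" if "v \<in> carrier_vec 1" for v
    proof -
      have "v = (v $ 0 / w $ 0) \<cdot>\<^sub>v w" using that wc w0 by (auto simp: vec_eq_iff)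
      then show ?thesis using smult[OF w(1)] by metis
    qed
    then show ?thesis using WV by blast
  qed
qed (use assms in auto)

section \<open>Characters of a product of cyclic groups\<close>

lemma exp_root_power:
  assumes "0 < m"
  shows "exp (2 * complex_of_real pi * \<i> / of_nat m) ^ j = cis (2 * pi * real j / real m)"
  by (simp add: cis_conv_exp exp_of_nat_mult[symmetric] mult_ac)

lemma exp_root_power_inj:
  assumes "0 < m"
  shows "inj_on (\<lambda>j. exp (2 * complex_of_real pi * \<i> / of_nat m) ^ j) {..<m}"
  using bij_betw_roots_unity[OF assms] by (simp add: exp_root_power[OF assms] bij_betw_def)

lemma sum_powers_root_unity:
  fixes z :: complex
  assumes "z ^ m = 1"
  shows "(\<Sum>i<m. z ^ i) = (if z = 1 then of_nat m else 0)"
  using assms by (auto simp: sum_gp_strict)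

locale cyclic_product =
  fixes P n :: nat and e :: "nat \<Rightarrow> nat" and C :: "nat \<Rightarrow> 'a monoid" and z :: "nat \<Rightarrow> 'a"
    and \<chi> :: "nat \<Rightarrow> 'a \<Rightarrow> complex"
  assumes prime_P: "prime P"
    and group_C: "k < n \<Longrightarrow> group (C k)"
    and gen_C: "k < n \<Longrightarrow> z k \<in> carrier (C k) \<and> carrier (C k) = generate (C k) {z k}"
    and order_C: "k < n \<Longrightarrow> Coset.order (C k) = P ^ e k"
    and \<chi>_linear: "k < n \<Longrightarrow> \<chi> k \<in> linear_characters (C k)"
    and \<chi>_gen: "k < n \<Longrightarrow> \<chi> k (z k) = exp (2 * complex_of_real pi * \<i> / of_nat (P ^ e k))"
begin

abbreviation q :: "nat \<Rightarrow> nat" where "q k \<equiv> P ^ e k"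

definition G :: "(nat \<Rightarrow> 'a) monoid" where "G = product_group {..<n} C"

lemma P_gt_1: "1 < int P" using prime_gt_1_nat[OF prime_P] by simp

lemma q_pos: "0 < q k" using prime_gt_0_nat[OF prime_P] by simp

sublocale truncated_polynomials "int P" "{..<n}" q
  by unfold_locales (rule P_gt_1)

sublocale G: group G
  unfolding G_def by (rule product_group) (simp add: group_C)

lemma carrier_G: "carrier G = (\<Pi>\<^sub>E k\<in>{..<n}. carrier (C k))"
  and one_G: "\<one>\<^bsub>G\<^esub> = (\<lambda>k\<in>{..<n}. \<one>\<^bsub>C k\<^esub>)"
  and mult_G: "x \<otimes>\<^bsub>G\<^esub> y = (\<lambda>k\<in>{..<n}. x k \<otimes>\<^bsub>C k\<^esub> y k)"
  by (simp_all add: G_def)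

lemma finite_C: "k < n \<Longrightarrow> finite (carrier (C k))"
  using order_C[of k] q_pos[of k] by (metis Coset.order_def card_ge_0_finite)

lemma finite_G: "finite (carrier G)"
  unfolding carrier_G by (rule finite_PiE) (auto simp: finite_C)

lemma card_G: "card (carrier G) = (\<Prod>k<n. q k)"
  unfolding carrier_G by (simp add: card_PiE) (simp add: order_C[unfolded Coset.order_def])

lemma card_G_pos: "0 < card (carrier G)"
  using prime_gt_0_nat[OF prime_P] by (simp add: card_G prod_pos)

lemma \<chi>_one: "k < n \<Longrightarrow> \<chi> k \<one>\<^bsub>C k\<^esub> = 1"
  and \<chi>_mult: "k < n \<Longrightarrow> x \<in> carrier (C k) \<Longrightarrow> y \<in> carrier (C k) \<Longrightarrow> \<chi> k (x \<otimes>\<^bsub>C k\<^esub> y) = \<chi> k x * \<chi> k y"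
  using linear_character_facts[OF group_C \<chi>_linear] by auto

lemma \<chi>_pow: "k < n \<Longrightarrow> x \<in> carrier (C k) \<Longrightarrow> \<chi> k (x [^]\<^bsub>C k\<^esub> (j::nat)) = \<chi> k x ^ j"
proof (induction j)
  case 0
  then show ?case by (simp add: nat_pow_def \<chi>_one)
next
  case (Suc j)
  interpret Ck: group "C k" by (rule group_C[OF Suc.prems(1)])
  show ?case using Suc by (simp add: \<chi>_mult mult.commute)
qed

lemma \<chi>_order: "k < n \<Longrightarrow> x \<in> carrier (C k) \<Longrightarrow> \<chi> k x ^ q k = 1"
  using group.pow_order_eq_1[OF group_C, of k x] by (simp add: order_C \<chi>_pow[symmetric] \<chi>_one)

lemma \<chi>_nonzero: "k < n \<Longrightarrow> x \<in> carrier (C k) \<Longrightarrow> \<chi> k x \<noteq> 0"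
  using \<chi>_order[of k x] q_pos[of k] by (auto simp: power_0_left)

text \<open>The character is faithful since its value at the generator is a primitive root of unity
  whose order is that of the group.\<close>

lemma \<chi>_eq_1: 
  assumes k: "k < n" and x: "x \<in> carrier (C k)" and 1: "\<chi> k x = 1"
  shows "x = \<one>\<^bsub>C k\<^esub>"
proof -
  interpret Ck: group "C k" by (rule group_C[OF k])
  obtain j :: nat where j: "x = z k [^]\<^bsub>C k\<^esub> j"
    using x gen_C[OF k] Ck.generate_pow_on_finite_carrier[OF finite_C[OF k], of "z k"] by auto
  have gk: "z k \<in> carrier (C k)" using gen_C[OF k] by (rule conjunct1)
  have ordr: "z k [^]\<^bsub>C k\<^esub> q k = \<one>\<^bsub>C k\<^esub>" using Ck.pow_order_eq_1[OF gk] by (simp add: order_C[OF k])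
  \<comment> \<open>Moves the exponent into the range on which the powers of the root of unity are
    distinct.\<close>
  have red: "z k [^]\<^bsub>C k\<^esub> j = z k [^]\<^bsub>C k\<^esub> (j mod q k)"
  proof -
    have "z k [^]\<^bsub>C k\<^esub> j = z k [^]\<^bsub>C k\<^esub> (q k * (j div q k) + j mod q k)" by simp
    also have "\<dots> = (z k [^]\<^bsub>C k\<^esub> q k) [^]\<^bsub>C k\<^esub> (j div q k) \<otimes>\<^bsub>C k\<^esub> z k [^]\<^bsub>C k\<^esub> (j mod q k)"
      using gk by (simp only: Ck.nat_pow_mult[symmetric] Ck.nat_pow_pow)
    finally show ?thesis using gk by (simp add: ordr)
  qed
  have "\<chi> k (z k) ^ (j mod q k) = \<chi> k (z k) ^ 0"
    using 1 by (simp add: j red \<chi>_pow[OF k gk])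
  then have "j mod q k = 0"
    unfolding \<chi>_gen[OF k] using inj_onD[OF exp_root_power_inj[OF q_pos[of k]], of "j mod q k" 0]
        q_pos[of k] by auto
  then show ?thesis by (simp add: j red)
qed

definition \<sigma> :: "(nat \<Rightarrow> nat) \<Rightarrow> (nat \<Rightarrow> 'a) \<Rightarrow> complex" where
  "\<sigma> a = (\<lambda>x\<in>carrier G. \<Prod>k<n. \<chi> k (x k) ^ a k)"

lemma \<sigma>_ext: "\<sigma> a \<in> extensional (carrier G)" by (simp add: \<sigma>_def)

lemma coord: "x \<in> carrier G \<Longrightarrow> k < n \<Longrightarrow> x k \<in> carrier (C k)"
  by (auto simp: carrier_G)

lemma \<sigma>_one: "\<sigma> a \<one>\<^bsub>G\<^esub> = 1"
proof -
  have "\<sigma> a \<one>\<^bsub>G\<^esub> = (\<Prod>k<n. \<chi> k (\<one>\<^bsub>G\<^esub> k) ^ a k)" unfolding \<sigma>_def by simp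
  then show ?thesis by (simp add: one_G \<chi>_one)
qed

lemma \<sigma>_mult: "x \<in> carrier G \<Longrightarrow> y \<in> carrier G \<Longrightarrow> \<sigma> a (x \<otimes>\<^bsub>G\<^esub> y) = \<sigma> a x * \<sigma> a y"
proof -
  assume xy: "x \<in> carrier G" "y \<in> carrier G"
  then have "\<sigma> a (x \<otimes>\<^bsub>G\<^esub> y) = (\<Prod>k<n. \<chi> k ((x \<otimes>\<^bsub>G\<^esub> y) k) ^ a k)" unfolding \<sigma>_def by simp
  then show ?thesis
    using xy by (simp add: mult_G \<chi>_mult coord power_mult_distrib prod.distrib) (simp add: \<sigma>_def)
qed

lemma \<sigma>_nonzero: "x \<in> carrier G \<Longrightarrow> \<sigma> a x \<noteq> 0"
  by (simp add: \<sigma>_def \<chi>_nonzero coord)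

lemma \<sigma>_inv: "x \<in> carrier G \<Longrightarrow> \<sigma> a (inv\<^bsub>G\<^esub> x) = inverse (\<sigma> a x)"
  using \<sigma>_mult[of x "inv\<^bsub>G\<^esub> x" a] \<sigma>_nonzero[of x a] by (simp add: \<sigma>_one field_simps)

lemma \<sigma>_pow: "x \<in> carrier G \<Longrightarrow> \<sigma> a (x [^]\<^bsub>G\<^esub> (j::nat)) = \<sigma> a x ^ j"
  by (induction j) (simp_all add: \<sigma>_one \<sigma>_mult mult.commute)

lemma \<sigma>_add: "x \<in> carrier G \<Longrightarrow> \<sigma> (\<lambda>k. a k + b k) x = \<sigma> a x * \<sigma> b x"
  by (simp add: \<sigma>_def power_add prod.distrib)

lemma \<sigma>_mod: "\<sigma> (\<lambda>k. a k mod q k) = \<sigma> a"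
proof
  fix x
  have "\<chi> k (x k) ^ (a k mod q k) = \<chi> k (x k) ^ a k" if "x \<in> carrier G" "k < n" for k
  proof -
    have "\<chi> k (x k) ^ a k = \<chi> k (x k) ^ (q k * (a k div q k) + a k mod q k)" by simp
    also have "\<dots> = (\<chi> k (x k) ^ q k) ^ (a k div q k) * \<chi> k (x k) ^ (a k mod q k)"
      by (simp only: power_add power_mult)
    finally show ?thesis using that by (simp add: \<chi>_order coord)
  qed
  then show "\<sigma> (\<lambda>k. a k mod q k) x = \<sigma> a x" by (simp add: \<sigma>_def)
qed

text \<open>One exponent vector for each linear character of G; the extensional product fixes the
  values outside \<open>{..<n}\<close>, so that distinct vectors give distinct characters.\<close>

definition box :: "(nat \<Rightarrow> nat) set" where "box = (\<Pi>\<^sub>E k\<in>{..<n}. {..<q k})"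

lemma finite_box: "finite box" unfolding box_def by (rule finite_PiE) auto

text \<open>Column orthogonality. The sum factors into one sum of powers of a root of unity per
  coordinate; unless every \<open>\<chi> k (x k)\<close> is 1 a factor vanishes, and if all are 1
  then x is trivial by faithfulness.\<close>

lemma \<sigma>_sum_box:
  assumes x: "x \<in> carrier G"
  shows "(\<Sum>a\<in>box. \<sigma> a x) = (if x = \<one>\<^bsub>G\<^esub> then of_nat (card (carrier G)) else 0)"
proof -
  have "(\<Sum>a\<in>box. \<sigma> a x) = (\<Prod>k<n. \<Sum>i<q k. \<chi> k (x k) ^ i)"
    using x by (simp add: \<sigma>_def box_def prod_sum_PiE)
  also have "\<dots> = (\<Prod>k<n. if \<chi> k (x k) = 1 then of_nat (q k) else 0)"
    using x by (intro prod.cong) (auto simp: sum_powers_root_unity \<chi>_order coord)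
  also have "\<dots> = (if x = \<one>\<^bsub>G\<^esub> then of_nat (card (carrier G)) else 0)"
  proof (cases "x = \<one>\<^bsub>G\<^esub>")
    case True
    then show ?thesis by (simp add: one_G \<chi>_one card_G)
  next
    case False
    have "\<exists>k<n. \<chi> k (x k) \<noteq> 1"
    proof (rule ccontr)
      assume "\<not> (\<exists>k<n. \<chi> k (x k) \<noteq> 1)"
      then have "x k = \<one>\<^bsub>C k\<^esub>" if "k < n" for k using \<chi>_eq_1 coord[OF x] that by blast
      then have "x = \<one>\<^bsub>G\<^esub>"
        using x by (auto simp: one_G carrier_G PiE_def extensional_def fun_eq_iff)
      then show False using False by simp
    qed
    then show ?thesis using False by auto
  qed
  finally show ?thesis .
qed

text \<open>Row orthogonality, with division in place of complex conjugation. Translating the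
  summation by an element y at which the two characters differ multiplies the sum by a factor other
  than 1.\<close>

lemma \<sigma>_orthogonal:
  assumes a: "a \<in> box" and b: "b \<in> box"
  shows "(\<Sum>x\<in>carrier G. \<sigma> a x / \<sigma> b x) = (if a = b then of_nat (card (carrier G)) else 0)"
proof (cases "a = b")
  case True
  have "(\<Sum>x\<in>carrier G. \<sigma> a x / \<sigma> b x) = (\<Sum>x\<in>carrier G. 1)"
    by (rule sum.cong) (simp_all add: True \<sigma>_nonzero)
  then show ?thesis by (simp add: True)
next
  case False
  then obtain k where k: "k < n" "a k \<noteq> b k"
    using a b by (metis PiE_ext box_def lessThan_iff)
  \<comment> \<open>The generator in a coordinate k where the exponents differ, and the identity
    elsewhere. The exponents are recovered from the values at y, as both lie below
    \<open>q k\<close>.\<close>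
  define y where "y = (\<lambda>l\<in>{..<n}. if l = k then z k else \<one>\<^bsub>C l\<^esub>)"
  have y: "y \<in> carrier G"
    using gen_C[OF k(1)] group_C by (auto simp: y_def carrier_G Group.group_def monoid.one_closed)
  have \<sigma>y: "\<sigma> c y = \<chi> k (z k) ^ c k" for c
  proof -
    have "\<sigma> c y = (\<Prod>l<n. \<chi> l (y l) ^ c l)" using y by (simp add: \<sigma>_def)
    also have "\<dots> = (\<Prod>l<n. if l = k then \<chi> k (z k) ^ c k else 1)"
      by (rule prod.cong) (auto simp: y_def \<chi>_one)
    finally have "\<sigma> c y = (\<Prod>l<n. if l = k then \<chi> k (z k) ^ c k else 1)" .
    then show ?thesis using k(1) by simp
  qed
  let ?S = "\<Sum>x\<in>carrier G. \<sigma> a x / \<sigma> b x"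
  have "?S = (\<Sum>x\<in>carrier G. \<sigma> a (y \<otimes>\<^bsub>G\<^esub> x) / \<sigma> b (y \<otimes>\<^bsub>G\<^esub> x))"
    by (rule sum.reindex_bij_betw[symmetric])
      (auto intro!: bij_betw_byWitness[where f' = "\<lambda>x. inv\<^bsub>G\<^esub> y \<otimes>\<^bsub>G\<^esub> x"] simp: y G.m_assoc[symmetric])
  also have "\<dots> = (\<sigma> a y / \<sigma> b y) * ?S"
    using y by (simp add: \<sigma>_mult sum_distrib_left)
  finally have *: "(1 - \<sigma> a y / \<sigma> b y) * ?S = 0" by (simp add: algebra_simps)
  have "\<sigma> a y \<noteq> \<sigma> b y"
  proof
    assume "\<sigma> a y = \<sigma> b y"
    then have "a k = b k"
      unfolding \<sigma>y \<chi>_gen[OF k(1)]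
      using inj_onD[OF exp_root_power_inj[OF q_pos[of k]], of "a k" "b k"] a b k(1)
      by (auto simp: box_def)
    then show False using k(2) by simp
  qed
  then have "?S = 0" using * \<sigma>_nonzero[OF y, of b] by auto
  then show ?thesis using False by simp
qed

end

section \<open>The character ring\<close>

context cyclic_product
begin

text \<open>\<open>lifts x f\<close> means that \<open>f\<close> arises from an expression of \<open>x\<close> in the \<open>\<rho>\<^sub>k\<close> by substituting \<open>1
  + u\<^sub>k\<close> for \<open>\<rho>\<^sub>k\<close>. Such an \<open>f\<close> is unique modulo \<open>K\<close> only.\<close>

inductive lifts :: "((nat \<Rightarrow> 'a) \<Rightarrow> complex) \<Rightarrow> (nat multiset \<Rightarrow>\<^sub>0 int) \<Rightarrow> bool" where
  lifts_zero: "lifts (\<lambda>g\<in>carrier G. 0) 0"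
| lifts_step_add: "lifts x f \<Longrightarrow> lifts (\<lambda>g\<in>carrier G. x g + \<sigma> a g) (f + vmon a)"
| lifts_step_diff: "lifts x f \<Longrightarrow> lifts (\<lambda>g\<in>carrier G. x g - \<sigma> a g) (f - vmon a)"

lemma lifts_ext: "lifts x f \<Longrightarrow> x \<in> extensional (carrier G)"
  by (induction rule: lifts.induct) (simp_all only: restrict_extensional)

lemma lifts_cong:
  assumes "lifts x f" "y \<in> extensional (carrier G)" "\<And>g. g \<in> carrier G \<Longrightarrow> y g = x g"
  shows "lifts y f"
  using assms extensionalityI[OF assms(2) lifts_ext[OF assms(1)]] by simp

text \<open>Rewrites the function pointwise and the polynomial by an equation in one go, which
  closes most of the cases below.\<close>

lemma lifts_restrict:
  assumes "lifts x f" "\<And>g. g \<in> carrier G \<Longrightarrow> y g = x g" "f' = f"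
  shows "lifts (restrict y (carrier G)) f'"
  unfolding assms(3) by (rule lifts_cong[OF assms(1)])
      (simp_all only: restrict_extensional restrict_apply' assms(2))

lemma lifts_add:
  assumes "lifts x f" "lifts y h"
  shows "lifts (\<lambda>g\<in>carrier G. x g + y g) (f + h)"
  using assms(2)
proof (induction rule: lifts.induct)
  case lifts_zero
  show ?case by (rule lifts_restrict[OF assms(1)]) simp_all
next
  case (lifts_step_add y h a)
  from lifts.lifts_step_add[OF lifts_step_add.IH, of a] show ?case by (rule lifts_restrict)
      (simp_all add: algebra_simps)
next
  case (lifts_step_diff y h a)
  from lifts.lifts_step_diff[OF lifts_step_diff.IH, of a] show ?case by (rule lifts_restrict)
      (simp_all add: algebra_simps)
qed

lemma lifts_minus: "lifts x f \<Longrightarrow> lifts (\<lambda>g\<in>carrier G. - x g) (- f)"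
proof (induction rule: lifts.induct)
  case lifts_zero
  show ?case by (rule lifts_restrict[OF lifts.lifts_zero]) simp_all
next
  case (lifts_step_add y h a)
  from lifts.lifts_step_diff[OF lifts_step_add.IH, of a] show ?case by (rule lifts_restrict)
      (simp_all add: algebra_simps)
next
  case (lifts_step_diff y h a)
  from lifts.lifts_step_add[OF lifts_step_diff.IH, of a] show ?case by (rule lifts_restrict)
      (simp_all add: algebra_simps)
qed

lemma lifts_diff: "lifts x f \<Longrightarrow> lifts y h \<Longrightarrow> lifts (\<lambda>g\<in>carrier G. x g - y g) (f - h)"
  using lifts_restrict[OF lifts_add[OF _ lifts_minus, of x f y h]] by simp

lemma lifts_\<sigma>: "lifts (\<sigma> a) (vmon a)"
  using lifts_cong[OF lifts_step_add[OF lifts_zero, of a] \<sigma>_ext] by simp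

lemma lifts_one: "lifts (\<lambda>g\<in>carrier G. 1) 1"
  by (rule lifts_restrict[OF lifts_\<sigma>[of "\<lambda>_. 0"]]) (simp_all add: vmon_zero \<sigma>_def)

lemma lifts_\<sigma>_mult: "lifts x f \<Longrightarrow> lifts (\<lambda>g\<in>carrier G. \<sigma> b g * x g) (vmon b * f)"
proof (induction rule: lifts.induct)
  case lifts_zero
  show ?case by (rule lifts_restrict[OF lifts.lifts_zero]) simp_all
next
  case (lifts_step_add y h a)
  from lifts.lifts_step_add[OF lifts_step_add.IH, of "\<lambda>k. b k + a k"] show ?case
      by (rule lifts_restrict) (simp_all add: vmon_add \<sigma>_add distrib_left)
next
  case (lifts_step_diff y h a)
  from lifts.lifts_step_diff[OF lifts_step_diff.IH, of "\<lambda>k. b k + a k"] show ?case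
      by (rule lifts_restrict) (simp_all add: vmon_add \<sigma>_add right_diff_distrib)
qed

lemma lifts_mult:
  assumes y: "lifts y h"
  shows "lifts x f \<Longrightarrow> lifts (\<lambda>g\<in>carrier G. x g * y g) (f * h)"
proof (induction rule: lifts.induct)
  case lifts_zero
  show ?case by (rule lifts_restrict[OF lifts.lifts_zero]) simp_all
next
  case (lifts_step_add x f a)
  from lifts_add[OF lifts_step_add.IH lifts_\<sigma>_mult[OF y, of a]] show ?case by (rule lifts_restrict)
      (simp_all add: distrib_right)
next
  case (lifts_step_diff x f a)
  from lifts_diff[OF lifts_step_diff.IH lifts_\<sigma>_mult[OF y, of a]] show ?case
      by (rule lifts_restrict) (simp_all add: left_diff_distrib)
qed

lemma lifts_sum:
  assumes "finite A" "\<And>i. i \<in> A \<Longrightarrow> lifts (x i) (f i)"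
  shows "lifts (\<lambda>g\<in>carrier G. \<Sum>i\<in>A. x i g) (\<Sum>i\<in>A. f i)"
  using assms
proof (induction A rule: finite_induct)
  case empty
  show ?case using lifts_zero by (simp only: sum.empty)
next
  case (insert i A)
  then have "lifts (\<lambda>g\<in>carrier G. x i g + (\<lambda>g\<in>carrier G. \<Sum>i\<in>A. x i g) g) (f i + (\<Sum>i\<in>A. f i))"
    by (intro lifts_add) auto
  then show ?case by (rule lifts_restrict) (simp_all add: insert.hyps)
qed

lemma lifts_of_nat_mult: "lifts x f \<Longrightarrow> lifts (\<lambda>g\<in>carrier G. of_nat m * x g) (of_nat m * f)"
proof (induction m)
  case 0
  show ?case by (rule lifts_restrict[OF lifts_zero]) simp_all
next
  case (Suc m)
  from lifts_add[OF Suc.prems Suc.IH[OF Suc.prems]] show ?case by (rule lifts_restrict)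
      (simp_all add: distrib_right)
qed

lemma vmon_box_K: "\<exists>b\<in>box. \<sigma> a = \<sigma> b \<and> vmon a - vmon b \<in> K"
proof -
  define b where "b = (\<lambda>k\<in>{..<n}. a k mod q k)"
  have "b \<in> box" using q_pos by (auto simp: b_def box_def)
  moreover have "vmon b = vmon (\<lambda>k. a k mod q k)" by (simp add: vmon_def b_def)
  moreover have "\<sigma> b = \<sigma> (\<lambda>k. a k mod q k)" by (simp add: \<sigma>_def b_def cong: restrict_cong)
  ultimately show ?thesis
    using vmon_mod_K[OF _ prime_P refl, of e a] \<sigma>_mod[of a] by (intro bexI[of _ b]) auto
qed

text \<open>Collects the terms by reducing all exponents to the box. The point is that the same
  integers N serve the function exactly and the polynomial modulo K.\<close>

lemma lifts_normal_form:
  "lifts x f \<Longrightarrow> \<exists>N :: (nat \<Rightarrow> nat) \<Rightarrow> int. (\<forall>g\<in>carrier G. x g = (\<Sum>a\<in>box. of_int (N a) * \<sigma> a g)) \<and>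
     f - (\<Sum>a\<in>box. of_int (N a) * vmon a) \<in> K"
proof (induction rule: lifts.induct)
  case lifts_zero
  show ?case by (rule exI[of _ "\<lambda>_. 0"]) (simp add: K_zero)
next
  case (lifts_step_add x f a)
  then obtain N where N: "\<forall>g\<in>carrier G. x g = (\<Sum>a\<in>box. of_int (N a) * \<sigma> a g)"
    "f - (\<Sum>a\<in>box. of_int (N a) * vmon a) \<in> K" by blast
  obtain b where b: "b \<in> box" "\<sigma> a = \<sigma> b" "vmon a - vmon b \<in> K" using vmon_box_K by blast
  \<comment> \<open>Proved over an arbitrary ring because it is applied both to complex values and
    to polynomials.\<close>
  have s: "(\<Sum>c\<in>box. of_int ((N(b := N b + 1)) c) * h c) = (\<Sum>c\<in>box. of_int (N c) * h c) + h b"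
    for h :: "(nat \<Rightarrow> nat) \<Rightarrow> 'r::ring_1"
    using finite_box b(1) by (simp add: sum.remove[of box b] distrib_right)
  have "f + vmon a - (\<Sum>c\<in>box. of_int ((N(b := N b + 1)) c) * vmon c) =
      (f - (\<Sum>a\<in>box. of_int (N a) * vmon a)) + (vmon a - vmon b)"
    unfolding s by (simp add: algebra_simps)
  then show ?case using N b s[of "\<lambda>c. \<sigma> c _"] K_add by (intro exI[of _ "N(b := N b + 1)"])
      (simp only:, simp)
next
  case (lifts_step_diff x f a)
  then obtain N where N: "\<forall>g\<in>carrier G. x g = (\<Sum>a\<in>box. of_int (N a) * \<sigma> a g)"
    "f - (\<Sum>a\<in>box. of_int (N a) * vmon a) \<in> K" by blast
  obtain b where b: "b \<in> box" "\<sigma> a = \<sigma> b" "vmon a - vmon b \<in> K" using vmon_box_K by blast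
  have s: "(\<Sum>c\<in>box. of_int ((N(b := N b - 1)) c) * h c) = (\<Sum>c\<in>box. of_int (N c) * h c) - h b"
    for h :: "(nat \<Rightarrow> nat) \<Rightarrow> 'r::ring_1"
    using finite_box b(1) by (simp add: sum.remove[of box b] left_diff_distrib)
  have "f - vmon a - (\<Sum>c\<in>box. of_int ((N(b := N b - 1)) c) * vmon c) =
      (f - (\<Sum>a\<in>box. of_int (N a) * vmon a)) - (vmon a - vmon b)"
    unfolding s by (simp add: algebra_simps)
  then show ?case using N b s[of "\<lambda>c. \<sigma> c _"] K_diff by (intro exI[of _ "N(b := N b - 1)"])
      (simp only:, simp)
qed

text \<open>This is the well-definedness of the substitution modulo K. Linear independence of the
  characters forces all multiplicities in the normal form to vanish, and what remains of f is its
  error term.\<close>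

lemma lifts_zero_K:
  assumes "lifts x f" "\<And>g. g \<in> carrier G \<Longrightarrow> x g = 0"
  shows "f \<in> K"
proof -
  obtain N where N: "\<forall>g\<in>carrier G. x g = (\<Sum>a\<in>box. of_int (N a) * \<sigma> a g)"
    "f - (\<Sum>a\<in>box. of_int (N a) * vmon a) \<in> K" using lifts_normal_form[OF assms(1)] by blast
  \<comment> \<open>Dividing by \<open>\<sigma> b\<close> and summing over the group isolates the
    multiplicity at b.\<close>
  have "N b = 0" if b: "b \<in> box" for b
  proof -
    have "0 = (\<Sum>g\<in>carrier G. x g / \<sigma> b g)" by (simp add: assms(2))
    also have "\<dots> = (\<Sum>g\<in>carrier G. \<Sum>a\<in>box. of_int (N a) * (\<sigma> a g / \<sigma> b g))"
      using N(1) by (simp add: sum_divide_distrib)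
    also have "\<dots> = (\<Sum>a\<in>box. of_int (N a) * (\<Sum>g\<in>carrier G. \<sigma> a g / \<sigma> b g))"
      by (subst sum.swap) (simp add: sum_distrib_left)
    also have "\<dots> = (\<Sum>a\<in>box. if a = b then of_int (N b) * of_nat (card (carrier G)) else 0)"
      by (rule sum.cong) (auto simp: \<sigma>_orthogonal b)
    also have "\<dots> = of_int (N b) * of_nat (card (carrier G))"
      using finite_box b by simp
    finally show ?thesis using card_G_pos by simp
  qed
  then show ?thesis using N(2) by simp
qed

lemma lifts_unique: "lifts x f \<Longrightarrow> lifts x h \<Longrightarrow> f - h \<in> K"
  using lifts_zero_K[OF lifts_diff, of x f x h] by simp

text \<open>The matrix \<open>A a\<close> below is the projection onto the \<open>\<sigma> a\<close>-isotypic part, so its trace is the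
  multiplicity of \<open>\<sigma> a\<close>; this avoids complete reducibility.\<close>

lemma representation_lifts:
  assumes r: "matrix_rep G d r"
  shows "\<exists>f. lifts (character G r) f"
proof -
  define w :: complex where "w = 1 / of_nat (card (carrier G))"
  define A where "A a = mat d d (\<lambda>(i, j). w * (\<Sum>h\<in>carrier G. r h $$ (i, j) / \<sigma> a h))" for a
  have A: "A a \<in> carrier_mat d d" for a by (simp add: A_def)
  have rc: "r h \<in> carrier_mat d d" if "h \<in> carrier G" for h by (rule matrix_rep_carrier[OF r that])
  have "A a * A a = A a" for a
  proof (rule eq_matI)
    fix i j assume "i < dim_row (A a)" "j < dim_col (A a)"
    then have ij: "i < d" "j < d" by (auto simp: A_def)
    have "(A a * A a) $$ (i, j) = (\<Sum>l<d. (w * (\<Sum>h\<in>carrier G. r h $$ (i, l) / \<sigma> a h)) *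
        (w * (\<Sum>h'\<in>carrier G. r h' $$ (l, j) / \<sigma> a h')))"
      using ij by (simp add: A_def scalar_prod_def atLeast0LessThan)
    also have "\<dots> = (\<Sum>l<d. \<Sum>h\<in>carrier G. \<Sum>h'\<in>carrier G. w * w * (r h $$ (i, l) *
        r h' $$ (l, j)) / (\<sigma> a h * \<sigma> a h'))"
      by (simp add: sum_distrib_left sum_distrib_right mult_ac)
    also have "\<dots> = (\<Sum>h\<in>carrier G. \<Sum>l<d. \<Sum>h'\<in>carrier G. w * w * (r h $$ (i, l) *
        r h' $$ (l, j)) / (\<sigma> a h * \<sigma> a h'))"
      by (rule sum.swap)
    also have "\<dots> = (\<Sum>h\<in>carrier G. \<Sum>h'\<in>carrier G. \<Sum>l<d. w * w * (r h $$ (i, l) *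
        r h' $$ (l, j)) / (\<sigma> a h * \<sigma> a h'))"
      by (rule sum.cong[OF refl], rule sum.swap)
    also have "\<dots> = (\<Sum>h\<in>carrier G. \<Sum>h'\<in>carrier G. w * w * (r (h \<otimes>\<^bsub>G\<^esub> h') $$ (i, j) / \<sigma> a (h \<otimes>\<^bsub>G\<^esub> h')))"
    proof (intro sum.cong refl)
      fix h h' assume hh: "h \<in> carrier G" "h' \<in> carrier G"
      have "r (h \<otimes>\<^bsub>G\<^esub> h') $$ (i, j) = (\<Sum>l<d. r h $$ (i, l) * r h' $$ (l, j))"
        using ij rc[OF hh(1)] rc[OF hh(2)]
        by (simp add: matrix_rep_mult[OF r hh] scalar_prod_def atLeast0LessThan)
      then show "(\<Sum>l<d. w * w * (r h $$ (i, l) * r h' $$ (l, j)) / (\<sigma> a h * \<sigma> a h')) =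
          w * w * (r (h \<otimes>\<^bsub>G\<^esub> h') $$ (i, j) / \<sigma> a (h \<otimes>\<^bsub>G\<^esub> h'))"
        by (simp add: \<sigma>_mult[OF hh] sum_distrib_left sum_divide_distrib)
    qed
    \<comment> \<open>Left translation by h makes the summand independent of h. The outer sum then
      contributes the order of the group, which cancels one factor w.\<close>
    also have "\<dots> = (\<Sum>h\<in>carrier G. \<Sum>h'\<in>carrier G. w * w * (r h' $$ (i, j) / \<sigma> a h'))"
    proof (rule sum.cong[OF refl])
      fix h assume h: "h \<in> carrier G"
      show "(\<Sum>h'\<in>carrier G. w * w * (r (h \<otimes>\<^bsub>G\<^esub> h') $$ (i, j) / \<sigma> a (h \<otimes>\<^bsub>G\<^esub> h'))) =
          (\<Sum>h'\<in>carrier G. w * w * (r h' $$ (i, j) / \<sigma> a h'))"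
        by (rule sum.reindex_bij_betw)
          (auto intro!: bij_betw_byWitness[where f' = "\<lambda>x. inv\<^bsub>G\<^esub> h \<otimes>\<^bsub>G\<^esub> x"] simp: h
              G.m_assoc[symmetric])
    qed
    also have "\<dots> = w * (\<Sum>h'\<in>carrier G. r h' $$ (i, j) / \<sigma> a h')"
      using card_G_pos by (simp add: w_def sum_distrib_left)
    also have "\<dots> = A a $$ (i, j)" using ij by (simp add: A_def)
    finally show "(A a * A a) $$ (i, j) = A a $$ (i, j)" .
  qed (auto simp: A_def)
  then have "mat_trace (A a) \<in> \<nat>" for a by (rule mat_trace_idempotent[OF A])
  then have "\<forall>a. \<exists>k. mat_trace (A a) = of_nat k" unfolding Nats_def by blast
  then obtain m where m: "\<And>a. mat_trace (A a) = of_nat (m a)" by metis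
  have trace_A: "mat_trace (A a) = w * (\<Sum>h\<in>carrier G. mat_trace (r h) / \<sigma> a h)" for a
  proof -
    have "mat_trace (A a) = (\<Sum>i<d. w * (\<Sum>h\<in>carrier G. r h $$ (i, i) / \<sigma> a h))"
      by (simp add: mat_trace_def A_def)
    also have "\<dots> = w * (\<Sum>h\<in>carrier G. \<Sum>i<d. r h $$ (i, i) / \<sigma> a h)"
      by (subst sum.swap) (simp add: sum_distrib_left)
    also have "\<dots> = w * (\<Sum>h\<in>carrier G. mat_trace (r h) / \<sigma> a h)"
      using rc by (intro arg_cong[of _ _ "\<lambda>u. w * u"] sum.cong)
          (auto simp: mat_trace_def sum_divide_distrib)
    finally show ?thesis .
  qed
  have "lifts (\<lambda>g\<in>carrier G. \<Sum>a\<in>box. (\<lambda>g\<in>carrier G. of_nat (m a) * \<sigma> a g) g) (\<Sum>a\<in>box. of_nat (m a) *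
      vmon a)"
    by (intro lifts_sum finite_box lifts_of_nat_mult lifts_\<sigma>)
  \<comment> \<open>The character is recovered from the multiplicities by column orthogonality: the
    sum over the box leaves only the term with h = g.\<close>
  moreover have "character G r g = (\<Sum>a\<in>box. of_nat (m a) * \<sigma> a g)" if g: "g \<in> carrier G" for g
  proof -
    have "(\<Sum>a\<in>box. of_nat (m a) * \<sigma> a g) = (\<Sum>a\<in>box. \<Sum>h\<in>carrier G. w * mat_trace (r h) *
        (\<sigma> a (g \<otimes>\<^bsub>G\<^esub> inv\<^bsub>G\<^esub> h)))"
      using g by (simp add: m[symmetric] trace_A sum_distrib_left sum_distrib_right \<sigma>_mult \<sigma>_inv
          divide_inverse mult_ac)
    also have "\<dots> = (\<Sum>h\<in>carrier G. w * mat_trace (r h) * (\<Sum>a\<in>box. \<sigma> a (g \<otimes>\<^bsub>G\<^esub> inv\<^bsub>G\<^esub> h)))"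
      by (subst sum.swap) (simp add: sum_distrib_left)
    also have "\<dots> = (\<Sum>h\<in>carrier G. if h = g then mat_trace (r g) else 0)"
    proof (rule sum.cong[OF refl])
      fix h assume h: "h \<in> carrier G"
      have "g \<otimes>\<^bsub>G\<^esub> inv\<^bsub>G\<^esub> h = \<one>\<^bsub>G\<^esub> \<longleftrightarrow> h = g"
      proof
        assume 1: "g \<otimes>\<^bsub>G\<^esub> inv\<^bsub>G\<^esub> h = \<one>\<^bsub>G\<^esub>"
        have "g = g \<otimes>\<^bsub>G\<^esub> inv\<^bsub>G\<^esub> h \<otimes>\<^bsub>G\<^esub> h" using g h by (simp add: G.m_assoc)
        then show "h = g" using h by (simp add: 1)
      qed (simp add: g)
      then show "w * mat_trace (r h) * (\<Sum>a\<in>box. \<sigma> a (g \<otimes>\<^bsub>G\<^esub> inv\<^bsub>G\<^esub> h)) = (if h =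
          g then mat_trace (r g) else 0)"
        using g h card_G_pos by (simp add: \<sigma>_sum_box w_def)
    qed
    also have "\<dots> = character G r g" using g finite_G by (simp add: character_def)
    finally show ?thesis by simp
  qed
  ultimately have "lifts (character G r) (\<Sum>a\<in>box. of_nat (m a) * vmon a)"
    by (elim lifts_cong) (auto simp: character_def)
  then show ?thesis by blast
qed

lemma \<sigma>_irreducible: "\<sigma> a \<in> irreducible_characters G"
proof -
  have "irreducible_rep G 1 (\<lambda>x. scalar_mat (\<sigma> a x))"
    by (intro irreducible_scalar_rep scalar_mat_rep G.is_group \<sigma>_one \<sigma>_mult)
  then show ?thesis
    using character_scalar_mat[OF \<sigma>_ext, of a] by (auto simp: irreducible_characters_def) metis
qed

lemma function_ring_simps: "x \<oplus>\<^bsub>function_ring G\<^esub> y = (\<lambda>g\<in>carrier G. x g + y g)"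
  "\<zero>\<^bsub>function_ring G\<^esub> = (\<lambda>g\<in>carrier G. 0)"
  by (simp_all only: function_ring_def ring.simps)

lemma lifts_function_ring: "lifts x f \<Longrightarrow> x \<in> carrier (function_ring G)"
  using lifts_ext by (simp add: function_ring_def PiE_def)

text \<open>From here on irreducible characters are replaced by the \<open>\<sigma> a\<close>: every
  irreducible character is a combination of them by \<open>representation_lifts\<close>, and each of
  them is itself irreducible, being one-dimensional.\<close>

lemma carrier_character_ring: "x \<in> carrier (character_ring G) \<longleftrightarrow> (\<exists>f. lifts x f)"
proof
  have irr: "\<exists>f. lifts h f" if "h \<in> irreducible_characters G" for h
    using that representation_lifts unfolding irreducible_characters_def irreducible_rep_def
        by blast
  assume "x \<in> carrier (character_ring G)"
  then have "x \<in> generate (add_monoid (function_ring G)) (irreducible_characters G)"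
    by (simp add: character_ring_def)
  then show "\<exists>f. lifts x f"
  proof (induction rule: generate.induct)
    case one
    have "\<one>\<^bsub>add_monoid (function_ring G)\<^esub> = (\<lambda>g\<in>carrier G. 0)" by
        (simp only: function_ring_simps monoid.simps)
    then show ?case using lifts_zero by metis
  next
    case (incl h)
    then show ?case by (rule irr)
  next
    case (inv h)
    then obtain f where f: "lifts h f" using irr by blast
    have "inv\<^bsub>add_monoid (function_ring G)\<^esub> h = (\<lambda>g\<in>carrier G. - h g)"
      using minus_function_ring[OF lifts_function_ring[OF f]] unfolding a_inv_def .
    then show ?case using lifts_minus[OF f] by metis
  next
    case (eng h1 h2)
    have "h1 \<otimes>\<^bsub>add_monoid (function_ring G)\<^esub> h2 = (\<lambda>g\<in>carrier G. h1 g + h2 g)"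
      by (simp only: function_ring_simps monoid.simps)
    then show ?case using eng.IH lifts_add by metis
  qed
next
  let ?A = "add_monoid (function_ring G)"
  let ?X = "generate ?A (irreducible_characters G)"
  assume "\<exists>f. lifts x f"
  then obtain f where "lifts x f" by blast
  then have "x \<in> ?X"
  proof (induction rule: lifts.induct)
    case lifts_zero
    have "\<one>\<^bsub>?A\<^esub> = (\<lambda>g\<in>carrier G. 0)" by (simp only: function_ring_simps monoid.simps)
    then show ?case using generate.one[of ?A] by metis
  next
    case (lifts_step_add x f a)
    have "x \<otimes>\<^bsub>?A\<^esub> \<sigma> a = (\<lambda>g\<in>carrier G. x g + \<sigma> a g)" by (simp only: function_ring_simps monoid.simps)
    then show ?case
      using generate.eng[OF lifts_step_add.IH generate.incl[OF \<sigma>_irreducible[of a], of ?A]] by metis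
  next
    case (lifts_step_diff x f a)
    have "inv\<^bsub>?A\<^esub> \<sigma> a = (\<lambda>g\<in>carrier G. - \<sigma> a g)"
      using minus_function_ring[OF lifts_function_ring[OF lifts_\<sigma>]] unfolding a_inv_def .
    then have "x \<otimes>\<^bsub>?A\<^esub> inv\<^bsub>?A\<^esub> \<sigma> a = (\<lambda>g\<in>carrier G. x g + (\<lambda>g\<in>carrier G. - \<sigma> a g) g)"
      by (simp only: function_ring_simps monoid.simps)
    also have "\<dots> = (\<lambda>g\<in>carrier G. x g - \<sigma> a g)" by (rule restrict_ext) simp
    finally show ?case
      using generate.eng[OF lifts_step_diff.IH generate.inv[OF \<sigma>_irreducible[of a], of ?A]] by metis
  qed
  then show "x \<in> carrier (character_ring G)" by (simp add: character_ring_def)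
qed

abbreviation "CR \<equiv> character_ring G"

lemma CR_simps: "x \<oplus>\<^bsub>CR\<^esub> y = (\<lambda>g\<in>carrier G. x g + y g)" "x \<otimes>\<^bsub>CR\<^esub> y = (\<lambda>g\<in>carrier G. x g * y g)"
  "\<one>\<^bsub>CR\<^esub> = (\<lambda>g\<in>carrier G. 1)" "\<zero>\<^bsub>CR\<^esub> = (\<lambda>g\<in>carrier G. 0)"
  by (simp_all add: character_ring_def function_ring_def)

lemma CR_ext: "x \<in> carrier CR \<Longrightarrow> x \<in> extensional (carrier G)"
  using carrier_character_ring lifts_ext by blast

lemma cring_CR: "cring CR"
proof -
  interpret FR: cring "function_ring G" by (rule cring_function_ring)
  have FR: "x \<in> carrier (function_ring G)" if "x \<in> carrier CR" for x
    using CR_ext[OF that] by (simp add: function_ring_def PiE_def)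
  have ops: "(\<oplus>\<^bsub>CR\<^esub>) = (\<oplus>\<^bsub>function_ring G\<^esub>)" "(\<otimes>\<^bsub>CR\<^esub>) = (\<otimes>\<^bsub>function_ring G\<^esub>)"
    "\<zero>\<^bsub>CR\<^esub> = \<zero>\<^bsub>function_ring G\<^esub>" "\<one>\<^bsub>CR\<^esub> = \<one>\<^bsub>function_ring G\<^esub>"
    by (simp_all add: character_ring_def)
  have closed: "x \<oplus>\<^bsub>CR\<^esub> y \<in> carrier CR" "x \<otimes>\<^bsub>CR\<^esub> y \<in> carrier CR"
    if "x \<in> carrier CR" "y \<in> carrier CR" for x y
    using that lifts_add lifts_mult unfolding carrier_character_ring CR_simps by blast+
  have constants: "\<zero>\<^bsub>CR\<^esub> \<in> carrier CR" "\<one>\<^bsub>CR\<^esub> \<in> carrier CR"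
    unfolding carrier_character_ring CR_simps using lifts_zero lifts_one by blast+
  show ?thesis
  proof (intro cringI abelian_groupI comm_monoidI)
    fix x assume x: "x \<in> carrier CR"
    then have "(\<lambda>g\<in>carrier G. - x g) \<in> carrier CR"
      using lifts_minus unfolding carrier_character_ring by blast
    then show "\<exists>y\<in>carrier CR. y \<oplus>\<^bsub>CR\<^esub> x = \<zero>\<^bsub>CR\<^esub>"
      by (intro bexI) (auto simp: CR_simps)
  qed (use closed constants FR in \<open>auto simp: ops FR.a_ac FR.m_ac FR.l_distr FR.r_distr\<close>)
qed

sublocale CR: cring CR by (rule cring_CR)

lemma CR_minus: "x \<in> carrier CR \<Longrightarrow> \<ominus>\<^bsub>CR\<^esub> x = (\<lambda>g\<in>carrier G. - x g)"
proof -
  assume x: "x \<in> carrier CR"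
  then have "(\<lambda>g\<in>carrier G. - x g) \<in> carrier CR"
    using lifts_minus unfolding carrier_character_ring by blast
  then show ?thesis using x by (intro CR.minus_equality) (auto simp: CR_simps)
qed

lemma CR_finsum:
  assumes "finite A" "\<And>i. i \<in> A \<Longrightarrow> x i \<in> carrier CR" "g \<in> carrier G"
  shows "(\<Oplus>\<^bsub>CR\<^esub>i\<in>A. x i) g = (\<Sum>i\<in>A. x i g)"
  using assms(1,2)
proof (induction A rule: finite_induct)
  case empty
  then show ?case using assms(3) by (simp add: CR_simps)
next
  case (insert i A)
  then show ?case using assms(3) by (subst CR.finsum_insert) (auto simp: CR_simps)
qed

lemma CR_add_pow:
  assumes "g \<in> carrier G"
  shows "add_pow CR (k::int) \<one>\<^bsub>CR\<^esub> g = of_int k"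
proof -
  have nat: "add_pow CR (j::nat) \<one>\<^bsub>CR\<^esub> g = of_nat j" for j
    using assms by (induction j) (simp_all add: CR.add.nat_pow_Suc CR_simps)
  show ?thesis
  proof (cases "0 \<le> k")
    case True
    then show ?thesis using nat[of "nat k"] int_pow_int[of "add_monoid CR" "\<one>\<^bsub>CR\<^esub>" "nat k"] by
        (simp add: add_pow_def)
  next
    case False
    then have "k = - int (nat (- k))" by simp
    then have "add_pow CR k \<one>\<^bsub>CR\<^esub> = \<ominus>\<^bsub>CR\<^esub> add_pow CR (nat (- k)) \<one>\<^bsub>CR\<^esub>"
      using group.int_pow_neg_int[OF CR.add.is_group, of "\<one>\<^bsub>CR\<^esub>" "nat (- k)"]
      by (simp add: add_pow_def a_inv_def)
    then show ?thesis using nat[of "nat (- k)"] assms False by (simp add: CR_minus)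
  qed
qed

end

section \<open>The \<open>\<lambda>\<close>-operations\<close>

definition fexp :: "complex fps \<Rightarrow> complex fps" where
  "fexp S = fps_exp 1 oo fps_integral0 S"

lemma fexp_nth_0: "fps_nth (fexp S) 0 = 1" by (simp add: fexp_def)

lemma fexp_deriv: "fps_deriv (fexp S) = fexp S * S"
  unfolding fexp_def by (subst fps_compose_deriv) (simp_all add: fps_deriv_fps_integral)

text \<open>Comparing coefficients gives the recursion of Newton's identities, (k+1) F_(k+1) =
  \<Sum> F_i S_(k-i), which can be solved in characteristic zero.\<close>

lemma fexp_unique:
  assumes "fps_nth F 0 = 1" "fps_deriv F = F * S"
  shows "F = fexp S"
proof (rule fps_ext)
  fix m
  show "fps_nth F m = fps_nth (fexp S) m"
  proof (induction m rule: less_induct)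
    case (less m)
    show ?case
    proof (cases m)
      case 0
      then show ?thesis using assms(1) by (simp add: fexp_nth_0)
    next
      case (Suc k)
      have eq: "of_nat (Suc k) * fps_nth H (Suc k) = (\<Sum>i=0..k. fps_nth H i * fps_nth S (k - i))"
        if "fps_deriv H = H * S" for H
        using that[THEN arg_cong, of "\<lambda>f. fps_nth f k"] by (simp add: fps_mult_nth)
      have "of_nat (Suc k) * fps_nth F (Suc k) = of_nat (Suc k) * fps_nth (fexp S) (Suc k)"
        unfolding eq[OF assms(2)] eq[OF fexp_deriv] using less Suc by (intro sum.cong) auto
      then show ?thesis unfolding Suc by (simp only: mult_cancel_left of_nat_eq_0_iff) simp
    qed
  qed
qed

lemma fexp_add: "fexp (S + T) = fexp S * fexp T"
  by (rule fexp_unique[symmetric]) (simp_all add: fexp_nth_0 fexp_deriv algebra_simps)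

lemma fexp_zero: "fexp 0 = 1"
  by (rule fexp_unique[symmetric]) simp_all

lemma fexp_sum: "finite A \<Longrightarrow> fexp (\<Sum>i\<in>A. S i) = (\<Prod>i\<in>A. fexp (S i))"
  by (induction A rule: finite_induct) (simp_all add: fexp_zero fexp_add)

text \<open>The argument is the expansion of a / (1 + aX), the logarithmic derivative of the
  right-hand side.\<close>

lemma fexp_geometric: "fexp (Abs_fps (\<lambda>k. (-1) ^ k * a ^ Suc k)) = 1 + fps_const a * fps_X"
proof (rule fexp_unique[symmetric])
  show "fps_deriv (1 + fps_const a * fps_X) =
      (1 + fps_const a * fps_X) * Abs_fps (\<lambda>k. (-1) ^ k * a ^ Suc k)"
  proof (rule fps_ext)
    fix m
    show "fps_nth (fps_deriv (1 + fps_const a * fps_X)) m =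
      fps_nth ((1 + fps_const a * fps_X) * Abs_fps (\<lambda>k. (-1) ^ k * a ^ Suc k)) m"
      by (cases m) (simp_all add: distrib_right mult.assoc)
  qed
qed simp

text \<open>The hypothesis equates two functions of t. Over an infinite field this is an equality of
  polynomials, hence of coefficients.\<close>

lemma prod_linear_fps_nth:
  fixes a c :: "nat \<Rightarrow> complex"
  assumes "\<And>t. (\<Prod>i<d. 1 + t * a i) = (\<Sum>k\<le>d. c k * t ^ k)"
  shows "fps_nth (\<Prod>i<d. 1 + fps_const (a i) * fps_X) k = (if k \<le> d then c k else 0)"
proof -
  have "(\<Prod>i<d. [:1, a i:]) = (\<Sum>k\<le>d. monom (c k) k)"
    by (rule poly_eq_poly_eq_iff[THEN iffD1])
        (simp add: fun_eq_iff poly_prod poly_sum poly_monom assms)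
  then have "fps_of_poly (\<Prod>i<d. [:1, a i:]) = fps_of_poly (\<Sum>k\<le>d. monom (c k) k)" by simp
  moreover have "fps_of_poly (\<Prod>i<d. [:1, a i:]) = (\<Prod>i<d. 1 + fps_const (a i) * fps_X)"
    by (simp add: fps_of_poly_prod fps_of_poly_pCons fps_of_poly_const)
  ultimately show ?thesis by (simp add: coeff_sum)
qed

lemma one_plus_X_power_nth: "m < k \<Longrightarrow> fps_nth ((1 + fps_X) ^ m :: complex fps) k = 0"
proof (induction m arbitrary: k)
  case (Suc m)
  then obtain k' where k: "k = Suc k'" "m < k'" by (cases k) auto
  have "(1 + fps_X) ^ Suc m = (1 + fps_X) ^ m + fps_X * ((1 + fps_X) ^ m :: complex fps)"
    by (simp add: algebra_simps)
  then have "fps_nth ((1 + fps_X) ^ Suc m :: complex fps) k =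
      fps_nth ((1 + fps_X) ^ m) k + fps_nth (fps_X * (1 + fps_X) ^ m) k" by (simp only: fps_add_nth)
  then show ?case using Suc.IH[of k] Suc.IH[of k'] k by (simp del: power_Suc)
qed simp

text \<open>The substitution \<open>t \<mapsto> t / (1 + t)\<close> turns the generating series of the \<open>\<gamma>\<^sup>i\<close> into that of
  the \<open>\<lambda>\<^sup>i\<close>.\<close>

definition gshift :: "complex fps" where "gshift = fps_X * inverse (1 + fps_X)"

lemma inverse_one_plus_X: "inverse (1 + fps_X) * (1 + fps_X) = (1 :: complex fps)"
  by (rule inverse_mult_eq_1) simp

lemma gshift_mult: "gshift * (1 + fps_X) = fps_X"
  using inverse_one_plus_X by (simp add: gshift_def mult.assoc)

lemma gshift_0: "fps_nth gshift 0 = 0" by (simp add: gshift_def)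

text \<open>The power of F with index j contributes t^j (1+t)^(i-1-j). For j < i this is a
  polynomial of degree i - 1, for j > i it starts too late, and for j = i it is t^i / (1+t) with
  coefficient 1. The factor (1+t)^(i-1) is the one from \<gamma>^i(x) = \<lambda>^i(x + i -
  1).\<close>

lemma compose_gshift_nth:
  assumes "0 < i"
  shows "fps_nth ((F oo gshift) * (1 + fps_X) ^ (i - 1)) i = fps_nth F i"
proof -
  let ?B = "(1 + fps_X) ^ (i - 1) :: complex fps"
  have "fps_nth ((F oo gshift) * ?B) i = (\<Sum>k=0..i. (\<Sum>j=0..k. fps_nth F j * fps_nth (gshift ^ j) k) *
      fps_nth ?B (i - k))"
    by (simp add: fps_mult_nth fps_compose_nth)
  \<comment> \<open>The inner sums get a common range so that they can be exchanged with the outer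
    one; the added terms vanish, since the j-th power of \<open>gshift\<close> has order at least
    j.\<close>
  also have "\<dots> = (\<Sum>k=0..i. (\<Sum>j=0..i. fps_nth F j * fps_nth (gshift ^ j) k) * fps_nth ?B (i - k))"
  proof (rule sum.cong[OF refl])
    fix k assume k: "k \<in> {0..i}"
    have "(\<Sum>j=0..k. fps_nth F j * fps_nth (gshift ^ j) k) =
        (\<Sum>j=0..i. fps_nth F j * fps_nth (gshift ^ j) k)"
      by (rule sum.mono_neutral_left) (use k startsby_zero_power_prefix[OF gshift_0] in auto)
    then show "(\<Sum>j=0..k. fps_nth F j * fps_nth (gshift ^ j) k) * fps_nth ?B (i - k) =
      (\<Sum>j=0..i. fps_nth F j * fps_nth (gshift ^ j) k) * fps_nth ?B (i - k)" by simp
  qed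
  also have "\<dots> = (\<Sum>j=0..i. fps_nth F j * fps_nth (gshift ^ j * ?B) i)"
    by (simp only: fps_mult_nth sum_distrib_left sum_distrib_right) (subst sum.swap, simp add:
        mult.assoc)
  also have "\<dots> = (\<Sum>j=0..i. if j = i then fps_nth F i else 0)"
  proof (rule sum.cong[OF refl])
    fix j assume j: "j \<in> {0..i}"
    show "fps_nth F j * fps_nth (gshift ^ j * ?B) i = (if j = i then fps_nth F i else 0)"
    proof (cases "j = i")
      case True
      have "gshift ^ i * ?B = gshift * (gshift * (1 + fps_X)) ^ (i - 1)"
        using assms by (cases i) (simp_all add: power_mult_distrib)
      also have "\<dots> = fps_X ^ i * inverse (1 + fps_X)"
        using assms unfolding gshift_mult by (cases i) (simp_all add: gshift_def mult_ac)
      finally show ?thesis using True by (simp add: fps_X_power_mult_nth)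
    next
      case False
      then have "j \<le> i - 1" using j by simp
      then have "?B = (1 + fps_X) ^ (j + (i - 1 - j))" by (simp only: le_add_diff_inverse)
      also have "\<dots> = (1 + fps_X) ^ j * (1 + fps_X) ^ (i - 1 - j)" by (rule power_add)
      finally have "?B = (1 + fps_X) ^ j * (1 + fps_X) ^ (i - 1 - j)" .
      then have "gshift ^ j * ?B = (gshift * (1 + fps_X)) ^ j * (1 + fps_X) ^ (i - 1 - j)"
        by (simp add: power_mult_distrib mult.assoc)
      also have "fps_nth \<dots> i = fps_nth ((1 + fps_X) ^ (i - 1 - j) :: complex fps) (i - j)"
        unfolding gshift_mult using \<open>j \<le> i - 1\<close> by (simp add: fps_X_power_mult_nth)
      also have "\<dots> = 0" using False j assms by (intro one_plus_X_power_nth) auto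
      finally show ?thesis using False by simp
    qed
  qed
  finally show ?thesis by simp
qed

context cyclic_product
begin

text \<open>The generating series of the \<open>\<lambda>\<^sup>i x\<close> at \<open>g\<close>: by Newton's identities, its logarithmic
  derivative has the coefficients \<open>(-1)\<^sup>k x(g\<^sup>k\<^sup>+\<^sup>1)\<close>, which are additive in \<open>x\<close>.\<close>

definition lambda_series :: "((nat \<Rightarrow> 'a) \<Rightarrow> complex) \<Rightarrow> (nat \<Rightarrow> 'a) \<Rightarrow> complex fps" where
  "lambda_series x g = fexp (Abs_fps (\<lambda>k. (-1) ^ k * x (g [^]\<^bsub>G\<^esub> Suc k)))"

lemma lambda_series_cong: "(\<And>g. g \<in> carrier G \<Longrightarrow> x g = y g) \<Longrightarrow> g \<in> carrier G \<Longrightarrow> lambda_series x g =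
    lambda_series y g"
  by (simp add: lambda_series_def del: G.nat_pow_Suc)

lemma lambda_series_add: "lambda_series (\<lambda>g. x g + y g) g = lambda_series x g * lambda_series y g"
proof -
  have "Abs_fps (\<lambda>k. (-1) ^ k * (x (g [^]\<^bsub>G\<^esub> Suc k) + y (g [^]\<^bsub>G\<^esub> Suc k))) =
    Abs_fps (\<lambda>k. (-1) ^ k * x (g [^]\<^bsub>G\<^esub> Suc k)) + Abs_fps (\<lambda>k. (-1) ^ k * y (g [^]\<^bsub>G\<^esub> Suc k))"
    by (simp add: fps_eq_iff distrib_left del: G.nat_pow_Suc)
  then show ?thesis unfolding lambda_series_def by (simp only: fexp_add)
qed

lemma lambda_series_zero: "lambda_series (\<lambda>g. 0) g = 1"
proof -
  have "Abs_fps (\<lambda>k. (-1) ^ k * 0) = (0 :: complex fps)" by (simp add: fps_eq_iff)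
  then show ?thesis unfolding lambda_series_def by (simp only: fexp_zero)
qed

lemma lambda_series_nth_0: "fps_nth (lambda_series x g) 0 = 1"
  by (simp add: lambda_series_def fexp_nth_0)

lemma lambda_series_nth_1: "g \<in> carrier G \<Longrightarrow> fps_nth (lambda_series x g) 1 = x g"
  using arg_cong[OF fexp_deriv, of "\<lambda>f. fps_nth f 0" "Abs_fps (\<lambda>k. (-1) ^ k * x (g [^]\<^bsub>G\<^esub> Suc k))"]
  by (simp add: lambda_series_def fexp_nth_0)

lemma lambda_series_\<sigma>:
  assumes "g \<in> carrier G"
  shows "lambda_series (\<sigma> a) g = 1 + fps_const (\<sigma> a g) * fps_X"
  unfolding lambda_series_def by (simp only: \<sigma>_pow[OF assms] fexp_geometric)

lemma lambda_series_one: "lambda_series (\<lambda>g. 1) g = 1 + fps_X"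
proof -
  have "Abs_fps (\<lambda>k. (-1) ^ k * 1) = Abs_fps (\<lambda>k. (-1) ^ k * (1::complex) ^ Suc k)" by simp
  then show ?thesis unfolding lambda_series_def by (simp only: fexp_geometric) simp
qed

lemma lambda_series_of_nat: "lambda_series (\<lambda>g. of_nat m) g = (1 + fps_X) ^ m"
proof (induction m)
  case (Suc m)
  have "lambda_series (\<lambda>g. of_nat (Suc m)) g = lambda_series (\<lambda>g. 1 + of_nat m) g" by
      (simp add: add.commute)
  also have "\<dots> = lambda_series (\<lambda>g. 1) g * lambda_series (\<lambda>g. of_nat m) g"
      by (rule lambda_series_add)
  finally show ?case by (simp add: lambda_series_one Suc)
qed (simp add: lambda_series_zero)

text \<open>The values of the character at the powers of g are the power sums of the eigenvalues of
  r(g). The series is therefore the product of the factors 1 + aX, whose coefficients are the traces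
  of the exterior powers.\<close>

lemma lambda_series_character:
  assumes r: "matrix_rep G d r" and g: "g \<in> carrier G"
  shows "fps_nth (lambda_series (character G r) g) k = mat_trace (exterior_power_mat k (r g))"
proof -
  have rc: "r g \<in> carrier_mat d d" by (rule matrix_rep_carrier[OF r g])
  obtain a where a: "\<And>t. (\<Prod>i<d. 1 + t * a i) =
      (\<Sum>k\<le>d. mat_trace (exterior_power_mat k (r g)) * t ^ k)"
    "\<And>k. mat_trace (r g ^\<^sub>m k) = (\<Sum>i<d. a i ^ k)"
    using eigenvalue_sums[OF rc] by blast
  have "character G r (g [^]\<^bsub>G\<^esub> Suc k) = (\<Sum>i<d. a i ^ Suc k)" for k
    using g by (simp only: character_def restrict_apply' G.nat_pow_closed matrix_rep_pow[OF
        G.is_group r g] a(2))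
  then have "Abs_fps (\<lambda>k. (-1) ^ k * character G r (g [^]\<^bsub>G\<^esub> Suc k)) =
      (\<Sum>i<d. Abs_fps (\<lambda>k. (-1) ^ k * a i ^ Suc k))"
    by (simp only: fps_eq_iff fps_sum_nth fps_nth_Abs_fps sum_distrib_left) simp
  then have "lambda_series (character G r) g = (\<Prod>i<d. 1 + fps_const (a i) * fps_X)"
    unfolding lambda_series_def by (simp only: fexp_sum finite_lessThan fexp_geometric)
  then show ?thesis
    using prod_linear_fps_nth[OF a(1), of k] det_one_plus_smult_exterior(2)[OF rc, of k] by auto
qed

lemma lifts_pow: "lifts x f \<Longrightarrow> lifts (\<lambda>g\<in>carrier G. x g ^ m) (f ^ m)"
proof (induction m)
  case 0
  show ?case by (rule lifts_restrict[OF lifts_one]) simp_all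
next
  case (Suc m)
  from lifts_mult[OF Suc.IH[OF Suc.prems] Suc.prems] show ?case by (rule lifts_restrict)
      (simp_all add: mult.commute)
qed

lemma lifts_cauchy:
  assumes c: "\<And>i. lifts (c i) (f i)" and d: "\<And>i. lifts (d i) (h i)"
  shows "lifts (\<lambda>g\<in>carrier G. \<Sum>i=0..(m::nat). c i g * d (m - i) g) (\<Sum>i=0..m. f i * h (m - i))"
proof -
  have "lifts (\<lambda>g\<in>carrier G. \<Sum>i\<in>{0..m}. (\<lambda>g\<in>carrier G. c i g * d (m - i) g) g) (\<Sum>i\<in>{0..m}. f i *
      h (m - i))"
    by (intro lifts_sum lifts_mult c d finite_atLeastAtMost)
  then show ?thesis by (rule lifts_restrict) simp_all
qed

lemma lambda_series_diff_\<sigma>: "g \<in> carrier G \<Longrightarrow>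
  lambda_series (\<lambda>g\<in>carrier G. x g - \<sigma> a g) g * (1 + fps_const (\<sigma> a g) * fps_X) = lambda_series x g"
proof -
  assume g: "g \<in> carrier G"
  have "lambda_series (\<lambda>g\<in>carrier G. x g - \<sigma> a g) g * lambda_series (\<sigma> a) g =
      lambda_series (\<lambda>h. (\<lambda>g\<in>carrier G. x g - \<sigma> a g) h + \<sigma> a h) g"
    by (rule lambda_series_add[symmetric])
  also have "\<dots> = lambda_series x g" by (rule lambda_series_cong) (use g in simp_all)
  finally show ?thesis by (simp add: lambda_series_\<sigma> g)
qed

lemma lambda_series_add_\<sigma>: "g \<in> carrier G \<Longrightarrow>
  lambda_series (\<lambda>g\<in>carrier G. x g + \<sigma> a g) g = lambda_series x g * (1 + fps_const (\<sigma> a g) * fps_X)"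
  using lambda_series_cong[of "\<lambda>g\<in>carrier G. x g + \<sigma> a g" "\<lambda>g. x g + \<sigma> a g" g] by
      (simp add: lambda_series_add lambda_series_\<sigma>)

lemma one_plus_const_X_inverse:
  "(1 + fps_const a * fps_X) * Abs_fps (\<lambda>k. (- a) ^ k) = (1 :: complex fps)"
proof (rule fps_ext)
  fix m
  show "fps_nth ((1 + fps_const a * fps_X) * Abs_fps (\<lambda>k. (- a) ^ k)) m = fps_nth 1 m"
    by (cases m) (simp_all add: distrib_right mult.assoc)
qed

text \<open>Integrality of the coefficients is invisible in the exponential, which involves
  denominators, so it is obtained along a derivation of \<open>lifts\<close>: adding
  \<open>\<sigma> a\<close> multiplies the series by 1 + \<open>\<sigma> a\<close> t, and
  subtracting it multiplies by the inverse geometric series. Both factors have virtual characters as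
  coefficients.\<close>

lemma lambda_series_lifts:
  "lifts x f \<Longrightarrow> \<exists>c h. (\<forall>i. lifts (c i) (h i)) \<and> (\<forall>g\<in>carrier G. lambda_series x g =
      Abs_fps (\<lambda>i. c i g))"
proof (induction rule: lifts.induct)
  case lifts_zero
  define c where "c i = (if i = (0::nat) then (\<lambda>g\<in>carrier G. 1) else (\<lambda>g\<in>carrier G. 0 :: complex))"
      for i
  have "lifts (c i) (if i = 0 then 1 else 0)" for i
    by (cases "i = 0") (simp_all only: c_def simp_thms if_True if_False lifts_one lifts.lifts_zero)
  moreover have "lambda_series (\<lambda>g\<in>carrier G. 0) g = Abs_fps (\<lambda>i. c i g)" if g: "g \<in> carrier G"
      for g
  proof -
    have "lambda_series (\<lambda>g\<in>carrier G. 0) g = lambda_series (\<lambda>g. 0) g" by (rule lambda_series_cong)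
        (use g in simp_all)
    then show ?thesis unfolding lambda_series_zero by
        (simp only:) (rule fps_ext, use g in \<open>simp add: c_def\<close>)
  qed
  ultimately show ?case
    by (intro exI[of _ c] exI[of _ "\<lambda>i. if i = 0 then 1 else 0"] conjI allI ballI)
next
  case (lifts_step_add x f a)
  then obtain c h where c: "\<And>i. lifts (c i) (h i)" "\<And>g. g \<in> carrier G \<Longrightarrow> lambda_series x g =
      Abs_fps (\<lambda>i. c i g)" by blast
  define d where "d i = (if i = (0::nat) then (\<lambda>g\<in>carrier G. 1) else if i =
      1 then \<sigma> a else (\<lambda>g\<in>carrier G. 0))" for i
  have d: "lifts (d i) (if i = 0 then 1 else if i = 1 then vmon a else 0)" for i
    by (cases "i = 0"; cases "i = 1")
      (simp_all only: d_def simp_thms if_True if_False lifts_one lifts.lifts_zero lifts_\<sigma>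
          one_neq_zero)
  have "lambda_series (\<lambda>g\<in>carrier G. x g + \<sigma> a g) g =
      Abs_fps (\<lambda>m. (\<lambda>g\<in>carrier G. \<Sum>i=0..m. c i g * d (m - i) g) g)"
    if g: "g \<in> carrier G" for g
  proof -
    have e: "1 + fps_const (\<sigma> a g) * fps_X = Abs_fps (\<lambda>i. d i g)"
      by (rule fps_ext) (use g in \<open>simp add: d_def\<close>)
    show ?thesis
      unfolding lambda_series_add_\<sigma>[OF g] c(2)[OF g] e by (rule fps_ext)
          (use g in \<open>simp add: fps_mult_nth\<close>)
  qed
  then show ?case
    by (intro exI[of _ "\<lambda>m. \<lambda>g\<in>carrier G. \<Sum>i=0..m. c i g * d (m -
        i) g"] exI[of _ "\<lambda>m. \<Sum>i=0..m. h i * (if m - i = 0 then 1 else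
        if m - i = 1 then vmon a else 0)"] conjI allI ballI
        lifts_cauchy[OF c(1) d])
next
  case (lifts_step_diff x f a)
  then obtain c h where c: "\<And>i. lifts (c i) (h i)" "\<And>g. g \<in> carrier G \<Longrightarrow> lambda_series x g =
      Abs_fps (\<lambda>i. c i g)" by blast
  define d where "d i = (\<lambda>g\<in>carrier G. (\<lambda>g\<in>carrier G. - \<sigma> a g) g ^ i)" for i :: nat
  have d: "lifts (d i) ((- vmon a) ^ i)" for i
    unfolding d_def by (intro lifts_pow lifts_minus lifts_\<sigma>)
  have "lambda_series (\<lambda>g\<in>carrier G. x g - \<sigma> a g) g =
      Abs_fps (\<lambda>m. (\<lambda>g\<in>carrier G. \<Sum>i=0..m. c i g * d (m - i) g) g)"
    if g: "g \<in> carrier G" for g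
  proof -
    have "lambda_series (\<lambda>g\<in>carrier G. x g - \<sigma> a g) g =
        lambda_series x g * Abs_fps (\<lambda>k. (- \<sigma> a g) ^ k)"
      unfolding lambda_series_diff_\<sigma>[OF g, of x a, symmetric] mult.assoc one_plus_const_X_inverse
          by simp
    moreover have "Abs_fps (\<lambda>k. (- \<sigma> a g) ^ k) = Abs_fps (\<lambda>i. d i g)"
      by (rule fps_ext) (use g in \<open>simp add: d_def\<close>)
    ultimately have "lambda_series (\<lambda>g\<in>carrier G. x g - \<sigma> a g) g =
        Abs_fps (\<lambda>i. c i g) * Abs_fps (\<lambda>i. d i g)"
      by (simp only: c(2)[OF g])
    then show ?thesis by (simp only:) (rule fps_ext, use g in \<open>simp add: fps_mult_nth\<close>)
  qed
  then show ?case
    by (intro exI[of _ "\<lambda>m. \<lambda>g\<in>carrier G. \<Sum>i=0..m. c i g * d (m -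
        i) g"] exI[of _ "\<lambda>m. \<Sum>i=0..m. h i * (- vmon a) ^ (m - i)"] conjI allI ballI
        lifts_cauchy[OF c(1) d])
qed

definition lambda_fun :: "nat \<Rightarrow> ((nat \<Rightarrow> 'a) \<Rightarrow> complex) \<Rightarrow> (nat \<Rightarrow> 'a) \<Rightarrow> complex" where
  "lambda_fun m = (\<lambda>x\<in>carrier CR. \<lambda>g\<in>carrier G. fps_nth (lambda_series x g) m)"

lemma lambda_fun_apply: "x \<in> carrier CR \<Longrightarrow> g \<in> carrier G \<Longrightarrow> lambda_fun m x g =
    fps_nth (lambda_series x g) m"
  by (simp add: lambda_fun_def)

lemma lambda_fun_closed: 
  assumes x: "x \<in> carrier CR"
  shows "lambda_fun m x \<in> carrier CR"
proof -
  obtain c h where c: "\<And>i. lifts (c i) (h i)" "\<And>g. g \<in> carrier G \<Longrightarrow> lambda_series x g =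
      Abs_fps (\<lambda>i. c i g)"
    using x lambda_series_lifts unfolding carrier_character_ring by blast
  have "lifts (\<lambda>g\<in>carrier G. fps_nth (lambda_series x g) m) (h m)"
    by (rule lifts_restrict[OF c(1)]) (simp_all add: c(2))
  then show ?thesis unfolding carrier_character_ring lambda_fun_def restrict_apply'[OF x]
      by (rule exI)
qed

text \<open>The predicate under the definite description in \<open>lambda_op\<close>, made explicit
  so that existence and uniqueness can be stated separately.\<close>

definition lambda_spec :: "(nat \<Rightarrow> ((nat \<Rightarrow> 'a) \<Rightarrow> complex) \<Rightarrow> (nat \<Rightarrow> 'a) \<Rightarrow> complex) \<Rightarrow> bool" where
  "lambda_spec L \<longleftrightarrow>
     (\<forall>n. L n \<in> carrier CR \<rightarrow>\<^sub>E carrier CR) \<and>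
     (\<forall>n d r. matrix_rep G d r \<longrightarrow>
        L n (character G r) = character G (\<lambda>g. exterior_power_mat n (r g))) \<and>
     (\<forall>x\<in>carrier CR. L 0 x = \<one>\<^bsub>CR\<^esub>) \<and>
     (\<forall>n. \<forall>x\<in>carrier CR. \<forall>y\<in>carrier CR.
        L n (x \<oplus>\<^bsub>CR\<^esub> y) = (\<Oplus>\<^bsub>CR\<^esub>i\<in>{..n}. L i x \<otimes>\<^bsub>CR\<^esub> L (n - i) y))"

lemma CR_eqI: "x \<in> carrier CR \<Longrightarrow> y \<in> carrier CR \<Longrightarrow> (\<And>g. g \<in> carrier G \<Longrightarrow> x g = y g) \<Longrightarrow> x = y"
  using CR_ext extensionalityI by blast

lemma lambda_spec_lambda_fun: "lambda_spec lambda_fun"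
  unfolding lambda_spec_def
proof (intro conjI allI ballI impI)
  fix m
  show "lambda_fun m \<in> carrier CR \<rightarrow>\<^sub>E carrier CR"
  proof (rule PiE_I)
    show "lambda_fun m x = undefined" if "x \<notin> carrier CR" for x using that by
        (simp add: lambda_fun_def)
  qed (rule lambda_fun_closed)
next
  fix m d r assume r: "matrix_rep G d r"
  have c: "character G r \<in> carrier CR" using representation_lifts[OF r] carrier_character_ring
      by blast
  show "lambda_fun m (character G r) = character G (\<lambda>g. exterior_power_mat m (r g))"
    unfolding lambda_fun_def restrict_apply'[OF c] character_def[of G
        "\<lambda>g. exterior_power_mat m (r g)"]
    by (rule restrict_ext) (rule lambda_series_character[OF r])
next
  fix x assume x: "x \<in> carrier CR"
  show "lambda_fun 0 x = \<one>\<^bsub>CR\<^esub>"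
    by (rule CR_eqI[OF lambda_fun_closed[OF x]])
        (simp_all add: lambda_fun_apply x lambda_series_nth_0, simp add: CR_simps)
next
  fix m x y assume x: "x \<in> carrier CR" and y: "y \<in> carrier CR"
  have s: "x \<oplus>\<^bsub>CR\<^esub> y \<in> carrier CR" using x y by simp
  show "lambda_fun m (x \<oplus>\<^bsub>CR\<^esub> y) = (\<Oplus>\<^bsub>CR\<^esub>i\<in>{..m}. lambda_fun i x \<otimes>\<^bsub>CR\<^esub> lambda_fun (m - i) y)"
  proof (rule CR_eqI[OF lambda_fun_closed[OF s]])
    show "(\<Oplus>\<^bsub>CR\<^esub>i\<in>{..m}. lambda_fun i x \<otimes>\<^bsub>CR\<^esub> lambda_fun (m - i) y) \<in> carrier CR"
      by (rule CR.finsum_closed) (auto intro!: CR.m_closed lambda_fun_closed x y)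
    fix g assume g: "g \<in> carrier G"
    have "lambda_series (x \<oplus>\<^bsub>CR\<^esub> y) g = lambda_series (\<lambda>g. x g + y g) g"
      by (rule lambda_series_cong) (use g in \<open>simp_all add: CR_simps\<close>)
    then have "lambda_fun m (x \<oplus>\<^bsub>CR\<^esub> y) g = (\<Sum>i\<in>{..m}. fps_nth (lambda_series x g) i *
        fps_nth (lambda_series y g) (m - i))"
      by (simp add: lambda_fun_apply s g lambda_series_add fps_mult_nth atLeast0AtMost)
    also have "\<dots> = (\<Sum>i\<in>{..m}. (lambda_fun i x \<otimes>\<^bsub>CR\<^esub> lambda_fun (m - i) y) g)"
      using g by (simp add: CR_simps lambda_fun_apply x y)
    also have "\<dots> = (\<Oplus>\<^bsub>CR\<^esub>i\<in>{..m}. lambda_fun i x \<otimes>\<^bsub>CR\<^esub> lambda_fun (m - i) y) g"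
      by (rule CR_finsum[symmetric]) (auto intro!: CR.m_closed lambda_fun_closed x y g)
    finally show "lambda_fun m (x \<oplus>\<^bsub>CR\<^esub> y) g = (\<Oplus>\<^bsub>CR\<^esub>i\<in>{..m}. lambda_fun i x \<otimes>\<^bsub>CR\<^esub> lambda_fun (m -
        i) y) g" .
  qed
qed

lemma lambda_spec_closed: "lambda_spec L \<Longrightarrow> x \<in> carrier CR \<Longrightarrow> L m x \<in> carrier CR"
proof -
  assume "lambda_spec L" and x: "x \<in> carrier CR"
  then have "L m \<in> carrier CR \<rightarrow>\<^sub>E carrier CR" unfolding lambda_spec_def by blast
  then show ?thesis using x by (rule PiE_mem)
qed

lemma lambda_spec_character:
  "lambda_spec L \<Longrightarrow> matrix_rep G d r \<Longrightarrow>
    L m (character G r) = character G (\<lambda>g. exterior_power_mat m (r g))"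
  unfolding lambda_spec_def by blast

lemma lambda_spec_add:
  assumes L: "lambda_spec L" and x: "x \<in> carrier CR" and y: "y \<in> carrier CR" and g: "g \<in> carrier G"
  shows "L m (x \<oplus>\<^bsub>CR\<^esub> y) g = (\<Sum>i\<le>m. L i x g * L (m - i) y g)"
proof -
  have "L m (x \<oplus>\<^bsub>CR\<^esub> y) g = (\<Oplus>\<^bsub>CR\<^esub>i\<in>{..m}. L i x \<otimes>\<^bsub>CR\<^esub> L (m - i) y) g"
    using L x y unfolding lambda_spec_def by simp
  also have "\<dots> = (\<Sum>i\<in>{..m}. (L i x \<otimes>\<^bsub>CR\<^esub> L (m - i) y) g)"
    by (rule CR_finsum) (auto intro!: CR.m_closed lambda_spec_closed[OF L] x y g)
  finally show ?thesis using g by (simp add: CR_simps)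
qed

text \<open>The zero function is a genuine character, that of degree 0, so the condition on exterior
  powers determines the operations there. This starts the uniqueness induction.\<close>

lemma zero_rep: "matrix_rep G 0 (\<lambda>_. 1\<^sub>m 0)" and character_zero_rep: "character G (\<lambda>_. 1\<^sub>m 0) =
    (\<lambda>g\<in>carrier G. 0)"
  by (auto simp: matrix_rep_def hom_def units_of_def Units_def ring_mat_def character_def
      mat_trace_def)

lemma \<sigma>_rep: "matrix_rep G 1 (\<lambda>x. scalar_mat (\<sigma> a x))"
  by (intro scalar_mat_rep G.is_group \<sigma>_one \<sigma>_mult)

text \<open>On the \<open>\<sigma> a\<close> the operations are forced by the exterior powers, and
  the sum formula carries uniqueness over additions. For a subtraction it is read backwards: with y
  = x - \<open>\<sigma> a\<close>, the formula for y + \<open>\<sigma> a\<close> is solved for its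
  top term.\<close>

lemma lambda_spec_unique_lifts:
  assumes L: "lambda_spec L" and M: "lambda_spec M"
  shows "lifts x f \<Longrightarrow> \<forall>m. L m x = M m x"
proof (induction rule: lifts.induct)
  case lifts_zero
  show ?case
    using lambda_spec_character[OF L zero_rep] lambda_spec_character[OF M zero_rep]
    unfolding character_zero_rep[symmetric] by simp
next
  case (lifts_step_add x f a)
  have x: "x \<in> carrier CR" and s: "\<sigma> a \<in> carrier CR"
      using lifts_step_add lifts_\<sigma> carrier_character_ring by blast+
  have \<sigma>: "L m (\<sigma> a) = M m (\<sigma> a)" for m
    using lambda_spec_character[OF L \<sigma>_rep, of m a] lambda_spec_character[OF M \<sigma>_rep, of m a]
    unfolding character_scalar_mat[OF \<sigma>_ext] by simp
  show ?case
  proof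
    fix m
    have "L m (x \<oplus>\<^bsub>CR\<^esub> \<sigma> a) = M m (x \<oplus>\<^bsub>CR\<^esub> \<sigma> a)"
      by (rule CR_eqI) (simp_all add: lambda_spec_closed[OF L] lambda_spec_closed[OF M] x s
          lambda_spec_add[OF L] lambda_spec_add[OF M] lifts_step_add.IH \<sigma>)
    then show "L m (\<lambda>g\<in>carrier G. x g + \<sigma> a g) = M m (\<lambda>g\<in>carrier G. x g + \<sigma> a g)"
      by (simp only: CR_simps)
  qed
next
  case (lifts_step_diff x f a)
  let ?y = "\<lambda>g\<in>carrier G. x g - \<sigma> a g"
  have x: "x \<in> carrier CR" and s: "\<sigma> a \<in> carrier CR" and y: "?y \<in> carrier CR"
    using lifts_step_diff lifts.lifts_step_diff[of x f a] lifts_\<sigma> carrier_character_ring by blast+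
  have \<sigma>: "L m (\<sigma> a) = M m (\<sigma> a)" for m
    using lambda_spec_character[OF L \<sigma>_rep, of m a] lambda_spec_character[OF M \<sigma>_rep, of m a]
    unfolding character_scalar_mat[OF \<sigma>_ext] by simp
  have xy: "?y \<oplus>\<^bsub>CR\<^esub> \<sigma> a = x"
    by (rule CR_eqI[OF CR.a_closed[OF y s] x]) (simp add: CR_simps(1))
  have "L m ?y = M m ?y" for m
  proof (induction m rule: less_induct)
    case (less m)
    show ?case
    proof (rule CR_eqI[OF lambda_spec_closed[OF L y] lambda_spec_closed[OF M y]])
      fix g assume g: "g \<in> carrier G"
      \<comment> \<open>The coefficient of the top term \<open>N m ?y\<close> is the value of
        \<open>N 0 (\<sigma> a)\<close>, which is 1; all other terms have smaller index and fall
        under the induction hypothesis.\<close>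
      have split: "N m x g = (\<Sum>i<m. N i ?y g * N (m - i) (\<sigma> a) g) + N m ?y g" if N: "lambda_spec N"
          for N
      proof -
        have "N 0 (\<sigma> a) g = 1"
          using N s g unfolding lambda_spec_def by (simp add: CR_simps(3))
        moreover have "N m x g = (\<Sum>i\<le>m. N i ?y g * N (m - i) (\<sigma> a) g)"
          using lambda_spec_add[OF N y s g] unfolding xy .
        moreover have "{..m} = insert m {..<m}" by auto
        ultimately show ?thesis by simp
      qed
      have "(\<Sum>i<m. L i ?y g * L (m - i) (\<sigma> a) g) = (\<Sum>i<m. M i ?y g * M (m - i) (\<sigma> a) g)"
        by (rule sum.cong[OF refl]) (simp only: less \<sigma> lessThan_iff)
      then show "L m ?y g = M m ?y g"
        using split[OF L] split[OF M] lifts_step_diff.IH by simp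
    qed
  qed
  then show ?case by blast
qed

lemma lambda_op_eq: "lambda_op G = lambda_fun"
proof -
  have "lambda_op G = (THE L. lambda_spec L)"
    unfolding lambda_op_def lambda_spec_def ..
  also have "\<dots> = lambda_fun"
  proof (rule the_equality[where P = lambda_spec, OF lambda_spec_lambda_fun])
    fix L assume L: "lambda_spec L"
    show "L = lambda_fun"
    proof (intro ext)
      fix m x
      have "L m x = lambda_fun m x"
      proof (cases "x \<in> carrier CR")
        case True
        then show ?thesis
          using lambda_spec_unique_lifts[OF L lambda_spec_lambda_fun] carrier_character_ring
              by blast
      next
        \<comment> \<open>Outside the carrier both operations are \<open>undefined\<close> by
          extensionality, so uniqueness holds for the functions as such.\<close>
        case False
        have "L m \<in> carrier CR \<rightarrow>\<^sub>E carrier CR" "lambda_fun m \<in> carrier CR \<rightarrow>\<^sub>E carrier CR"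
          using L lambda_spec_lambda_fun unfolding lambda_spec_def by blast+
        then show ?thesis using False unfolding PiE_def extensional_def by simp
      qed
      then show "L m x g = lambda_fun m x g" for g by simp
    qed
  qed
  finally show ?thesis .
qed

end

section \<open>The \<open>\<gamma>\<close>-filtration\<close>

context cyclic_product
begin

lemma J_sum: "finite A \<Longrightarrow> (\<And>i. i \<in> A \<Longrightarrow> f i \<in> J m) \<Longrightarrow> (\<Sum>i\<in>A. f i) \<in> J m"
  by (induction A rule: finite_induct) (simp_all add: J_zero J_add)

lemma J_power: "f \<in> J 1 \<Longrightarrow> f ^ i \<in> J i"
  by (induction i) (use J_mult[of f 1] in \<open>simp_all add: J_0\<close>)

lemma lifts_cauchy_J:
  assumes "\<And>i. lifts (c i) (f i) \<and> f i \<in> J i" "\<And>i. lifts (d i) (h i) \<and> h i \<in> J i"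
  shows "lifts (\<lambda>g\<in>carrier G. \<Sum>i=0..m. c i g * d (m - i) g) (\<Sum>i=0..m. f i * h (m - i)) \<and>
    (\<Sum>i=0..m. f i * h (m - i)) \<in> J m"
proof (intro conjI lifts_cauchy J_sum finite_atLeastAtMost)
  show "lifts (c i) (f i)" "lifts (d i) (h i)" for i using assms by auto
  fix i assume "i \<in> {0..m}"
  then show "f i * h (m - i) \<in> J m" using J_mult[of "f i" i "h (m - i)" "m - i"] assms by auto
qed

lemma lifts_\<sigma>_minus_one: "lifts (\<lambda>g\<in>carrier G. \<sigma> a g - 1) (vmon a - 1)"
  by (rule lifts_restrict[OF lifts_diff[OF lifts_\<sigma>[of a] lifts_one]]) simp_all

text \<open>With s = t/(1+t), this says for a linear character \<sigma> that its \<lambda>-series in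
  t is 1 + t, the \<lambda>-series of the trivial character, times 1 + (\<sigma> - 1)s, the
  \<gamma>-series of \<sigma> - 1 in s.\<close>

lemma one_plus_gshift: "(1 + fps_X) * (1 + fps_const (b - 1) * gshift) = 1 + fps_const b * fps_X"
proof -
  have "(1 + fps_X) * (1 + fps_const (b - 1) * gshift) =
      1 + fps_X + fps_const (b - 1) * (gshift * (1 + fps_X))"
    by (simp only: algebra_simps mult_1_left mult_1_right)
  also have "\<dots> = 1 + fps_const b * fps_X"
    unfolding gshift_mult by (simp add: fps_const_sub[symmetric] algebra_simps del: fps_const_sub)
  finally show ?thesis .
qed

text \<open>The two exponents replace the power of \<open>1 + t\<close> with exponent \<open>\<epsilon>(x) = l - k\<close>, which may be
  negative.\<close>

lemma lambda_series_gshift: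
  "lifts x f \<Longrightarrow> \<exists>k l c h. x \<one>\<^bsub>G\<^esub> + of_nat k = of_nat l \<and> (\<forall>i. lifts (c i) (h i) \<and> h i \<in> J i) \<and>
     (\<forall>g\<in>carrier G. lambda_series x g * (1 + fps_X) ^ k = (Abs_fps (\<lambda>i. c i g) oo gshift) * (1 +
         fps_X) ^ l)"
proof (induction rule: lifts.induct)
  case lifts_zero
  define c where "c i = (if i = (0::nat) then (\<lambda>g\<in>carrier G. 1) else (\<lambda>g\<in>carrier G. 0 :: complex))"
      for i
  have "lifts (c i) (if i = 0 then 1 else 0) \<and> (if i = 0 then 1 else 0) \<in> J i" for i
    by (cases "i = 0") (simp_all only: c_def simp_thms if_True if_False lifts_one lifts.lifts_zero
        J_0 J_zero)
  moreover define y :: "(nat \<Rightarrow> 'a) \<Rightarrow> complex" where "y = (\<lambda>g\<in>carrier G. 0)"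
  moreover have "lambda_series y g * (1 + fps_X) ^ 0 =
      (Abs_fps (\<lambda>i. c i g) oo gshift) * (1 + fps_X) ^ 0"
    if g: "g \<in> carrier G" for g
  proof -
    have "lambda_series y g = lambda_series (\<lambda>g. 0) g" unfolding y_def by (rule lambda_series_cong)
        (use g in simp_all)
    moreover have "Abs_fps (\<lambda>i. c i g) = 1" by (rule fps_ext) (use g in \<open>simp add: c_def\<close>)
    ultimately show ?thesis by (simp only: lambda_series_zero fps_compose_1)
  qed
  moreover have "y \<one>\<^bsub>G\<^esub> + of_nat 0 = of_nat 0" by (simp add: y_def)
  ultimately show ?case unfolding y_def[symmetric]
    by (intro exI[of _ 0] exI[of _ c] exI[of _ "\<lambda>i. if i =
        0 then 1 else 0"] conjI allI ballI) simp_all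
next
  case (lifts_step_add x f a)
  then obtain k l c h where kl: "x \<one>\<^bsub>G\<^esub> + of_nat k = of_nat l"
    and c: "\<And>i. lifts (c i) (h i) \<and> h i \<in> J i"
    and lambda_series: "\<And>g. g \<in> carrier G \<Longrightarrow> lambda_series x g * (1 + fps_X) ^ k =
        (Abs_fps (\<lambda>i. c i g) oo gshift) * (1 + fps_X) ^ l"
    by blast
  define d where "d i = (if i = (0::nat) then (\<lambda>g\<in>carrier G. 1) else if i =
      1 then (\<lambda>g\<in>carrier G. \<sigma> a g - 1) else (\<lambda>g\<in>carrier G. 0))" for i
  define D where "D i = (if i = (0::nat) then 1 else if i = 1 then vmon a - 1 else 0)" for i
  have d: "lifts (d i) (D i) \<and> D i \<in> J i" for i
    by (cases "i = 0"; cases "i = 1")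
      (simp_all only: d_def D_def simp_thms if_True if_False lifts_one lifts.lifts_zero
          lifts_\<sigma>_minus_one one_neq_zero J_0 J_zero vmon_minus_one_J)
  define y where "y = (\<lambda>g\<in>carrier G. x g + \<sigma> a g)"
  define cd where "cd m = (\<lambda>g\<in>carrier G. \<Sum>i=0..m. c i g * d (m - i) g)" for m
  have "lambda_series y g * (1 + fps_X) ^ k =
      (Abs_fps (\<lambda>i. cd i g) oo gshift) * (1 + fps_X) ^ Suc l"
    if g: "g \<in> carrier G" for g
  proof -
    have "Abs_fps (\<lambda>i. d i g) = 1 + fps_const (\<sigma> a g - 1) * fps_X"
      by (rule fps_ext) (use g in \<open>simp add: d_def\<close>)
    then have e: "Abs_fps (\<lambda>i. d i g) oo gshift = 1 + fps_const (\<sigma> a g - 1) * gshift"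
      by (simp add: fps_compose_add_distrib fps_compose_mult_distrib gshift_0)
    have "Abs_fps (\<lambda>i. cd i g) = Abs_fps (\<lambda>i. c i g) * Abs_fps (\<lambda>i. d i g)"
      by (rule fps_ext) (use g in \<open>simp add: fps_mult_nth cd_def\<close>)
    then have cd: "Abs_fps (\<lambda>i. cd i g) oo gshift =
        (Abs_fps (\<lambda>i. c i g) oo gshift) * (1 + fps_const (\<sigma> a g - 1) * gshift)"
      by (simp only: fps_compose_mult_distrib gshift_0 e)
    have "lambda_series y g * (1 + fps_X) ^ k =
        lambda_series x g * (1 + fps_X) ^ k * (1 + fps_const (\<sigma> a g) * fps_X)"
      unfolding y_def lambda_series_add_\<sigma>[OF g] by (simp only: mult_ac)
    also have "\<dots> = (Abs_fps (\<lambda>i. c i g) oo gshift) * (1 + fps_X) ^ l * ((1 + fps_X) * (1 +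
        fps_const (\<sigma> a g - 1) * gshift))"
      by (simp only: lambda_series[OF g] one_plus_gshift)
    also have "\<dots> = (Abs_fps (\<lambda>i. cd i g) oo gshift) * (1 + fps_X) ^ Suc l"
      by (simp only: cd power_Suc mult_ac)
    finally show ?thesis .
  qed
  moreover have "y \<one>\<^bsub>G\<^esub> + of_nat k = of_nat (Suc l)"
    using kl by (simp add: y_def \<sigma>_one)
  moreover have "lifts (cd m) (\<Sum>i=0..m. h i * D (m - i)) \<and> (\<Sum>i=0..m. h i * D (m - i)) \<in> J m" for m
    unfolding cd_def by (rule lifts_cauchy_J[OF c d])
  ultimately show ?case unfolding y_def[symmetric]
    by (intro exI[of _ k] exI[of _ "Suc l"] exI[of _ cd] exI[of _ "\<lambda>m. \<Sum>i=0..m. h i * D (m -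
        i)"] conjI allI ballI) simp_all
next
  case (lifts_step_diff x f a)
  then obtain k l c h where kl: "x \<one>\<^bsub>G\<^esub> + of_nat k = of_nat l"
    and c: "\<And>i. lifts (c i) (h i) \<and> h i \<in> J i"
    and lambda_series: "\<And>g. g \<in> carrier G \<Longrightarrow> lambda_series x g * (1 + fps_X) ^ k =
        (Abs_fps (\<lambda>i. c i g) oo gshift) * (1 + fps_X) ^ l"
    by blast
  \<comment> \<open>The coefficients of the inverse of 1 + (\<open>\<sigma> a\<close> - 1)s, a
    geometric series; being an i-th power of an element of \<open>J 1\<close>, the i-th lift has the
    required order. The nested restrictions are those that \<open>lifts_minus\<close> and
    \<open>lifts_pow\<close> produce.\<close>
  define d where "d i = (\<lambda>g\<in>carrier G. (\<lambda>g\<in>carrier G. - (\<lambda>g\<in>carrier G. \<sigma> a g - 1) g) g ^ i)"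
      for i :: nat
  define D where "D i = (- (vmon a - 1)) ^ i" for i
  have d: "lifts (d i) (D i) \<and> D i \<in> J i" for i
    unfolding d_def D_def by (intro conjI lifts_pow lifts_minus lifts_\<sigma>_minus_one J_power J_uminus
        vmon_minus_one_J)
  define y where "y = (\<lambda>g\<in>carrier G. x g - \<sigma> a g)"
  define cd where "cd m = (\<lambda>g\<in>carrier G. \<Sum>i=0..m. c i g * d (m - i) g)" for m
  have "lambda_series y g * (1 + fps_X) ^ Suc k =
      (Abs_fps (\<lambda>i. cd i g) oo gshift) * (1 + fps_X) ^ l"
    if g: "g \<in> carrier G" for g
  proof -
    have "Abs_fps (\<lambda>i. d i g) = Abs_fps (\<lambda>i. (- (\<sigma> a g - 1)) ^ i)"
      by (rule fps_ext) (use g in \<open>simp add: d_def\<close>)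
    then have "(1 + fps_const (\<sigma> a g - 1) * fps_X) * Abs_fps (\<lambda>i. d i g) = 1"
      by (simp only: one_plus_const_X_inverse)
    then have "((1 + fps_const (\<sigma> a g - 1) * fps_X) * Abs_fps (\<lambda>i. d i g)) oo gshift = 1" by simp
    then have e: "(1 + fps_const (\<sigma> a g - 1) * gshift) * (Abs_fps (\<lambda>i. d i g) oo gshift) = 1"
      by (simp add: fps_compose_add_distrib fps_compose_mult_distrib gshift_0)
    have "Abs_fps (\<lambda>i. cd i g) = Abs_fps (\<lambda>i. c i g) * Abs_fps (\<lambda>i. d i g)"
      by (rule fps_ext) (use g in \<open>simp add: fps_mult_nth cd_def\<close>)
    then have cd: "Abs_fps (\<lambda>i. cd i g) oo gshift =
        (Abs_fps (\<lambda>i. c i g) oo gshift) * (Abs_fps (\<lambda>i. d i g) oo gshift)"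
      by (simp only: fps_compose_mult_distrib gshift_0)
    have "lambda_series y g * ((1 + fps_X) * (1 + fps_const (\<sigma> a g - 1) * gshift)) =
        lambda_series x g"
      unfolding one_plus_gshift y_def by (rule lambda_series_diff_\<sigma>[OF g])
    then have "(Abs_fps (\<lambda>i. c i g) oo gshift) * (1 + fps_X) ^ l =
        lambda_series y g * ((1 + fps_X) * (1 + fps_const (\<sigma> a g - 1) * gshift)) * (1 + fps_X) ^ k"
      by (simp only: lambda_series[OF g])
    also have "\<dots> = (lambda_series y g * (1 + fps_X) ^ Suc k) * (1 + fps_const (\<sigma> a g - 1) * gshift)"
      by (simp only: power_Suc mult_ac)
    finally have fin: "(Abs_fps (\<lambda>i. c i g) oo gshift) * (1 + fps_X) ^ l =
        (lambda_series y g * (1 + fps_X) ^ Suc k) * (1 + fps_const (\<sigma> a g - 1) * gshift)" .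
    have "(Abs_fps (\<lambda>i. cd i g) oo gshift) * (1 + fps_X) ^ l =
        (Abs_fps (\<lambda>i. c i g) oo gshift) * (1 + fps_X) ^ l * (Abs_fps (\<lambda>i. d i g) oo gshift)"
      by (simp only: cd mult_ac)
    also have "\<dots> =
       (lambda_series y g * (1 + fps_X) ^ Suc k) * ((1 + fps_const (\<sigma> a g - 1) * gshift) * (Abs_fps
           (\<lambda>i. d i g) oo gshift))"
      unfolding fin by (rule mult.assoc)
    finally have "(Abs_fps (\<lambda>i. cd i g) oo gshift) * (1 + fps_X) ^ l =
       (lambda_series y g * (1 + fps_X) ^ Suc k) * ((1 + fps_const (\<sigma> a g - 1) * gshift) * (Abs_fps
           (\<lambda>i. d i g) oo gshift))" .
    then show ?thesis by (simp only: e mult_1_right)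
  qed
  moreover have "y \<one>\<^bsub>G\<^esub> + of_nat (Suc k) = of_nat l"
    using kl by (simp add: y_def \<sigma>_one)
  moreover have "lifts (cd m) (\<Sum>i=0..m. h i * D (m - i)) \<and> (\<Sum>i=0..m. h i * D (m - i)) \<in> J m" for m
    unfolding cd_def by (rule lifts_cauchy_J[OF c d])
  ultimately show ?case unfolding y_def[symmetric]
    by (intro exI[of _ "Suc k"] exI[of _ l] exI[of _ cd] exI[of _ "\<lambda>m. \<Sum>i=0..m. h i * D (m -
        i)"] conjI allI ballI) simp_all
qed

text \<open>The exponents in \<open>lambda_series_gshift\<close> already record the degree as a
  difference of natural numbers.\<close>

lemma lifts_one_int: "lifts x f \<Longrightarrow> \<exists>d::int. x \<one>\<^bsub>G\<^esub> = of_int d"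
proof -
  assume "lifts x f"
  from lambda_series_gshift[OF this] obtain k l :: nat where "x \<one>\<^bsub>G\<^esub> + of_nat k = of_nat l" by blast
  then have "x \<one>\<^bsub>G\<^esub> = of_int (int l - int k)" by (simp add: algebra_simps)
  then show ?thesis by blast
qed

lemma augmentation_eq: "x \<one>\<^bsub>G\<^esub> = of_int d \<Longrightarrow> augmentation G x = d"
  unfolding augmentation_def by (rule the_equality) auto

lemma augmentation_ideal_iff: "x \<in> augmentation_ideal G \<longleftrightarrow> x \<in> carrier CR \<and> x \<one>\<^bsub>G\<^esub> = 0"
proof
  assume "x \<in> augmentation_ideal G"
  then have x: "x \<in> carrier CR" "augmentation G x = 0" by (simp_all add: augmentation_ideal_def)
  obtain d where "x \<one>\<^bsub>G\<^esub> = of_int d" using lifts_one_int x(1) unfolding carrier_character_ring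
      by blast
  then show "x \<in> carrier CR \<and> x \<one>\<^bsub>G\<^esub> = 0" using x augmentation_eq by force
next
  assume "x \<in> carrier CR \<and> x \<one>\<^bsub>G\<^esub> = 0"
  then show "x \<in> augmentation_ideal G" using augmentation_eq[of x 0] by
      (simp add: augmentation_ideal_def)
qed

text \<open>Adding the constant i multiplies the \<lambda>-series by (1+t)^i. The index is a
  successor because for \<gamma>^0 this exponent would be -1.\<close>

lemma gamma_op_apply:
  assumes x: "x \<in> carrier CR" and g: "g \<in> carrier G"
  shows "gamma_op G (Suc i) x g = fps_nth (lambda_series x g * (1 + fps_X) ^ i) (Suc i)"
    and "gamma_op G i x \<in> carrier CR"
proof -
  have s: "x \<oplus>\<^bsub>CR\<^esub> add_pow CR (int i - 1) \<one>\<^bsub>CR\<^esub> \<in> carrier CR" for i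
    using x CR.add.int_pow_closed[OF CR.one_closed] by simp
  show "gamma_op G i x \<in> carrier CR"
    unfolding gamma_op_def lambda_op_eq by (rule lambda_fun_closed[OF s])
  have "lambda_series (x \<oplus>\<^bsub>CR\<^esub> add_pow CR (int (Suc i) - 1) \<one>\<^bsub>CR\<^esub>) g =
      lambda_series (\<lambda>g. x g + of_nat i) g"
    by (rule lambda_series_cong) (use g in \<open>simp_all add: CR_simps(1) CR_add_pow\<close>)
  also have "\<dots> = lambda_series x g * (1 + fps_X) ^ i" by
      (simp only: lambda_series_add lambda_series_of_nat)
  finally show "gamma_op G (Suc i) x g = fps_nth (lambda_series x g * (1 + fps_X) ^ i) (Suc i)"
    unfolding gamma_op_def lambda_op_eq lambda_fun_apply[OF s g] by simp
qed

text \<open>On the augmentation ideal the two powers of 1 + t in \<open>lambda_series_gshift\<close>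
  have equal exponents and cancel. The \<lambda>-series is then the series of the c i evaluated at
  t/(1+t), and \<open>compose_gshift_nth\<close> identifies \<gamma>^i(x) with c i, which has a lift
  of order i. Index 0 is separate but imposes no condition on the order.\<close>

lemma gamma_op_lifts:
  assumes "x \<in> augmentation_ideal G"
  shows "\<exists>f. lifts (gamma_op G i x) f \<and> f \<in> J i"
proof (cases i)
  case 0
  obtain f where "lifts (gamma_op G 0 x) f"
    using gamma_op_apply(2)[of x "\<one>\<^bsub>G\<^esub>" 0] assms
        unfolding augmentation_ideal_iff carrier_character_ring by auto
  then show ?thesis using 0 J_0 by blast
next
  case (Suc j)
  have x: "x \<in> carrier CR" "x \<one>\<^bsub>G\<^esub> = 0" using assms by (simp_all add: augmentation_ideal_iff)
  then obtain f where "lifts x f" unfolding carrier_character_ring by blast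
  from lambda_series_gshift[OF this] obtain k l c h where kl: "x \<one>\<^bsub>G\<^esub> + of_nat k = of_nat l"
    and c: "\<And>i. lifts (c i) (h i) \<and> h i \<in> J i"
    and lambda_series: "\<And>g. g \<in> carrier G \<Longrightarrow> lambda_series x g * (1 + fps_X) ^ k =
        (Abs_fps (\<lambda>i. c i g) oo gshift) * (1 + fps_X) ^ l"
    by blast
  have "k = l" using kl x(2) by simp
  have "fps_nth (1 + fps_X :: complex fps) 0 \<noteq> 0" by simp
  then have "(1 + fps_X :: complex fps) \<noteq> 0" by (metis fps_zero_nth)
  then have lambda_series': "lambda_series x g = Abs_fps (\<lambda>i. c i g) oo gshift" if "g \<in> carrier G"
      for g
    using lambda_series[OF that] \<open>k = l\<close> by simp
  have "gamma_op G i x g = c i g" if g: "g \<in> carrier G" for g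
    using compose_gshift_nth[of i "Abs_fps (\<lambda>i. c i g)"] Suc
    by (simp add: gamma_op_apply(1)[OF x(1) g] lambda_series'[OF g])
  then have "lifts (gamma_op G i x) (h i)"
    using lifts_cong[of "c i" "h i" "gamma_op G i x"] c CR_ext[OF gamma_op_apply(2)[OF x(1)
        G.one_closed]] by blast
  then show ?thesis using c by blast
qed

lemma gamma_op_1: "x \<in> carrier CR \<Longrightarrow> gamma_op G 1 x = x"
  using gamma_op_apply(2)[of x "\<one>\<^bsub>G\<^esub>" 1]
  by (intro CR_eqI) (simp_all add: gamma_op_apply(1)[of x _ 0, simplified]
      lambda_series_nth_1[unfolded One_nat_def])

section \<open>Products of \<gamma>-operations and the filtration they generate\<close>

lemma gamma_product_Nil: "gamma_product G [] = \<one>\<^bsub>CR\<^esub>"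
  and gamma_product_Cons: "gamma_product G ((i, x) # ps) = gamma_op G i x \<otimes>\<^bsub>CR\<^esub> gamma_product G ps"
  by (simp_all add: gamma_product_def)

lemma gamma_product_lifts:
  "snd ` set ps \<subseteq> augmentation_ideal G \<Longrightarrow>
    \<exists>f. lifts (gamma_product G ps) f \<and> f \<in> J (sum_list (map fst ps))"
proof (induction ps)
  case Nil
  show ?case unfolding gamma_product_Nil CR_simps list.map sum_list.Nil
    by (intro exI[of _ 1] conjI lifts_one J_0)
next
  case (Cons q ps)
  obtain i x where q: "q = (i, x)" by (cases q)
  obtain f where f: "lifts (gamma_product G ps) f" "f \<in> J (sum_list (map fst ps))" using Cons
      by auto
  obtain h where h: "lifts (gamma_op G i x) h" "h \<in> J i" using gamma_op_lifts[of x i] Cons.prems q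
      by auto
  have "lifts (gamma_product G (q # ps)) (h * f)"
    unfolding q gamma_product_Cons CR_simps by (rule lifts_mult[OF f(1) h(1)])
  moreover have "h * f \<in> J (sum_list (map fst (q # ps)))" using J_mult[OF h(2) f(2)] by
      (simp add: q)
  ultimately show ?case by blast
qed

lemma gamma_product_closed:
  "snd ` set ps \<subseteq> augmentation_ideal G \<Longrightarrow> gamma_product G ps \<in> carrier CR"
  using gamma_product_lifts carrier_character_ring by blast

lemma gamma_product_append:
  assumes "snd ` set ps \<subseteq> augmentation_ideal G" "snd ` set qs \<subseteq> augmentation_ideal G"
  shows "gamma_product G (ps @ qs) = gamma_product G ps \<otimes>\<^bsub>CR\<^esub> gamma_product G qs"
  using assms(1)
proof (induction ps)
  case Nil
  then show ?case using gamma_product_closed[OF assms(2)] by (simp add: gamma_product_Nil)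
next
  case (Cons r ps)
  obtain i x where r: "r = (i, x)" by (cases r)
  have "gamma_op G i x \<in> carrier CR"
    using gamma_op_apply(2)[OF _ G.one_closed] Cons.prems r by (auto simp: augmentation_ideal_iff)
  then show ?case
    using Cons gamma_product_closed[of ps] gamma_product_closed[OF assms(2)]
    by (simp add: r gamma_product_Cons CR.m_assoc)
qed

definition gamma_gens :: "nat \<Rightarrow> ((nat \<Rightarrow> 'a) \<Rightarrow> complex) set" where
  "gamma_gens m = {gamma_product G ps |ps. snd ` set ps \<subseteq> augmentation_ideal G \<and>
      m \<le> sum_list (map fst ps)}"

lemma gamma_filtration_eq: "gamma_filtration G m = generate (add_monoid CR) (gamma_gens m)"
  by (simp add: gamma_filtration_def gamma_gens_def)

lemma gamma_gens_closed: "gamma_gens m \<subseteq> carrier CR"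
  using gamma_product_closed unfolding gamma_gens_def by blast

lemma gamma_filtration_subgroup: "subgroup (gamma_filtration G m) (add_monoid CR)"
  unfolding gamma_filtration_eq using gamma_gens_closed by (intro CR.add.generate_is_subgroup) simp

lemma gamma_filtration_closed: "x \<in> gamma_filtration G m \<Longrightarrow> x \<in> carrier CR"
  using subgroup.subset[OF gamma_filtration_subgroup] by auto

lemma gamma_filtration_induct [consumes 1, case_names gen zero minus add]:
  assumes x: "x \<in> gamma_filtration G m"
    and gen: "\<And>x. x \<in> gamma_gens m \<Longrightarrow> Q x" and zero: "Q \<zero>\<^bsub>CR\<^esub>"
    and minus: "\<And>x. x \<in> carrier CR \<Longrightarrow> Q x \<Longrightarrow> Q (\<ominus>\<^bsub>CR\<^esub> x)"
    and add: "\<And>x y. x \<in> carrier CR \<Longrightarrow> y \<in> carrier CR \<Longrightarrow> Q x \<Longrightarrow> Q y \<Longrightarrow> Q (x \<oplus>\<^bsub>CR\<^esub> y)"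
  shows "Q x"
  using x[unfolded gamma_filtration_eq]
proof (induction rule: generate.induct)
  case one
  show ?case using zero by simp
next
  case (incl h)
  then show ?case by (rule gen)
next
  case (inv h)
  then show ?case using minus[of h] gen[of h] gamma_gens_closed by (auto simp: a_inv_def)
next
  case (eng h1 h2)
  then show ?case using add[of h1 h2] gamma_filtration_closed[of _ m, unfolded gamma_filtration_eq]
      by simp
qed

text \<open>The \<gamma>-filtration is carried into the filtration by degree. One good lift
  suffices, as two lifts of x differ by an element of K, and K lies in every
  \<open>J m\<close>.\<close>

lemma gamma_filtration_lifts: "x \<in> gamma_filtration G m \<Longrightarrow> \<exists>f. lifts x f \<and> f \<in> J m"
proof (induction rule: gamma_filtration_induct)
  case (gen x)
  then obtain ps where ps: "x = gamma_product G ps" "snd ` set ps \<subseteq> augmentation_ideal G"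
    "m \<le> sum_list (map fst ps)" unfolding gamma_gens_def by blast
  obtain f where "lifts x f" "f \<in> J (sum_list (map fst ps))"
      using gamma_product_lifts[OF ps(2)] ps(1) by blast
  then show ?case using subsetD[OF J_mono[OF ps(3)]] by blast
next
  case zero
  show ?case unfolding CR_simps by (intro exI[of _ 0] conjI lifts_zero J_zero)
next
  case (minus x)
  then obtain f where "lifts x f" "f \<in> J m" by blast
  then show ?case unfolding CR_minus[OF minus(1)]
    by (intro exI[of _ "- f"] conjI lifts_minus J_uminus)
next
  case (add x y)
  then obtain f h where "lifts x f" "f \<in> J m" "lifts y h" "h \<in> J m" by blast
  then show ?case unfolding CR_simps by (intro exI[of _ "f + h"] conjI lifts_add J_add)
qed

text \<open>For generators the product is given by concatenating the lists, so the weights add; an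
  induction in each factor extends this additively.\<close>

lemma gamma_filtration_mult:
  assumes x: "x \<in> gamma_filtration G i" and y: "y \<in> gamma_filtration G j"
  shows "x \<otimes>\<^bsub>CR\<^esub> y \<in> gamma_filtration G (i + j)"
proof -
  interpret S: subgroup "gamma_filtration G (i + j)" "add_monoid CR"
      by (rule gamma_filtration_subgroup)
  have zero: "\<zero>\<^bsub>CR\<^esub> \<in> gamma_filtration G (i + j)" using S.one_closed by simp
  have minus: "\<ominus>\<^bsub>CR\<^esub> z \<in> gamma_filtration G (i + j)" if "z \<in> gamma_filtration G (i + j)" for z
    using S.m_inv_closed[OF that] by (simp add: a_inv_def)
  have add: "z \<oplus>\<^bsub>CR\<^esub> w \<in> gamma_filtration G (i + j)"
    if "z \<in> gamma_filtration G (i + j)" "w \<in> gamma_filtration G (i + j)" for z w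
    using S.m_closed[OF that] by simp
  have yc: "y \<in> carrier CR" by (rule gamma_filtration_closed[OF y])
  show ?thesis using x
  proof (induction rule: gamma_filtration_induct)
    case (gen x)
    then have xc: "x \<in> carrier CR" using gamma_gens_closed by blast
    show ?case using y
    proof (induction rule: gamma_filtration_induct)
      case (gen y)
      obtain ps where ps: "x = gamma_product G ps" "snd ` set ps \<subseteq> augmentation_ideal G"
          "i \<le> sum_list (map fst ps)"
        using \<open>x \<in> gamma_gens i\<close> unfolding gamma_gens_def by blast
      obtain qs where qs: "y = gamma_product G qs" "snd ` set qs \<subseteq> augmentation_ideal G"
          "j \<le> sum_list (map fst qs)"
        using gen unfolding gamma_gens_def by blast
      have "x \<otimes>\<^bsub>CR\<^esub> y = gamma_product G (ps @ qs)" using gamma_product_append[OF ps(2) qs(2)] ps qs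
          by simp
      moreover have "snd ` set (ps @ qs) \<subseteq> augmentation_ideal G" "i +
          j \<le> sum_list (map fst (ps @ qs))"
        using ps qs by auto
      ultimately have "x \<otimes>\<^bsub>CR\<^esub> y \<in> gamma_gens (i + j)" unfolding gamma_gens_def by blast
      then show ?case unfolding gamma_filtration_eq by (rule generate.incl)
    next
      case zero
      show ?case using \<open>\<zero>\<^bsub>CR\<^esub> \<in> gamma_filtration G (i + j)\<close> xc by simp
    next
      case (minus y)
      then show ?case using \<open>\<And>z. z \<in> gamma_filtration G (i + j) \<Longrightarrow> \<ominus>\<^bsub>CR\<^esub> z \<in> gamma_filtration G (i +
          j)\<close> xc
        by (simp add: CR.r_minus)
    next
      case (add y w)
      then show ?case using S.m_closed xc by (simp add: CR.r_distr)
    qed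
  next
    case zero
    show ?case using \<open>\<zero>\<^bsub>CR\<^esub> \<in> gamma_filtration G (i + j)\<close> yc by simp
  next
    case (minus x)
    then show ?case using \<open>\<And>z. z \<in> gamma_filtration G (i + j) \<Longrightarrow> \<ominus>\<^bsub>CR\<^esub> z \<in> gamma_filtration G (i + j)\<close>
        yc
      by (simp add: CR.l_minus)
  next
    case (add x w)
    then show ?case using S.m_closed yc by (simp add: CR.l_distr)
  qed
qed

lemma gamma_ring_filtration: "ring_filtration CR (gamma_filtration G)"
proof (intro ring_filtration.intro ring_filtration_axioms.intro)
  show "ring CR" by (rule CR.ring_axioms)
  show "subgroup (gamma_filtration G m) (add_monoid CR)" for m by (rule gamma_filtration_subgroup)
  show "gamma_filtration G (Suc m) \<subseteq> gamma_filtration G m" for m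
    unfolding gamma_filtration_eq by (rule CR.add.mono_generate) (auto simp: gamma_gens_def)
  show "\<one>\<^bsub>CR\<^esub> \<in> gamma_filtration G 0"
    unfolding gamma_filtration_eq gamma_product_Nil[symmetric]
    by (rule generate.incl) (auto simp: gamma_gens_def intro: exI[of _ "[]"])
qed (rule gamma_filtration_mult)

section \<open>The homomorphism on the graded ring and on its reduction modulo p\<close>

definition component :: "nat \<Rightarrow> ((nat \<Rightarrow> 'a) \<Rightarrow> complex) \<Rightarrow> (nat multiset \<Rightarrow> int) set" where
  "component m x = degree_part m (SOME f. lifts x f)"

lemma component_lifts: "lifts x f \<Longrightarrow> component m x = degree_part m f"
  unfolding component_def by (rule degree_part_cong, rule lifts_unique) (rule someI)

lemma graded_character_ring_hom:
  "\<exists>f \<in> Ring.ring_hom (graded_character_ring G) TR. \<forall>m. \<forall>x\<in>gamma_filtration G m.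
     f (homogeneous CR (gamma_filtration G) m x) = component m x"
  unfolding graded_character_ring_def
proof (rule ring_filtration.graded_ring_hom[OF gamma_ring_filtration cring_TR])
  fix m x assume x: "x \<in> gamma_filtration G m"
  obtain f where f: "lifts x f" "f \<in> J m" using gamma_filtration_lifts[OF x] by blast
  show "component m x \<in> carrier TR" unfolding component_lifts[OF f(1)] by (rule degree_part_closed)
  fix y
  show "component m (x \<oplus>\<^bsub>CR\<^esub> y) = component m x \<oplus>\<^bsub>TR\<^esub> component m y" if y: "y \<in> gamma_filtration G m"
  proof -
    obtain h where h: "lifts y h" using gamma_filtration_lifts[OF y] by blast
    have "lifts (x \<oplus>\<^bsub>CR\<^esub> y) (f + h)" unfolding CR_simps by (rule lifts_add[OF f(1) h])
    then show ?thesis by (simp only: component_lifts[OF f(1)] component_lifts[OF h] component_lifts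
        degree_part_add)
  qed
  fix k
  \<comment> \<open>Additivity holds for arbitrary lifts, but multiplicativity needs lifts in
    \<open>J m\<close> and \<open>J k\<close>; this is where the comparison of the two filtrations
    enters.\<close>
  show "component (m + k) (x \<otimes>\<^bsub>CR\<^esub> y) = component m x \<otimes>\<^bsub>TR\<^esub> component k y"
      if y: "y \<in> gamma_filtration G k"
  proof -
    obtain h where h: "lifts y h" "h \<in> J k" using gamma_filtration_lifts[OF y] by blast
    have "lifts (x \<otimes>\<^bsub>CR\<^esub> y) (f * h)" unfolding CR_simps by (rule lifts_mult[OF h(1) f(1)])
    then show ?thesis by (simp only: component_lifts[OF f(1)] component_lifts[OF h(1)]
        component_lifts degree_part_mult[OF f(2) h(2)])
  qed
next
  have "lifts \<one>\<^bsub>CR\<^esub> 1" unfolding CR_simps by (rule lifts_one)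
  then show "component 0 \<one>\<^bsub>CR\<^esub> = \<one>\<^bsub>TR\<^esub>" by (simp only: component_lifts degree_part_one)
next
  fix m x assume "x \<in> gamma_filtration G (Suc m)"
  then obtain f where f: "lifts x f" "f \<in> J (Suc m)" using gamma_filtration_lifts by blast
  show "component m x = \<zero>\<^bsub>TR\<^esub>" unfolding component_lifts[OF f(1)] by (rule degree_part_zero[OF f(2)])
qed

text \<open>Since \<gamma>^1 is the identity, the Chern class is the class of y = \<rho> - 1. The
  k-th unit vector is the exponent vector of \<rho>, so y lifts to (1 + \<open>uvar k\<close>) - 1,
  which is already homogeneous of degree 1.\<close>

lemma chern_class_linear:
  assumes k: "k < n"
  defines "\<rho> \<equiv> \<lambda>x\<in>carrier G. \<chi> k (x k)"
  shows "\<exists>y \<in> gamma_filtration G 1. chern_class G 1 \<rho> = homogeneous CR (gamma_filtration G) 1 y \<and>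
    component 1 y = truncated_var Fp {..<n} q k"
proof -
  let ?a = "\<lambda>l. if l = k then 1 else 0 :: nat"
  have "(\<Prod>l<n. \<chi> l (x l) ^ ?a l) = \<chi> k (x k)" for x :: "nat \<Rightarrow> 'a"
  proof -
    have "(\<Prod>l<n. \<chi> l (x l) ^ ?a l) = (\<Prod>l<n. if l = k then \<chi> k (x k) else 1)"
      by (rule prod.cong) auto
    then show ?thesis using k by simp
  qed
  then have \<rho>: "\<rho> = \<sigma> ?a" unfolding \<rho>_def \<sigma>_def by (simp only:)
  have v: "vmon ?a = 1 + uvar k" by (rule vmon_unit) (use k in simp_all)
  define y where "y = \<rho> \<ominus>\<^bsub>CR\<^esub> add_pow CR (augmentation G \<rho>) \<one>\<^bsub>CR\<^esub>"
  have aug: "augmentation G \<rho> = 1" by (rule augmentation_eq) (simp add: \<rho> \<sigma>_one)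
  have \<rho>c: "\<rho> \<in> carrier CR" unfolding \<rho> carrier_character_ring using lifts_\<sigma> by blast
  have pc: "add_pow CR (1::int) \<one>\<^bsub>CR\<^esub> \<in> carrier CR" by simp
  have yc: "y \<in> carrier CR" unfolding y_def aug using \<rho>c pc by (rule CR.minus_closed)
  have y: "y g = \<sigma> ?a g - 1" if g: "g \<in> carrier G" for g
    using g CR_add_pow[OF g, of 1] CR_minus[OF pc]
    by (simp add: y_def aug[unfolded \<rho>] a_minus_def CR_simps(1) \<rho> del: CR.add.int_pow_1)
  have "lifts y (vmon ?a - 1)"
    by (rule lifts_cong[OF lifts_\<sigma>_minus_one CR_ext[OF yc]]) (simp add: y)
  then have lifts_y: "lifts y (uvar k)" by (simp add: v)
  have "y \<in> augmentation_ideal G" using yc by (simp add: augmentation_ideal_iff y \<sigma>_one)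
  then have "gamma_product G [(1, y)] \<in> gamma_gens 1"
    unfolding gamma_gens_def by (intro CollectI exI[of _ "[(1, y)]"]) simp
  moreover have "gamma_product G [(1, y)] = y"
    unfolding gamma_product_Cons gamma_product_Nil gamma_op_1[OF yc] using yc by simp
  ultimately have "y \<in> gamma_filtration G 1" unfolding gamma_filtration_eq by (metis generate.incl)
  moreover have "chern_class G 1 \<rho> = homogeneous CR (gamma_filtration G) 1 y"
    unfolding chern_class_def y_def[symmetric] gamma_op_1[OF yc] ..
  moreover have "component 1 y = truncated_var Fp {..<n} q k"
    unfolding component_lifts[OF lifts_y] by (rule degree_part_uvar) (use k in simp)
  ultimately show ?thesis by blast
qed

lemma tensor_graded_character_ring_hom:
  "\<exists>h \<in> Ring.ring_hom (tensor_ring (graded_character_ring G) Fp) TR.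
     \<forall>k<n. h (pure_tensor (graded_character_ring G) Fp (chern_class G 1 (\<lambda>x\<in>carrier G. \<chi> k (x k)))
         \<one>\<^bsub>Fp\<^esub>)
       = truncated_var Fp {..<n} q k"
proof -
  interpret F: ring_filtration CR "gamma_filtration G" by (rule gamma_ring_filtration)
  interpret TR: cring TR by (rule cring_TR)
  let ?A = "graded_character_ring G"
  obtain f where f: "f \<in> Ring.ring_hom ?A TR"
    and f_hom: "\<And>m x. x \<in> gamma_filtration G m \<Longrightarrow> f (homogeneous CR (gamma_filtration G) m x) =
        component m x"
    using graded_character_ring_hom by blast
  have "\<exists>h \<in> Ring.ring_hom (tensor_ring ?A Fp) TR. \<forall>a\<in>carrier ?A. \<forall>b\<in>carrier Fp.
      h (pure_tensor ?A Fp a b) = f a \<otimes>\<^bsub>TR\<^esub> trunc (Poly_Mapping.single 0 b)"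
  proof (rule tensor_ring_hom[OF cring_TR _ _ _ res.ring_axioms f trunc_const_hom])
    show "\<one>\<^bsub>?A\<^esub> \<in> carrier ?A"
      unfolding graded_character_ring_def F.one_graded_ring
          by (rule F.homogeneous_closed[OF F.filtration_one])
  qed (simp_all add: graded_character_ring_def F.graded_ring_mult_closed F.graded_ring_add_closed)
  then obtain h where h: "h \<in> Ring.ring_hom (tensor_ring ?A Fp) TR"
    and h_pure: "\<And>a b. a \<in> carrier ?A \<Longrightarrow> b \<in> carrier Fp \<Longrightarrow>
      h (pure_tensor ?A Fp a b) = f a \<otimes>\<^bsub>TR\<^esub> trunc (Poly_Mapping.single 0 b)"
    by blast
  have "h (pure_tensor ?A Fp (chern_class G 1 (\<lambda>x\<in>carrier G. \<chi> k (x k))) \<one>\<^bsub>Fp\<^esub>)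
      = truncated_var Fp {..<n} q k" if k: "k < n" for k
  proof -
    obtain y where y: "y \<in> gamma_filtration G 1"
      "chern_class G 1 (\<lambda>x\<in>carrier G. \<chi> k (x k)) = homogeneous CR (gamma_filtration G) 1 y"
      "component 1 y = truncated_var Fp {..<n} q k"
      using chern_class_linear[OF k] by blast
    have "homogeneous CR (gamma_filtration G) 1 y \<in> carrier ?A"
      unfolding graded_character_ring_def by (rule F.homogeneous_closed[OF y(1)])
    then have "h (pure_tensor ?A Fp (chern_class G 1 (\<lambda>x\<in>carrier G. \<chi> k (x k))) \<one>\<^bsub>Fp\<^esub>)
        = component 1 y \<otimes>\<^bsub>TR\<^esub> trunc (Poly_Mapping.single 0 \<one>\<^bsub>Fp\<^esub>)"
      unfolding y(2) by (simp only: h_pure res.one_closed f_hom[OF y(1)])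
    also have "trunc (Poly_Mapping.single 0 \<one>\<^bsub>Fp\<^esub>) = \<one>\<^bsub>TR\<^esub>"
      using ring_hom_one[OF trunc_const_hom] .
    also have "component 1 y \<otimes>\<^bsub>TR\<^esub> \<one>\<^bsub>TR\<^esub> = component 1 y"
      using ring_filtration.filtration_closed by (simp add: component_def degree_part_closed)
    finally show ?thesis by (simp only: y(3))
  qed
  then show ?thesis using h by blast
qed

end

theorem theorem5p3:
  fixes p n :: nat and e :: "nat \<Rightarrow> nat"
    and C :: "nat \<Rightarrow> 'a monoid" and g :: "nat \<Rightarrow> 'a"
    and \<chi> :: "nat \<Rightarrow> 'a \<Rightarrow> complex" and \<rho> :: "nat \<Rightarrow> (nat \<Rightarrow> 'a) \<Rightarrow> complex"
    and G :: "(nat \<Rightarrow> 'a) monoid"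
  assumes "prime p"
    and "\<And>k. k < n \<Longrightarrow> 1 \<le> e k"
    and "\<And>k. k < n \<Longrightarrow> group (C k)"
    and "\<And>k. k < n \<Longrightarrow> g k \<in> carrier (C k) \<and> carrier (C k) = generate (C k) {g k}"
    and "\<And>k. k < n \<Longrightarrow> Coset.order (C k) = p ^ e k"
    and "G = product_group {..<n} C"
    and "\<And>k. k < n \<Longrightarrow> \<chi> k \<in> linear_characters (C k)"
    and "\<And>k. k < n \<Longrightarrow> \<chi> k (g k) = exp (2 * complex_of_real pi * \<i> / of_nat (p ^ e k))"
    and "\<And>k. k < n \<Longrightarrow> \<rho> k = (\<lambda>x\<in>carrier G. \<chi> k (x k))"
  shows "\<exists>h \<in> Ring.ring_hom
            (tensor_ring (graded_character_ring G) (residue_ring (int p)))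
            (truncated_poly_ring (residue_ring (int p)) {..<n} (\<lambda>k. p ^ e k)).
          \<forall>k<n. h (pure_tensor (graded_character_ring G) (residue_ring (int p))
                      (chern_class G 1 (\<rho> k)) \<one>\<^bsub>residue_ring (int p)\<^esub>)
                = truncated_var (residue_ring (int p)) {..<n} (\<lambda>k. p ^ e k) k"
proof -
  interpret cp: cyclic_product p n e C g \<chi>
    by (rule cyclic_product.intro) (use assms in auto)
  have "cp.G = G" by (simp only: cp.G_def assms(6))
  with cp.tensor_graded_character_ring_hom obtain h
    where "h \<in> Ring.ring_hom (tensor_ring (graded_character_ring G) (residue_ring (int p)))
        (truncated_poly_ring (residue_ring (int p)) {..<n} (\<lambda>k. p ^ e k))"
      "\<forall>k<n. h (pure_tensor (graded_character_ring G) (residue_ring (int p))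
          (chern_class G 1 (\<lambda>x\<in>carrier G. \<chi> k (x k))) \<one>\<^bsub>residue_ring (int p)\<^esub>)
        = truncated_var (residue_ring (int p)) {..<n} (\<lambda>k. p ^ e k) k"
    by auto
  then show ?thesis using assms(9) by (intro bexI[of _ h]) auto
qed

end
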